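(* Let $\Gamma$ be a discrete group and $\pi$ a unitary representation of $\Gamma$. Then the action $\Gamma\curvearrowright\mathcal{B}_\pi$ extends to an action of $\mathbf{aut}_\pi(\Gamma)$ on $\mathcal{B}_\pi$ by $*$-automorphisms; that is, there is a group homomorphism $\alpha\mapsto\Phi_\alpha$ from $\mathbf{aut}_\pi(\Gamma)$ to $\mathrm{Aut}(\mathcal{B}_\pi)$ such that for every $g\in\Gamma$, if $\alpha_g$ denotes the inner automorphism $h\mapsto ghg^{-1}$ of $\Gamma$, then $\Phi_{\alpha_g}$ is the automorphism by which $g$ acts on $\mathcal{B}_\pi$.
   Context: For a unitary representation $\pi:\Gamma\to\mathcal{U}(\mathcal{H}_\pi)$, $\Gamma$ acts on $B(\mathcal{H}_\pi)$ by $g\cdot x=\pi(g)x\pi(g^{-1})$. A $\Gamma$-map between operator systems carrying $\Gamma$-actions is a unital completely positive $\Gamma$-equivariant linear map. Furstenberg--Hamana (FH) boundary: on the set $\mathcal{G}$ of all $\Gamma$-maps $\phi:B(\mathcal{H}_\pi)\to B(\mathcal{H}_\pi)$ put the preorder $\phi\le\psi$ iff $\|\phi(x)\|\le\|\psi(x)\|$ for all $x$. Then $\mathcal{G}$ has minimal elements, every minimal element is idempotent, and its image is unique up to bijective completely isometric $\Gamma$-maps. $\mathcal{B}_\pi$ is the image of a minimal $\phi\in\mathcal{G}$, with the Choi--Effros product $a\cdot b=\phi(ab)$ and the restricted $\Gamma$-action; it is a $\Gamma$-$C^*$-algebra. $C^*_\pi(\Gamma)\subseteq B(\mathcal{H}_\pi)$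 is the norm-closed span of $\pi(\Gamma)$. An automorphism $\alpha$ of $\Gamma$ is a $\pi$-automorphism if it extends to $C^*_\pi(\Gamma)$, i.e. there is a $*$-automorphism of $C^*_\pi(\Gamma)$ sending $\pi(g)$ to $\pi(\alpha(g))$ for all $g\in\Gamma$. $\mathbf{aut}_\pi(\Gamma)$ is the group of all $\pi$-automorphisms; it is a subgroup of $\mathrm{Aut}(\Gamma)$ containing all inner automorphisms. The center of $\Gamma$ acts trivially on $\mathcal{B}_\pi$, so the $\Gamma$-action factors through the group $\Gamma/\mathcal{Z}(\Gamma)$ of inner automorphisms. *)

theory Defs
  imports "HOL-Analysis.Analysis" "HOL-Algebra.Bij"
begin

text \<open>
  Complex Hilbert spaces. The complex structure is put on top of the library class of real inner
  product spaces, so that norm, topology and completeness are the library's; the real inner product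
  is the real part of the complex one. The inner product is linear in the second argument.
\<close>

class chilbert_space = real_inner + banach +
  fixes scaleC :: "complex \<Rightarrow> 'a \<Rightarrow> 'a" (infixr \<open>*\<^sub>C\<close> 75)
    and cinner :: "'a \<Rightarrow> 'a \<Rightarrow> complex"
  assumes scaleC_add_right: "a *\<^sub>C (x + y) = a *\<^sub>C x + a *\<^sub>C y"
    and scaleC_add_left: "(a + b) *\<^sub>C x = a *\<^sub>C x + b *\<^sub>C x"
    and scaleC_scaleC: "a *\<^sub>C b *\<^sub>C x = (a * b) *\<^sub>C x"
    and scaleR_scaleC: "r *\<^sub>R x = complex_of_real r *\<^sub>C x"
    and cinner_commute: "cinner x y = cnj (cinner y x)"
    and cinner_add_right: "cinner x (y + z) = cinner x y + cinner x z"
    and cinner_scaleC_right: "cinner x (a *\<^sub>C y) = a * cinner x y"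
    and inner_eq_Re_cinner: "inner x y = Re (cinner x y)"

instantiation complex :: chilbert_space
begin
definition scaleC_complex :: "complex \<Rightarrow> complex \<Rightarrow> complex" where "scaleC_complex a x = a * x"
definition cinner_complex :: "complex \<Rightarrow> complex \<Rightarrow> complex" where "cinner_complex x y = cnj x * y"
instance
  by standard
    (auto simp: scaleC_complex_def cinner_complex_def algebra_simps scaleR_conv_of_real
      inner_complex_def)
end

lemma scaleC_one: "1 *\<^sub>C (x :: 'h::chilbert_space) = x"
  using scaleR_scaleC[of 1 x] by simp

lemma norm_scaleC: "norm (a *\<^sub>C x) = cmod a * norm (x :: 'h::chilbert_space)"
proof -
  have "cinner (a *\<^sub>C x) (a *\<^sub>C x) = a * cnj (cinner x (a *\<^sub>C x))"
    by (subst cinner_scaleC_right, subst cinner_commute) (rule refl)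
  also have "\<dots> = (a * cnj a) * cnj (cinner x x)"
    by (simp add: cinner_scaleC_right)
  also have "\<dots> = complex_of_real ((cmod a)\<^sup>2) * cinner x x"
    by (simp only: complex_norm_square cinner_commute[of x x, symmetric])
  finally have "inner (a *\<^sub>C x) (a *\<^sub>C x) = (cmod a)\<^sup>2 * inner x x"
    by (simp add: inner_eq_Re_cinner)
  then show ?thesis
    by (simp add: norm_eq_sqrt_inner real_sqrt_mult)
qed

lemma bounded_linear_scaleC: "bounded_linear (\<lambda>x :: 'h::chilbert_space. a *\<^sub>C x)"
proof (rule bounded_linear_intro)
  show "a *\<^sub>C (x + y) = a *\<^sub>C x + a *\<^sub>C y" for x y :: 'h
    by (rule scaleC_add_right)
  show "a *\<^sub>C (r *\<^sub>R x) = r *\<^sub>R (a *\<^sub>C x)" for r and x :: 'h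
    by (simp add: scaleR_scaleC scaleC_scaleC mult.commute)
  show "norm (a *\<^sub>C x) \<le> norm x * cmod a" for x :: 'h
    by (simp add: norm_scaleC mult.commute)
qed

text \<open>
  The library type of bounded operators consists of the real-linear ones; \<open>bounded_ops\<close> is
  $B(\mathcal H)$. Its operator norm is the one of the library.
\<close>

definition bounded_ops :: "('h::chilbert_space \<Rightarrow>\<^sub>L 'h) set" where
  "bounded_ops = {T. \<forall>a x. blinfun_apply T (a *\<^sub>C x) = a *\<^sub>C blinfun_apply T x}"

lift_definition scaleC_op :: "complex \<Rightarrow> ('h::chilbert_space \<Rightarrow>\<^sub>L 'h) \<Rightarrow> 'h \<Rightarrow>\<^sub>L 'h"
  is "\<lambda>a T x. a *\<^sub>C T x"
  by (rule bounded_linear_compose[OF bounded_linear_scaleC])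

interpretation cop: vector_space "scaleC_op :: complex \<Rightarrow> ('h::chilbert_space \<Rightarrow>\<^sub>L 'h) \<Rightarrow> 'h \<Rightarrow>\<^sub>L 'h"
proof
  fix a b :: complex and S T :: "'h \<Rightarrow>\<^sub>L 'h"
  show "scaleC_op a (S + T) = scaleC_op a S + scaleC_op a T"
    by (rule blinfun_eqI) (simp add: scaleC_op.rep_eq blinfun.add_left scaleC_add_right)
  show "scaleC_op (a + b) T = scaleC_op a T + scaleC_op b T"
    by (rule blinfun_eqI) (simp add: scaleC_op.rep_eq blinfun.add_left scaleC_add_left)
  show "scaleC_op a (scaleC_op b T) = scaleC_op (a * b) T"
    by (rule blinfun_eqI) (simp add: scaleC_op.rep_eq blinfun.add_left scaleC_scaleC)
  show "scaleC_op 1 T = T"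
    by (rule blinfun_eqI) (simp add: scaleC_op.rep_eq scaleC_one)
qed

definition adj_op :: "('h::chilbert_space \<Rightarrow>\<^sub>L 'h) \<Rightarrow> 'h \<Rightarrow>\<^sub>L 'h" where
  "adj_op T = (THE S. \<forall>x y. cinner (blinfun_apply S x) y = cinner x (blinfun_apply T y))"

definition unitary_group :: "('h::chilbert_space \<Rightarrow>\<^sub>L 'h) monoid" where
  "unitary_group =
    \<lparr>carrier = {U \<in> bounded_ops. adj_op U o\<^sub>L U = id_blinfun \<and> U o\<^sub>L adj_op U = id_blinfun},
     mult = (o\<^sub>L), one = id_blinfun\<rparr>"

definition unitary_rep ::
  "('g, 'm) monoid_scheme \<Rightarrow> ('g \<Rightarrow> ('h::chilbert_space \<Rightarrow>\<^sub>L 'h)) \<Rightarrow> bool" where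
  "unitary_rep G \<pi> \<longleftrightarrow> group G \<and> \<pi> \<in> hom G unitary_group"

definition op_act ::
  "('g, 'm) monoid_scheme \<Rightarrow> ('g \<Rightarrow> ('h::chilbert_space \<Rightarrow>\<^sub>L 'h)) \<Rightarrow> 'g \<Rightarrow> ('h \<Rightarrow>\<^sub>L 'h) \<Rightarrow> 'h \<Rightarrow>\<^sub>L 'h" where
  "op_act G \<pi> g T = \<pi> g o\<^sub>L T o\<^sub>L \<pi> (inv\<^bsub>G\<^esub> g)"

definition clinear_on ::
  "('h::chilbert_space \<Rightarrow>\<^sub>L 'h) set \<Rightarrow> (('h \<Rightarrow>\<^sub>L 'h) \<Rightarrow> ('h \<Rightarrow>\<^sub>L 'h)) \<Rightarrow> bool" where
  "clinear_on A \<phi> \<longleftrightarrow> (\<forall>S\<in>A. \<forall>T\<in>A. \<phi> (S + T) = \<phi> S + \<phi> T) \<and>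
    (\<forall>a. \<forall>T\<in>A. \<phi> (scaleC_op a T) = scaleC_op a (\<phi> T))"

text \<open>
  An $n \times n$ matrix over $B(\mathcal H)$ is a function of two indices below \<open>n\<close>. It is
  positive in $M_n(B(\mathcal H)) = B(\mathcal H^n)$ iff its quadratic form takes values in
  $[0,\infty)$; values of the functions at indices from \<open>n\<close> on are irrelevant.
\<close>

definition positive_op_matrix :: "nat \<Rightarrow> (nat \<Rightarrow> nat \<Rightarrow> ('h::chilbert_space \<Rightarrow>\<^sub>L 'h)) \<Rightarrow> bool" where
  "positive_op_matrix n A \<longleftrightarrow>
    (\<forall>x. (\<Sum>i<n. \<Sum>j<n. cinner (x i) (blinfun_apply (A i j) (x j))) \<in> \<real>\<^sub>\<ge>\<^sub>0)"

definition completely_positive ::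
  "(('h::chilbert_space \<Rightarrow>\<^sub>L 'h) \<Rightarrow> ('h \<Rightarrow>\<^sub>L 'h)) \<Rightarrow> bool" where
  "completely_positive \<phi> \<longleftrightarrow>
    (\<forall>n A. (\<forall>i<n. \<forall>j<n. A i j \<in> bounded_ops) \<and> positive_op_matrix n A \<longrightarrow>
      positive_op_matrix n (\<lambda>i j. \<phi> (A i j)))"

text \<open>
  $\Gamma$-maps $B(\mathcal H_\pi) \to B(\mathcal H_\pi)$. Values outside \<open>bounded_ops\<close> are
  unconstrained and never used below.
\<close>

definition gamma_maps ::
  "('g, 'm) monoid_scheme \<Rightarrow> ('g \<Rightarrow> ('h::chilbert_space \<Rightarrow>\<^sub>L 'h)) \<Rightarrow> (('h \<Rightarrow>\<^sub>L 'h) \<Rightarrow> ('h \<Rightarrow>\<^sub>L 'h)) set" where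
  "gamma_maps G \<pi> = {\<phi>. \<phi> \<in> bounded_ops \<rightarrow> bounded_ops \<and> clinear_on bounded_ops \<phi> \<and>
    \<phi> id_blinfun = id_blinfun \<and> completely_positive \<phi> \<and>
    (\<forall>g\<in>carrier G. \<forall>T\<in>bounded_ops. \<phi> (op_act G \<pi> g T) = op_act G \<pi> g (\<phi> T))}"

definition gamma_map_le ::
  "(('h::chilbert_space \<Rightarrow>\<^sub>L 'h) \<Rightarrow> ('h \<Rightarrow>\<^sub>L 'h)) \<Rightarrow> (('h \<Rightarrow>\<^sub>L 'h) \<Rightarrow> ('h \<Rightarrow>\<^sub>L 'h)) \<Rightarrow> bool" where
  "gamma_map_le \<phi> \<psi> \<longleftrightarrow> (\<forall>T\<in>bounded_ops. norm (\<phi> T) \<le> norm (\<psi> T))"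

definition minimal_gamma_map ::
  "('g, 'm) monoid_scheme \<Rightarrow> ('g \<Rightarrow> ('h::chilbert_space \<Rightarrow>\<^sub>L 'h)) \<Rightarrow> (('h \<Rightarrow>\<^sub>L 'h) \<Rightarrow> ('h \<Rightarrow>\<^sub>L 'h)) \<Rightarrow> bool" where
  "minimal_gamma_map G \<pi> \<phi> \<longleftrightarrow> \<phi> \<in> gamma_maps G \<pi> \<and>
    (\<forall>\<psi>\<in>gamma_maps G \<pi>. gamma_map_le \<psi> \<phi> \<longrightarrow> gamma_map_le \<phi> \<psi>)"

text \<open>
  The Furstenberg--Hamana boundary as realised by a minimal $\Gamma$-map $\varphi$: underlying
  space and Choi--Effros product. Linear structure and involution are those of $B(\mathcal H_\pi)$.
\<close>

definition fh_boundary ::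
  "(('h::chilbert_space \<Rightarrow>\<^sub>L 'h) \<Rightarrow> ('h \<Rightarrow>\<^sub>L 'h)) \<Rightarrow> ('h \<Rightarrow>\<^sub>L 'h) set" where
  "fh_boundary \<phi> = \<phi> ` bounded_ops"

definition choi_effros ::
  "(('h::chilbert_space \<Rightarrow>\<^sub>L 'h) \<Rightarrow> ('h \<Rightarrow>\<^sub>L 'h)) \<Rightarrow> ('h \<Rightarrow>\<^sub>L 'h) \<Rightarrow> ('h \<Rightarrow>\<^sub>L 'h) \<Rightarrow> 'h \<Rightarrow>\<^sub>L 'h" where
  "choi_effros \<phi> S T = \<phi> (S o\<^sub>L T)"

text \<open>
  $*$-automorphisms of a self-adjoint linear space \<open>A\<close> of operators that is an algebra for the
  product \<open>m\<close>, which need not be composition.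
\<close>

definition star_auto ::
  "('h::chilbert_space \<Rightarrow>\<^sub>L 'h) set \<Rightarrow> (('h \<Rightarrow>\<^sub>L 'h) \<Rightarrow> ('h \<Rightarrow>\<^sub>L 'h) \<Rightarrow> ('h \<Rightarrow>\<^sub>L 'h)) \<Rightarrow>
    (('h \<Rightarrow>\<^sub>L 'h) \<Rightarrow> ('h \<Rightarrow>\<^sub>L 'h)) set" where
  "star_auto A m = {F \<in> Bij A. clinear_on A F \<and>
    (\<forall>S\<in>A. \<forall>T\<in>A. F (m S T) = m (F S) (F T)) \<and> (\<forall>T\<in>A. F (adj_op T) = adj_op (F T))}"

definition StarAutoGroup ::
  "('h::chilbert_space \<Rightarrow>\<^sub>L 'h) set \<Rightarrow> (('h \<Rightarrow>\<^sub>L 'h) \<Rightarrow> ('h \<Rightarrow>\<^sub>L 'h) \<Rightarrow> ('h \<Rightarrow>\<^sub>L 'h)) \<Rightarrow>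
    (('h \<Rightarrow>\<^sub>L 'h) \<Rightarrow> ('h \<Rightarrow>\<^sub>L 'h)) monoid" where
  "StarAutoGroup A m = BijGroup A\<lparr>carrier := star_auto A m\<rparr>"

definition cstar_rep ::
  "('g, 'm) monoid_scheme \<Rightarrow> ('g \<Rightarrow> ('h::chilbert_space \<Rightarrow>\<^sub>L 'h)) \<Rightarrow> ('h \<Rightarrow>\<^sub>L 'h) set" where
  "cstar_rep G \<pi> = closure (cop.span (\<pi> ` carrier G))"

definition rep_auto ::
  "('g, 'm) monoid_scheme \<Rightarrow> ('g \<Rightarrow> ('h::chilbert_space \<Rightarrow>\<^sub>L 'h)) \<Rightarrow> ('g \<Rightarrow> 'g) set" where
  "rep_auto G \<pi> = {\<alpha> \<in> auto G.
    \<exists>\<theta>\<in>star_auto (cstar_rep G \<pi>) (o\<^sub>L). \<forall>g\<in>carrier G. \<theta> (\<pi> g) = \<pi> (\<alpha> g)}"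

definition RepAutoGroup ::
  "('g, 'm) monoid_scheme \<Rightarrow> ('g \<Rightarrow> ('h::chilbert_space \<Rightarrow>\<^sub>L 'h)) \<Rightarrow> ('g \<Rightarrow> 'g) monoid" where
  "RepAutoGroup G \<pi> = AutoGroup G\<lparr>carrier := rep_auto G \<pi>\<rparr>"

definition inner_auto :: "('g, 'm) monoid_scheme \<Rightarrow> 'g \<Rightarrow> 'g \<Rightarrow> 'g" where
  "inner_auto G g = (\<lambda>h\<in>carrier G. g \<otimes>\<^bsub>G\<^esub> h \<otimes>\<^bsub>G\<^esub> inv\<^bsub>G\<^esub> g)"

end

theory Submission
  imports Defs "HOL-Library.Poly_Mapping"
begin

text \<open>
  Let \<open>\<alpha>\<close> be an automorphism of \<open>\<Gamma>\<close> that extends to a *-automorphism \<open>\<theta>\<close> of the C*-algebra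
  generated by \<open>\<pi>(\<Gamma>)\<close>. By Arveson's theorem \<open>\<theta>\<close> extends to a unital completely positive map
  \<open>\<Theta>\<close> on B(H) (lemma \<open>arveson_extension\<close>). As \<open>\<Theta>\<close> maps the unitaries \<open>\<pi> g\<close> to the unitaries
  \<open>\<pi> (\<alpha> g)\<close>, these lie in its multiplicative domain, and \<open>\<Theta>\<close> intertwines the action of \<open>\<Gamma>\<close>
  with its twist by \<open>\<alpha>\<close> (\<open>rep_auto_extension\<close>). The automorphism attached to \<open>\<alpha>\<close> is the
  restriction of \<open>\<phi> \<circ> \<Theta>\<close> to the range of \<open>\<phi>\<close>.

  Everything else follows from rigidity: \<open>\<phi> \<psi> \<phi> = \<phi>\<close> for every \<open>\<Gamma>\<close>-map \<open>\<psi>\<close>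
  (\<open>minimal_gamma_map_rigid\<close>). Applied to the maps of \<open>\<alpha>\<close> and of its inverse, it shows that the
  restriction is a bijection whose inverse is of the same kind, and that it does not depend on the
  choice of \<open>\<Theta>\<close> (\<open>induced_unique\<close>). A unital completely positive bijection with such an inverse is
  multiplicative for the Choi--Effros product, since the Kadison--Schwarz inequalities for both maps
  become equalities (\<open>ucp_inverse_multiplicative\<close>). Uniqueness gives compatibility with
  composition, and identifies the automorphism of an inner automorphism with the action of the group
  element, because conjugation by \<open>\<pi> g\<close> is itself equivariant along that inner automorphism.

  Arveson's theorem is obtained from a single application of M. Riesz's extension theorem for positive
  functionals. A linear map from a *-algebra \<open>A\<close> of operators into B(H) defines a functional on the tensor
  product of \<open>A\<close> with \<open>H\<close> and its conjugate, and complete positivity is nonnegativity of this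
  functional on a cone. The needed complete positivity of \<open>\<theta>\<close> follows from the existence of square
  roots in \<open>A\<close> and a decomposition into cyclic subspaces (\<open>hom_form_positive\<close>).
\<close>

section \<open>Projections, the Riesz representation, and adjoints\<close>

lemma linear_coefficient_eq_0:
  fixes a b :: real
  assumes "\<And>t. 0 \<le> a * t + b * t\<^sup>2"
  shows "a = 0"
proof (rule ccontr)
  assume a: "a \<noteq> 0"
  define c where "c = \<bar>b\<bar> + 1"
  have c: "c > 0" "b \<le> c - 1" by (auto simp: c_def)
  have "0 \<le> a * (- (a / (2 * c))) + b * (- (a / (2 * c)))\<^sup>2" by (rule assms)
  also have "\<dots> \<le> a * (- (a / (2 * c))) + c * (- (a / (2 * c)))\<^sup>2"
    by (intro add_left_mono mult_right_mono) (use c in auto)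
  also have "\<dots> = - (a\<^sup>2 / (4 * c))"
    using c by (simp add: field_simps power2_eq_square)
  finally show False using a c by (simp add: divide_le_0_iff field_simps)
qed

lemma orthogonal_projection_exists:
  fixes x :: "'a::{real_inner,banach}"
  assumes K: "subspace K" "closed K"
  shows "\<exists>y\<in>K. \<forall>k\<in>K. inner (x - y) k = 0"
proof -
  define d where "d = (INF k\<in>K. norm (x - k))"
  have K0: "0 \<in> K" using K by (simp add: subspace_0)
  have bdd: "bdd_below ((\<lambda>k. norm (x - k)) ` K)" by (rule bdd_belowI[of _ 0]) auto
  have dle: "d \<le> norm (x - k)" if "k \<in> K" for k
    unfolding d_def by (rule cINF_lower[OF bdd that])
  have d0: "0 \<le> d" unfolding d_def by (rule cINF_greatest) (use K0 in auto)
  have "\<exists>k\<in>K. (norm (x - k))\<^sup>2 < d\<^sup>2 + 1 / (real n + 1)" for n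
  proof -
    have "d < sqrt (d\<^sup>2 + 1 / (real n + 1))"
      by (rule real_less_rsqrt) simp
    then obtain k where "k \<in> K" "norm (x - k) < sqrt (d\<^sup>2 + 1 / (real n + 1))"
      using K0 bdd unfolding d_def by (subst (asm) cINF_less_iff) auto
    moreover have "(norm (x - k))\<^sup>2 < (sqrt (d\<^sup>2 + 1 / (real n + 1)))\<^sup>2"
      using calculation by (intro power_strict_mono) auto
    ultimately show ?thesis by (auto intro!: bexI[of _ k])
  qed
  then obtain k where k: "\<And>n. k n \<in> K" "\<And>n. (norm (x - k n))\<^sup>2 < d\<^sup>2 + 1 / (real n + 1)"
    by metis
  have gap: "(norm (k m - k n))\<^sup>2 \<le> 2 / (real m + 1) + 2 / (real n + 1)" for m n
  proof -
    have "(1/2) *\<^sub>R (k m + k n) \<in> K" using K k by (intro subspace_scale subspace_add) auto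
    then have "d\<^sup>2 \<le> (norm (x - (1/2) *\<^sub>R (k m + k n)))\<^sup>2"
      using dle d0 by (intro power_mono) auto
    moreover have "(norm (k m - k n))\<^sup>2 = 2 * (norm (x - k m))\<^sup>2 + 2 * (norm (x - k n))\<^sup>2
        - 4 * (norm (x - (1/2) *\<^sub>R (k m + k n)))\<^sup>2"
      by (simp add: power2_norm_eq_inner inner_simps inner_commute algebra_simps)
    ultimately show ?thesis using k(2)[of m] k(2)[of n] by simp
  qed
  have "Cauchy k"
  proof (rule CauchyI)
    fix e :: real assume e: "0 < e"
    obtain N where N: "1 / (real N + 1) < e\<^sup>2 / 4"
      using reals_Archimedean[of "e\<^sup>2 / 4"] e by (auto simp: inverse_eq_divide add.commute)
    have "norm (k m - k n) < e" if "m \<ge> N" "n \<ge> N" for m n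
    proof -
      have "1 / (real m + 1) \<le> 1 / (real N + 1)" "1 / (real n + 1) \<le> 1 / (real N + 1)"
        using that by (auto intro!: divide_left_mono)
      then have "(norm (k m - k n))\<^sup>2 < e\<^sup>2"
        using gap[of m n] N by simp
      then show ?thesis using e by (simp add: power2_less_imp_less)
    qed
    then show "\<exists>M. \<forall>m\<ge>M. \<forall>n\<ge>M. norm (k m - k n) < e" by blast
  qed
  then obtain y where y: "k \<longlonglongrightarrow> y" using Cauchy_convergent convergentD by blast
  have yK: "y \<in> K" using closed_sequentially[OF K(2)] k y by blast
  have "(norm (x - y))\<^sup>2 \<le> d\<^sup>2"
  proof (rule LIMSEQ_le[of _ _ "\<lambda>n. d\<^sup>2 + 1 / (real n + 1)"])
    show "(\<lambda>n. (norm (x - k n))\<^sup>2) \<longlonglongrightarrow> (norm (x - y))\<^sup>2" using y by (intro tendsto_intros)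
    have "(\<lambda>n. d\<^sup>2 + 1 / (real (Suc n))) \<longlonglongrightarrow> d\<^sup>2 + 0"
      by (intro tendsto_intros lim_inverse_n'[THEN LIMSEQ_Suc])
    then show "(\<lambda>n. d\<^sup>2 + 1 / (real n + 1)) \<longlonglongrightarrow> d\<^sup>2" by (simp add: add.commute)
    show "\<exists>N. \<forall>n\<ge>N. (norm (x - k n))\<^sup>2 \<le> d\<^sup>2 + 1 / (real n + 1)"
      using k(2) less_imp_le by blast
  qed
  then have min: "(norm (x - y))\<^sup>2 \<le> (norm (x - z))\<^sup>2" if "z \<in> K" for z
    using dle[OF that] d0 power_mono[of d "norm (x - z)" 2] by linarith
  have "inner (x - y) z = 0" if z: "z \<in> K" for z
  proof -
    have "0 \<le> (- 2 * inner (x - y) z) * t + (norm z)\<^sup>2 * t\<^sup>2" for t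
    proof -
      have "y + t *\<^sub>R z \<in> K" using K yK z by (intro subspace_add subspace_scale)
      from min[OF this] have "(norm (x - y))\<^sup>2 \<le> (norm ((x - y) - t *\<^sub>R z))\<^sup>2"
        by (simp add: algebra_simps)
      also have "\<dots> = (norm (x - y))\<^sup>2 - 2 * t * inner (x - y) z + t\<^sup>2 * (norm z)\<^sup>2"
        unfolding power2_norm_eq_inner
        by (simp add: inner_diff_left inner_diff_right inner_commute[of z x] inner_commute[of z y] power2_eq_square algebra_simps)
      finally show ?thesis by (simp add: algebra_simps)
    qed
    from linear_coefficient_eq_0[OF this] show ?thesis by simp
  qed
  with yK show ?thesis by blast
qed

lemma riesz_representation:
  fixes f :: "'a::{real_inner,banach} \<Rightarrow> real"
  assumes f: "bounded_linear f"
  shows "\<exists>z. \<forall>x. f x = inner z x"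
proof (cases "\<forall>x. f x = 0")
  case True
  then show ?thesis by (intro exI[of _ 0]) simp
next
  case False
  interpret bounded_linear f by (rule f)
  from False obtain x where x: "f x \<noteq> 0" by blast
  have sub: "subspace {k. f k = 0}" by (rule subspaceI) (auto simp: add scaleR zero)
  have clo: "closed {k. f k = 0}" by (intro closed_Collect_eq continuous_intros continuous_on)
  obtain y where y: "f y = 0" "\<And>k. f k = 0 \<Longrightarrow> inner (x - y) k = 0"
    using orthogonal_projection_exists[OF sub clo, of x] by blast
  define w where "w = x - y"
  have fw: "f w \<noteq> 0" using x y by (simp add: w_def diff)
  then have w0: "inner w w \<noteq> 0" using zero by auto
  have "f u = inner ((f w / inner w w) *\<^sub>R w) u" for u
  proof -
    have "inner w (u - (f u / f w) *\<^sub>R w) = 0"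
      unfolding w_def using fw by (intro y(2)) (simp add: diff scaleR w_def)
    then have "inner w u = f u / f w * inner w w" by (simp add: inner_simps)
    then show ?thesis using fw w0 by simp
  qed
  then show ?thesis by blast
qed

text \<open>A bounded real bilinear form is the form of a bounded operator.\<close>

lemma bounded_bilinear_form_operator:
  fixes b :: "'a::{real_inner,banach} \<Rightarrow> 'a \<Rightarrow> real"
  assumes b: "bounded_bilinear b"
  shows "\<exists>R :: 'a \<Rightarrow>\<^sub>L 'a. \<forall>x y. inner x (blinfun_apply R y) = b x y"
proof -
  interpret bounded_bilinear b by (rule b)
  have "\<exists>z. \<forall>x. b x y = inner z x" for y
    by (rule riesz_representation) (rule bounded_linear_left)
  then obtain R where R: "\<And>x y. b x y = inner (R y) x" by metis
  obtain K where K: "\<And>x y. norm (b x y) \<le> norm x * norm y * K" "0 < K"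
    using pos_bounded by blast
  have "bounded_linear R"
  proof (rule bounded_linear_intro[of _ K])
    show "R (x + y) = R x + R y" for x y
      by (rule vector_eq_rdot[THEN iffD1]) (simp add: inner_simps R[symmetric] add_right)
    show "R (r *\<^sub>R x) = r *\<^sub>R R x" for r x
      by (rule vector_eq_rdot[THEN iffD1]) (simp add: inner_simps R[symmetric] scaleR_right)
    show "norm (R x) \<le> norm x * K" for x
    proof (cases "R x = 0")
      case False
      have "norm (R x) * norm (R x) \<le> norm (R x) * (norm x * K)"
        using K(1)[of "R x" x] by (simp add: R power2_norm_eq_inner[symmetric] power2_eq_square mult.assoc)
      then show ?thesis using False by simp
    qed (use K in simp)
  qed
  then show ?thesis
    by (intro exI[of _ "Blinfun R"]) (simp add: bounded_linear_Blinfun_apply R inner_commute)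
qed

lemma cinner_scaleC_left: "cinner (a *\<^sub>C x) y = cnj a * cinner x (y :: 'h::chilbert_space)"
  by (subst (1 2) cinner_commute) (simp add: cinner_scaleC_right)

lemma scaleC_zero_left [simp]: "0 *\<^sub>C (x :: 'h::chilbert_space) = 0"
  using norm_scaleC[of 0 x] by simp

lemma scaleC_zero_right [simp]: "a *\<^sub>C (0 :: 'h::chilbert_space) = 0"
  using norm_scaleC[of a "0::'h"] by simp

lemma scaleC_minus_left: "(- a) *\<^sub>C x = - (a *\<^sub>C (x :: 'h::chilbert_space))"
  using scaleC_add_left[of "-a" a x] by (simp add: eq_neg_iff_add_eq_0)

lemma inner_scaleC_left:
  "inner (a *\<^sub>C x) y = inner x (cnj a *\<^sub>C (y :: 'h::chilbert_space))"
  by (simp add: inner_eq_Re_cinner cinner_scaleC_left cinner_scaleC_right)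

lemma Im_cinner: "Im (cinner x y) = - inner x (\<i> *\<^sub>C (y :: 'h::chilbert_space))"
  by (simp add: inner_eq_Re_cinner cinner_scaleC_right)

lemma cinner_eqI:
  assumes "inner x y = inner x' (y' :: 'h::chilbert_space)"
    and "inner x (\<i> *\<^sub>C y) = inner x' (\<i> *\<^sub>C y')"
  shows "cinner x y = cinner x' y'"
  by (rule complex_eqI) (use assms in \<open>auto simp: inner_eq_Re_cinner[symmetric] Im_cinner\<close>)

lemma bounded_opsD: "T \<in> bounded_ops \<Longrightarrow> blinfun_apply T (a *\<^sub>C x) = a *\<^sub>C blinfun_apply T x"
  by (simp add: bounded_ops_def)

lemma id_in_bounded_ops [simp]: "id_blinfun \<in> bounded_ops"
  by (simp add: bounded_ops_def)

lemma bounded_ops_add: "S \<in> bounded_ops \<Longrightarrow> T \<in> bounded_ops \<Longrightarrow> S + T \<in> bounded_ops"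
  by (simp add: bounded_ops_def blinfun.add_left scaleC_add_right)

lemma bounded_ops_zero [simp]: "0 \<in> bounded_ops"
  by (simp add: bounded_ops_def)

lemma bounded_ops_compose:
  "S \<in> bounded_ops \<Longrightarrow> T \<in> bounded_ops \<Longrightarrow> S o\<^sub>L T \<in> bounded_ops"
  by (simp add: bounded_ops_def)

lemma scaleC_op_apply [simp]: "blinfun_apply (scaleC_op a T) x = a *\<^sub>C blinfun_apply T x"
  by (simp add: scaleC_op.rep_eq)

lemma bounded_ops_scaleC: "T \<in> bounded_ops \<Longrightarrow> scaleC_op a T \<in> bounded_ops"
  by (simp add: bounded_ops_def scaleC_scaleC mult.commute)

lemma scaleR_op: "r *\<^sub>R T = scaleC_op (complex_of_real r) T"
  by (rule blinfun_eqI) (simp add: blinfun.scaleR_left scaleR_scaleC)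

lemma bounded_ops_scaleR: "T \<in> bounded_ops \<Longrightarrow> r *\<^sub>R T \<in> bounded_ops"
  by (simp add: scaleR_op bounded_ops_scaleC)

lemma bounded_ops_minus: "T \<in> bounded_ops \<Longrightarrow> - T \<in> bounded_ops"
  using bounded_ops_scaleR[of T "-1"] by simp

lemma bounded_ops_diff: "S \<in> bounded_ops \<Longrightarrow> T \<in> bounded_ops \<Longrightarrow> S - T \<in> bounded_ops"
  using bounded_ops_add[of S "- T"] bounded_ops_minus[of T] by simp

lemma closed_bounded_ops: "closed (bounded_ops :: ('h::chilbert_space \<Rightarrow>\<^sub>L 'h) set)"
proof -
  have eq: "bounded_ops = (\<Inter>a. \<Inter>x. {T :: 'h \<Rightarrow>\<^sub>L 'h. blinfun_apply T (a *\<^sub>C x) = a *\<^sub>C blinfun_apply T x})"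
    by (auto simp: bounded_ops_def)
  have "closed {T :: 'h \<Rightarrow>\<^sub>L 'h. blinfun_apply T (a *\<^sub>C x) = a *\<^sub>C blinfun_apply T x}" for a x
    by (intro closed_Collect_eq bounded_linear.continuous_on[OF bounded_linear_scaleC]
        continuous_intros)
  then show ?thesis unfolding eq by (intro closed_INT ballI)
qed

lemma blinfun_compose_assoc: "(A o\<^sub>L B) o\<^sub>L C = A o\<^sub>L (B o\<^sub>L C)"
  by (rule blinfun_eqI) simp

lemma blinfun_compose_id: "id_blinfun o\<^sub>L A = A" "A o\<^sub>L id_blinfun = A"
  by (rule blinfun_eqI, simp)+

lemma op_eqI:
  fixes S T :: "'h::chilbert_space \<Rightarrow>\<^sub>L 'h"
  assumes "\<And>x y. inner x (blinfun_apply S y) = inner x (blinfun_apply T y)"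
  shows "S = T"
  by (rule blinfun_eqI) (use assms vector_eq_ldot in blast)

lemma adj_op_unique:
  assumes T: "T \<in> bounded_ops"
    and S: "\<And>x y. inner (blinfun_apply S x) y = inner x (blinfun_apply T y)"
  shows "adj_op T = S"
  unfolding adj_op_def
proof (rule the_equality)
  show "\<forall>x y. cinner (blinfun_apply S x) y = cinner x (blinfun_apply T y)"
    by (intro allI cinner_eqI) (simp_all add: S bounded_opsD[OF T, symmetric])
  show "R = S" if "\<forall>x y. cinner (blinfun_apply R x) y = cinner x (blinfun_apply T y)" for R
    by (rule blinfun_eqI, rule vector_eq_rdot[THEN iffD1])
      (use that in \<open>simp add: S inner_eq_Re_cinner[of "blinfun_apply R _"] inner_eq_Re_cinner[of _ "blinfun_apply T _"]\<close>)
qed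

lemma inner_adj_op:
  fixes T :: "'h::chilbert_space \<Rightarrow>\<^sub>L 'h"
  assumes T: "T \<in> bounded_ops"
  shows "inner (blinfun_apply (adj_op T) x) y = inner x (blinfun_apply T y)"
proof -
  have "bounded_bilinear (\<lambda>x y. inner (blinfun_apply T x) y)"
    by (rule bounded_bilinear.comp1[OF bounded_bilinear_inner blinfun.bounded_linear_right])
  then obtain S :: "'h \<Rightarrow>\<^sub>L 'h" where "\<And>x y. inner x (blinfun_apply S y) = inner (blinfun_apply T x) y"
    using bounded_bilinear_form_operator by blast
  then have S: "\<And>x y. inner (blinfun_apply S x) y = inner x (blinfun_apply T y)"
    by (metis inner_commute)
  with adj_op_unique[OF T, of S] show ?thesis by simp
qed

lemma inner_adj_op': "T \<in> bounded_ops \<Longrightarrow>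
    inner x (blinfun_apply (adj_op T) y) = inner (blinfun_apply T x) y"
  by (metis inner_adj_op inner_commute)

lemma bounded_ops_adj:
  assumes T: "T \<in> bounded_ops"
  shows "adj_op T \<in> bounded_ops"
  unfolding bounded_ops_def
proof (intro CollectI allI)
  fix a x
  show "blinfun_apply (adj_op T) (a *\<^sub>C x) = a *\<^sub>C blinfun_apply (adj_op T) x"
    by (rule vector_eq_rdot[THEN iffD1])
      (simp add: inner_adj_op[OF T] inner_scaleC_left bounded_opsD[OF T, symmetric])
qed

lemma adj_adj_op: "T \<in> bounded_ops \<Longrightarrow> adj_op (adj_op T) = T"
  by (rule adj_op_unique) (simp_all add: bounded_ops_adj inner_adj_op')

lemma adj_op_id [simp]: "adj_op id_blinfun = id_blinfun"
  by (rule adj_op_unique) simp_all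

lemma adj_op_compose:
  "S \<in> bounded_ops \<Longrightarrow> T \<in> bounded_ops \<Longrightarrow> adj_op (S o\<^sub>L T) = adj_op T o\<^sub>L adj_op S"
  by (rule adj_op_unique) (simp_all add: bounded_ops_compose inner_adj_op)

lemma adj_op_add:
  "S \<in> bounded_ops \<Longrightarrow> T \<in> bounded_ops \<Longrightarrow> adj_op (S + T) = adj_op S + adj_op T"
  by (rule adj_op_unique) (simp_all add: bounded_ops_add blinfun.add_left inner_simps inner_adj_op)

lemma adj_op_scaleC: "T \<in> bounded_ops \<Longrightarrow> adj_op (scaleC_op a T) = scaleC_op (cnj a) (adj_op T)"
  by (rule adj_op_unique)
    (simp_all add: bounded_ops_scaleC inner_scaleC_left inner_adj_op bounded_opsD)

lemma adj_op_scaleR: "T \<in> bounded_ops \<Longrightarrow> adj_op (r *\<^sub>R T) = r *\<^sub>R adj_op T"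
  by (simp add: scaleR_op adj_op_scaleC)

lemma adj_op_diff:
  "S \<in> bounded_ops \<Longrightarrow> T \<in> bounded_ops \<Longrightarrow> adj_op (S - T) = adj_op S - adj_op T"
  by (rule adj_op_unique) (simp_all add: bounded_ops_diff blinfun.diff_left inner_simps inner_adj_op)

lemma norm_adj_op_le:
  assumes T: "T \<in> bounded_ops"
  shows "norm (adj_op T) \<le> norm T"
proof (rule norm_blinfun_bound)
  fix x
  let ?y = "blinfun_apply (adj_op T) x"
  have "norm ?y * norm ?y = inner x (blinfun_apply T ?y)"
    by (simp add: inner_adj_op[OF T, symmetric] power2_norm_eq_inner[symmetric] power2_eq_square)
  also have "\<dots> \<le> norm x * (norm T * norm ?y)"
    by (meson Cauchy_Schwarz_ineq2 abs_le_D1 mult_left_mono norm_blinfun norm_ge_zero order_trans)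
  finally have "norm ?y * norm ?y \<le> (norm T * norm x) * norm ?y" by (simp add: algebra_simps)
  then show "norm ?y \<le> norm T * norm x"
    by (cases "norm ?y = 0") (auto simp: mult_le_cancel_right)
qed simp

lemma norm_adj_op: "T \<in> bounded_ops \<Longrightarrow> norm (adj_op T) = norm T"
  using norm_adj_op_le[of T] norm_adj_op_le[of "adj_op T"] by (simp add: bounded_ops_adj adj_adj_op)

section \<open>Extension of positive functionals\<close>

text \<open>
  Requiring one inequality of positive homogeneity is enough, since \<open>r\<close> may be replaced by
  its inverse.
\<close>

definition sublinear :: "('v::real_vector \<Rightarrow> real) \<Rightarrow> bool" where
  "sublinear p \<longleftrightarrow> (\<forall>x y. p (x + y) \<le> p x + p y) \<and> (\<forall>r>0. \<forall>x. p (r *\<^sub>R x) \<le> r * p x)"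

lemma sublinearD:
  assumes "sublinear p"
  shows "p (x + y) \<le> p x + p y" "r > 0 \<Longrightarrow> p (r *\<^sub>R x) = r * p x" "p 0 = 0" "- p (- x) \<le> p x"
proof -
  show add: "p (x + y) \<le> p x + p y" for x y
    using assms by (simp add: sublinear_def)
  have le: "p (r *\<^sub>R x) \<le> r * p x" if "r > 0" for r x
    using assms that by (simp add: sublinear_def)
  show "r > 0 \<Longrightarrow> p (r *\<^sub>R x) = r * p x"
    using le[of r x] le[of "inverse r" "r *\<^sub>R x"] by (simp add: field_simps)
  show "p 0 = 0" using le[of "1/2" 0] le[of 2 0] by simp
  then show "- p (- x) \<le> p x" using add[of x "- x"] by simp
qed

text \<open>
  The Hahn--Banach theorem. A minimal sublinear functional \<open>m\<close> below \<open>p\<close> exists by Zorn's lemma.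
  It is linear because the infimum of \<open>m (x + t y) - t m y\<close> over \<open>t \<ge> 0\<close> is again
  sublinear and below \<open>m\<close>, which yields superadditivity.
\<close>

lemma sublinear_dominates_linear:
  fixes p :: "'v::real_vector \<Rightarrow> real"
  assumes p: "sublinear p"
  shows "\<exists>f. linear f \<and> (\<forall>x. f x \<le> p x)"
proof -
  define A where "A = {q. sublinear q \<and> (\<forall>x. q x \<le> p x)}"
  define P :: "('v \<Rightarrow> real) \<Rightarrow> ('v \<Rightarrow> real) \<Rightarrow> bool"
    where "P = (\<lambda>a u. \<forall>x. u x \<le> a x)"
  have A_sub: "sublinear q" and A_le: "q x \<le> p x" if "q \<in> A" for q x
    using that by (auto simp: A_def)
  have "\<exists>m\<in>A. \<forall>a\<in>A. P m a \<longrightarrow> a = m"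
  proof (rule predicate_Zorn)
    show "partial_order_on A (relation_of P A)"
      by (rule partial_order_on_relation_ofI) (auto simp: P_def fun_eq_iff intro: order_trans antisym)
    fix C assume C: "C \<in> Chains (relation_of P A)"
    then have CA: "C \<subseteq> A" and Ctot: "\<And>a b. a \<in> C \<Longrightarrow> b \<in> C \<Longrightarrow> P a b \<or> P b a"
      by (auto simp: Chains_def relation_of_def)
    show "\<exists>u\<in>A. \<forall>a\<in>C. P a u"
    proof (cases "C = {}")
      case True
      then show ?thesis using p by (auto simp: A_def)
    next
      case False
      define u where "u x = (INF q\<in>C. q x)" for x
      have lb: "- p (- x) \<le> q x" if "q \<in> C" for q x
        using sublinearD(4)[OF A_sub, of q x] A_le[of q "- x"] that CA by force
      have ule: "u x \<le> q x" if "q \<in> C" for q x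
        unfolding u_def by (rule cINF_lower[OF bdd_belowI2[OF lb]]) (use that in auto)
      have ug: "c \<le> u x" if "\<And>q. q \<in> C \<Longrightarrow> c \<le> q x" for c x
        unfolding u_def by (rule cINF_greatest) (use that False in auto)
      have "u (x + y) \<le> u x + u y" for x y
      proof -
        have ab: "u (x + y) \<le> a x + b y" if ab: "a \<in> C" "b \<in> C" for a b
        proof -
          \<comment> \<open>the smaller of the two members of the chain bounds the value at the sum\<close>
          obtain q where "q \<in> C" "\<And>z. q z \<le> a z" "\<And>z. q z \<le> b z"
            using Ctot[OF ab] ab by (auto simp: P_def)
          then show ?thesis
            using ule[of q "x + y"] sublinearD(1)[OF A_sub, of q x y] CA
            by (smt (verit) subsetD)
        qed
        have "u (x + y) - a x \<le> u y" if "a \<in> C" for a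
          by (rule ug) (use ab[OF that] in \<open>simp add: algebra_simps\<close>)
        then have "u (x + y) - u y \<le> u x" by (intro ug) (simp add: algebra_simps)
        then show ?thesis by simp
      qed
      moreover have "u (r *\<^sub>R x) \<le> r * u x" if r: "r > 0" for r x
      proof -
        have "u (r *\<^sub>R x) / r \<le> u x"
        proof (rule ug)
          fix q assume q: "q \<in> C"
          have "u (r *\<^sub>R x) \<le> r * q x"
            using ule[OF q, of "r *\<^sub>R x"] sublinearD(2)[OF A_sub r, of q x] q CA by auto
          then show "u (r *\<^sub>R x) / r \<le> q x" using r by (simp add: field_simps)
        qed
        then show ?thesis using r by (simp add: field_simps)
      qed
      moreover have "u x \<le> p x" for x
        using False ule A_le CA by (meson all_not_in_conv order_trans subsetD)
      ultimately have "u \<in> A" by (simp add: A_def sublinear_def)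
      then show ?thesis using ule by (auto simp: P_def)
    qed
  qed
  then obtain m where mA: "m \<in> A" and mmin: "\<And>a. a \<in> A \<Longrightarrow> (\<And>x. a x \<le> m x) \<Longrightarrow> a = m"
    unfolding P_def by blast
  have ms: "sublinear m" using mA by (simp add: A_def)
  note m = sublinearD[OF ms]
  have mge: "m x + m y \<le> m (x + y)" for x y
  proof -
    define u where "u x = (INF t\<in>{0..}. m (x + t *\<^sub>R y) - t * m y)" for x
    have m_scale: "m (t *\<^sub>R y) = t * m y" if "t \<ge> 0" for t
      using m(2)[of t y] m(3) that by (cases "t = 0") auto
    have lb: "- m (- x) \<le> m (x + t *\<^sub>R y) - t * m y" if "t \<in> {0..}" for x t
      using m(1)[of "x + t *\<^sub>R y" "- x"] m_scale[of t] that by simp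
    have ule: "u x \<le> m (x + t *\<^sub>R y) - t * m y" if "t \<ge> 0" for x t
      unfolding u_def by (rule cINF_lower[OF bdd_belowI2[OF lb]]) (use that in auto)
    have ug: "c \<le> u x" if "\<And>t. t \<ge> 0 \<Longrightarrow> c \<le> m (x + t *\<^sub>R y) - t * m y" for c x
      unfolding u_def by (rule cINF_greatest) (use that in auto)
    have um: "u x \<le> m x" for x using ule[of 0 x] by simp
    have "u (a + b) \<le> u a + u b" for a b
    proof -
      have ab: "u (a + b) \<le> (m (a + s *\<^sub>R y) - s * m y) + (m (b + t *\<^sub>R y) - t * m y)"
        if "s \<ge> 0" "t \<ge> 0" for s t
        using ule[of "s + t" "a + b"] m(1)[of "a + s *\<^sub>R y" "b + t *\<^sub>R y"] that
        by (simp add: algebra_simps)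
      have "u (a + b) - (m (a + s *\<^sub>R y) - s * m y) \<le> u b" if "s \<ge> 0" for s
        by (rule ug) (use ab[OF that] in \<open>simp add: algebra_simps\<close>)
      then have "u (a + b) - u b \<le> u a" by (intro ug) (simp add: algebra_simps)
      then show ?thesis by simp
    qed
    moreover have "u (r *\<^sub>R x) \<le> r * u x" if r: "r > 0" for r x
    proof -
      have "u (r *\<^sub>R x) / r \<le> u x"
      proof (rule ug)
        fix t :: real assume t: "t \<ge> 0"
        have "u (r *\<^sub>R x) \<le> m (r *\<^sub>R x + (r * t) *\<^sub>R y) - (r * t) * m y"
          using ule[of "r * t"] r t by simp
        also have "\<dots> = r * (m (x + t *\<^sub>R y) - t * m y)"
          using m(2)[OF r, of "x + t *\<^sub>R y"] by (simp add: algebra_simps)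
        finally show "u (r *\<^sub>R x) / r \<le> m (x + t *\<^sub>R y) - t * m y" using r by (simp add: field_simps)
      qed
      then show ?thesis using r by (simp add: field_simps)
    qed
    ultimately have "u \<in> A"
      using um A_le[OF mA] order_trans[OF um A_le[OF mA]] by (simp add: A_def sublinear_def)
    then have "u = m" using um by (rule mmin)
    then show ?thesis using ule[of 1 x] by simp
  qed
  have madd: "m (x + y) = m x + m y" for x y using mge m(1) by (rule antisym[rotated])
  have mneg: "m (- x) = - m x" for x using madd[of x "- x"] m(3) by simp
  have "linear m"
  proof (rule linearI)
    show "m (r *\<^sub>R x) = r *\<^sub>R m x" for r x
      using m(2)[of r x] m(2)[of "- r" x] m(3) mneg[of "r *\<^sub>R x"]
      by (cases r "0::real" rule: linorder_cases) auto
  qed (rule madd)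
  then show ?thesis using mA by (auto simp: A_def)
qed

text \<open>
  M. Riesz's extension theorem: a functional on a subspace that is nonnegative on the part of a
  convex cone in the subspace extends to a functional that is nonnegative on the cone, provided
  that the subspace majorises every vector.
\<close>

lemma positive_functional_extension:
  fixes s :: "'v::real_vector \<Rightarrow> real"
  assumes W: "subspace W"
    and s_add: "\<And>v w. v \<in> W \<Longrightarrow> w \<in> W \<Longrightarrow> s (v + w) = s v + s w"
    and s_scale: "\<And>r w. w \<in> W \<Longrightarrow> s (r *\<^sub>R w) = r * s w"
    and K_zero: "0 \<in> K"
    and K_add: "\<And>v w. v \<in> K \<Longrightarrow> w \<in> K \<Longrightarrow> v + w \<in> K"
    and K_scale: "\<And>r v. v \<in> K \<Longrightarrow> r > 0 \<Longrightarrow> r *\<^sub>R v \<in> K"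
    and pos: "\<And>w. w \<in> W \<Longrightarrow> w \<in> K \<Longrightarrow> 0 \<le> s w"
    and maj: "\<And>v. \<exists>w\<in>W. w - v \<in> K"
  shows "\<exists>f. linear f \<and> (\<forall>w\<in>W. f w = s w) \<and> (\<forall>v\<in>K. 0 \<le> f v)"
proof -
  define M where "M v = {w \<in> W. w - v \<in> K}" for v
  define p where "p v = (INF w\<in>M v. s w)" for v
  have Mne: "M v \<noteq> {}" for v using maj[of v] by (auto simp: M_def)
  have bdd: "bdd_below (s ` M v)" for v
  proof -
    obtain w' where w': "w' \<in> W" "w' - (- v) \<in> K" using maj by blast
    have "- s w' \<le> s w" if "w \<in> M v" for w
    proof -
      have "w + w' \<in> K" using K_add[of "w - v" "w' - (- v)"] w' that by (simp add: M_def)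
      then show ?thesis
        using pos[of "w + w'"] s_add[of w w'] w' that subspace_add[OF W] by (simp add: M_def)
    qed
    then show ?thesis by (rule bdd_belowI2)
  qed
  have ple: "p v \<le> s w" if "w \<in> M v" for v w
    unfolding p_def by (rule cINF_lower[OF bdd that])
  have pg: "c \<le> p v" if "\<And>w. w \<in> M v \<Longrightarrow> c \<le> s w" for c v
    unfolding p_def by (rule cINF_greatest) (use that Mne in auto)
  have "sublinear p"
    unfolding sublinear_def
  proof (intro conjI allI impI)
    fix v v'
    have ab: "p (v + v') \<le> s w + s w'" if "w \<in> M v" "w' \<in> M v'" for w w'
    proof -
      have "w + w' \<in> M (v + v')"
        using that K_add[of "w - v" "w' - v'"] subspace_add[OF W] by (simp add: M_def algebra_simps)
      then show ?thesis using ple s_add[of w w'] that by (fastforce simp: M_def)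
    qed
    have "p (v + v') - s w \<le> p v'" if "w \<in> M v" for w
      by (rule pg) (use ab[OF that] in \<open>simp add: algebra_simps\<close>)
    then have "p (v + v') - p v' \<le> p v" by (intro pg) (simp add: algebra_simps)
    then show "p (v + v') \<le> p v + p v'" by simp
  next
    fix r :: real and v assume r: "0 < r"
    have "p (r *\<^sub>R v) / r \<le> p v"
    proof (rule pg)
      fix w assume w: "w \<in> M v"
      have "r *\<^sub>R w \<in> M (r *\<^sub>R v)"
        using w r K_scale[of "w - v" r] subspace_scale[OF W] by (simp add: M_def algebra_simps)
      then have "p (r *\<^sub>R v) \<le> r * s w" using ple s_scale[of w r] w by (fastforce simp: M_def)
      then show "p (r *\<^sub>R v) / r \<le> s w" using r by (simp add: field_simps)
    qed
    then show "p (r *\<^sub>R v) \<le> r * p v" using r by (simp add: field_simps)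
  qed
  then obtain f where f: "linear f" "\<And>v. f v \<le> p v"
    using sublinear_dominates_linear by blast
  have fW: "f w \<le> s w" if "w \<in> W" for w
    using f(2)[of w] ple[of w w] that K_zero by (simp add: M_def)
  have "f w = s w" if w: "w \<in> W" for w
    using fW[OF w] fW[of "- w"] s_scale[OF w, of "-1"] subspace_neg[OF W w] linear_neg[OF f(1), of w]
    by simp
  moreover have "0 \<le> f v" if v: "v \<in> K" for v
  proof -
    have "p (- v) \<le> s 0" by (rule ple) (use v subspace_0[OF W] in \<open>simp add: M_def\<close>)
    moreover have "s 0 = 0" using s_scale[of 0 0] subspace_0[OF W] by simp
    ultimately show ?thesis using f(2)[of "- v"] linear_neg[OF f(1), of v] by simp
  qed
  ultimately show ?thesis using f(1) by blast
qed

text \<open>Finitely supported functions with values in a real vector space form a real vector space.\<close>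

instantiation poly_mapping :: (type, real_vector) real_vector
begin

lift_definition scaleR_poly_mapping :: "real \<Rightarrow> ('a \<Rightarrow>\<^sub>0 'b) \<Rightarrow> 'a \<Rightarrow>\<^sub>0 'b"
  is "\<lambda>r f k. r *\<^sub>R f k"
  by (erule finite_subset[rotated]) auto

instance
  by standard (transfer; simp add: fun_eq_iff algebra_simps)+

end

lemma lookup_scaleR: "Poly_Mapping.lookup (r *\<^sub>R M) k = r *\<^sub>R Poly_Mapping.lookup M k"
  by (simp add: scaleR_poly_mapping.rep_eq)

text \<open>The functional on finitely supported functions with the component \<open>f k\<close> at the key \<open>k\<close>.\<close>

definition sum_keys :: "('k \<Rightarrow> 'b \<Rightarrow> real) \<Rightarrow> ('k \<Rightarrow>\<^sub>0 'b::real_vector) \<Rightarrow> real" where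
  "sum_keys f M = (\<Sum>k\<in>Poly_Mapping.keys M. f k (Poly_Mapping.lookup M k))"

lemma sum_keys_superset:
  assumes "finite F" "Poly_Mapping.keys M \<subseteq> F" "\<And>k. f k 0 = 0"
  shows "sum_keys f M = (\<Sum>k\<in>F. f k (Poly_Mapping.lookup M k))"
  unfolding sum_keys_def
  by (rule sum.mono_neutral_left) (use assms in \<open>auto simp: in_keys_iff\<close>)

lemma sum_keys_add:
  assumes "\<And>k. f k (Poly_Mapping.lookup M k + Poly_Mapping.lookup N k) = f k (Poly_Mapping.lookup M k) + f k (Poly_Mapping.lookup N k)"
    and "\<And>k. f k 0 = 0"
  shows "sum_keys f (M + N) = sum_keys f M + sum_keys f N"
proof -
  let ?F = "Poly_Mapping.keys M \<union> Poly_Mapping.keys N"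
  have "sum_keys f (M + N) = (\<Sum>k\<in>?F. f k (Poly_Mapping.lookup (M + N) k))"
    by (rule sum_keys_superset) (use assms keys_add[of M N] in auto)
  also have "\<dots> = (\<Sum>k\<in>?F. f k (Poly_Mapping.lookup M k)) + (\<Sum>k\<in>?F. f k (Poly_Mapping.lookup N k))"
    by (simp add: lookup_add assms sum.distrib)
  also have "\<dots> = sum_keys f M + sum_keys f N"
    by (subst (1 2) sum_keys_superset[of ?F]) (use assms in auto)
  finally show ?thesis .
qed

lemma sum_keys_scaleR:
  assumes "\<And>k. f k (r *\<^sub>R Poly_Mapping.lookup M k) = r * f k (Poly_Mapping.lookup M k)"
    and "\<And>k. f k 0 = 0"
  shows "sum_keys f (r *\<^sub>R M) = r * sum_keys f M"
proof -
  have "sum_keys f (r *\<^sub>R M) = (\<Sum>k\<in>Poly_Mapping.keys M. f k (Poly_Mapping.lookup (r *\<^sub>R M) k))"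
    by (rule sum_keys_superset) (use assms in \<open>auto simp: in_keys_iff lookup_scaleR\<close>)
  then show ?thesis by (simp add: lookup_scaleR assms sum_keys_def sum_distrib_left)
qed

lemma sum_keys_single:
  assumes "\<And>k. f k 0 = 0"
  shows "sum_keys f (Poly_Mapping.single k v) = f k v"
  by (subst sum_keys_superset[of "{k}"]) (use assms in auto)

section \<open>Complete positivity of *-homomorphisms\<close>

lemma subspace_closure:
  fixes S :: "'a::real_normed_vector set"
  assumes S: "subspace S"
  shows "subspace (closure S)"
proof (rule subspaceI)
  show "0 \<in> closure S" using subspace_0[OF S] closure_subset by blast
next
  fix x y assume "x \<in> closure S" "y \<in> closure S"
  then obtain f g where "\<And>n. f n \<in> S" "\<And>n. g n \<in> S" "f \<longlonglongrightarrow> x" "g \<longlonglongrightarrow> y"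
    by (auto simp: closure_sequential)
  then show "x + y \<in> closure S"
    unfolding closure_sequential using subspace_add[OF S]
    by (intro exI[of _ "\<lambda>n. f n + g n"]) (auto intro: tendsto_add)
next
  fix c x assume "x \<in> closure S"
  then obtain f where "\<And>n. f n \<in> S" "f \<longlonglongrightarrow> x" by (auto simp: closure_sequential)
  then show "c *\<^sub>R x \<in> closure S"
    unfolding closure_sequential using subspace_scale[OF S]
    by (intro exI[of _ "\<lambda>n. c *\<^sub>R f n"]) (auto intro: tendsto_scaleR)
qed

lemma norm_le_of_positive_form:
  fixes R :: "'h::chilbert_space \<Rightarrow>\<^sub>L 'h"
  assumes R: "R \<in> bounded_ops" "adj_op R = R" and k: "k \<ge> 0"
    and pos: "\<And>x. 0 \<le> inner x (blinfun_apply R x)"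
    and le: "\<And>x. inner x (blinfun_apply R x) \<le> k * (norm x)\<^sup>2"
  shows "norm R \<le> k"
proof (rule norm_blinfun_bound[OF k])
  fix y
  show "norm (blinfun_apply R y) \<le> k * norm y"
  proof (cases "blinfun_apply R y = 0")
    case True
    then show ?thesis using k by simp
  next
    case False
    then have y: "y \<noteq> 0" by auto
    let ?w = "blinfun_apply R y"
    define x where "x = (norm y / norm ?w) *\<^sub>R ?w"
    have nx: "norm x = norm y" using False by (simp add: x_def)
    have xw: "inner x ?w = norm y * norm ?w"
      using False by (simp add: x_def power2_norm_eq_inner[symmetric] power2_eq_square)
    have sym: "inner y (blinfun_apply R x) = inner x (blinfun_apply R y)"
      using inner_adj_op[OF R(1), of y x] R(2) by (simp add: inner_commute)
    have "0 \<le> inner (x - y) (blinfun_apply R (x - y))" by (rule pos)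
    then have "2 * inner x ?w \<le> inner x (blinfun_apply R x) + inner y (blinfun_apply R y)"
      by (simp add: blinfun.diff_right inner_diff_left inner_diff_right sym)
    also have "\<dots> \<le> k * (norm y)\<^sup>2 + k * (norm y)\<^sup>2"
      using le[of x] le[of y] nx by simp
    finally have "norm y * norm ?w \<le> norm y * (k * norm y)"
      by (simp add: xw power2_eq_square algebra_simps)
    then show ?thesis using y by simp
  qed
qed

text \<open>
  A unital *-homomorphism from a norm closed unital *-algebra of operators into B(H). Neither
  continuity nor positivity of the homomorphism is assumed.
\<close>

locale unital_star_hom =
  fixes A :: "('h::chilbert_space \<Rightarrow>\<^sub>L 'h) set" and \<theta> :: "('h \<Rightarrow>\<^sub>L 'h) \<Rightarrow> ('h \<Rightarrow>\<^sub>L 'h)"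
  assumes A_sub: "A \<subseteq> bounded_ops" and A_closed: "closed A"
    and A_id: "id_blinfun \<in> A"
    and A_add: "S \<in> A \<Longrightarrow> T \<in> A \<Longrightarrow> S + T \<in> A"
    and A_scaleC: "T \<in> A \<Longrightarrow> scaleC_op a T \<in> A"
    and A_compose: "S \<in> A \<Longrightarrow> T \<in> A \<Longrightarrow> S o\<^sub>L T \<in> A"
    and A_adj: "T \<in> A \<Longrightarrow> adj_op T \<in> A"
    and hom_ops: "T \<in> A \<Longrightarrow> \<theta> T \<in> bounded_ops"
    and hom_id: "\<theta> id_blinfun = id_blinfun"
    and hom_add: "S \<in> A \<Longrightarrow> T \<in> A \<Longrightarrow> \<theta> (S + T) = \<theta> S + \<theta> T"
    and hom_scaleC: "T \<in> A \<Longrightarrow> \<theta> (scaleC_op a T) = scaleC_op a (\<theta> T)"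
    and hom_compose: "S \<in> A \<Longrightarrow> T \<in> A \<Longrightarrow> \<theta> (S o\<^sub>L T) = \<theta> S o\<^sub>L \<theta> T"
    and hom_adj: "T \<in> A \<Longrightarrow> \<theta> (adj_op T) = adj_op (\<theta> T)"
begin

lemma A_ops: "T \<in> A \<Longrightarrow> T \<in> bounded_ops"
  using A_sub by blast

lemma A_scaleR: "T \<in> A \<Longrightarrow> r *\<^sub>R T \<in> A"
  by (simp add: scaleR_op A_scaleC)

lemma A_zero: "0 \<in> A"
  using A_scaleR[OF A_id, of 0] by simp

lemma A_diff: "S \<in> A \<Longrightarrow> T \<in> A \<Longrightarrow> S - T \<in> A"
  using A_add[of S "- 1 *\<^sub>R T"] A_scaleR[of T "- 1"] by simp

lemma A_sum: "(\<And>i. i \<in> I \<Longrightarrow> f i \<in> A) \<Longrightarrow> sum f I \<in> A"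
  by (induction I rule: infinite_finite_induct) (auto intro: A_add A_zero)

lemma hom_scaleR: "T \<in> A \<Longrightarrow> \<theta> (r *\<^sub>R T) = r *\<^sub>R \<theta> T"
  by (simp add: scaleR_op hom_scaleC)

lemma hom_zero: "\<theta> 0 = 0"
  using hom_scaleR[OF A_id, of 0] by simp

lemma hom_diff: "S \<in> A \<Longrightarrow> T \<in> A \<Longrightarrow> \<theta> (S - T) = \<theta> S - \<theta> T"
  using hom_add[of S "- 1 *\<^sub>R T"] hom_scaleR[of T "- 1"] A_scaleR[of T "- 1"] by simp

lemma hom_sum: "(\<And>i. i \<in> I \<Longrightarrow> f i \<in> A) \<Longrightarrow> \<theta> (sum f I) = (\<Sum>i\<in>I. \<theta> (f i))"
  by (induction I rule: infinite_finite_induct) (auto simp: hom_zero hom_add A_sum)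

text \<open>
  The square root of \<open>1 - R\<close> is \<open>1 - Q\<close>, where \<open>Q\<close> is the fixed point of
  \<open>Q \<mapsto> (R + Q\<^sup>2)/2\<close>, a contraction of the selfadjoint part of the ball of radius \<open>\<parallel>R\<parallel>\<close>.
\<close>

lemma square_root_exists:
  assumes R: "R \<in> A" "adj_op R = R" "norm R < 1"
  shows "\<exists>Q\<in>A. adj_op Q = Q \<and> id_blinfun - R = (id_blinfun - Q) o\<^sub>L (id_blinfun - Q)"
proof -
  define r where "r = norm R"
  define S where "S = {Q \<in> A. adj_op Q = Q \<and> norm Q \<le> r}"
  define f where "f Q = (1/2) *\<^sub>R (R + (Q o\<^sub>L Q))" for Q
  have r: "0 \<le> r" "r < 1" using R by (auto simp: r_def)
  have sa: "adj_op Q = Q \<longleftrightarrow>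
      (\<forall>x y. inner (blinfun_apply Q x) y = inner x (blinfun_apply Q y))" if "Q \<in> A" for Q
    using adj_op_unique[OF A_ops[OF that], of Q] inner_adj_op[OF A_ops[OF that]] by metis
  have "S = A \<inter> (\<Inter>x. \<Inter>y. {Q. inner (blinfun_apply Q x) y = inner x (blinfun_apply Q y)}) \<inter> cball 0 r"
    by (auto simp: S_def sa)
  moreover have "closed {Q :: 'h \<Rightarrow>\<^sub>L 'h. inner (blinfun_apply Q x) y = inner x (blinfun_apply Q y)}" for x y
    by (intro closed_Collect_eq continuous_intros)
  ultimately have "closed S" by (auto intro!: closed_INT closed_Int A_closed)
  then have cS: "complete S" by (simp add: complete_eq_closed)
  have neS: "S \<noteq> {}" using R by (auto simp: S_def r_def)
  have fS: "f ` S \<subseteq> S"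
  proof (intro image_subsetI)
    fix Q assume "Q \<in> S"
    then have Q: "Q \<in> A" "adj_op Q = Q" "norm Q \<le> r" by (auto simp: S_def)
    have QQ: "Q o\<^sub>L Q \<in> A" using Q A_compose by blast
    have "f Q \<in> A" unfolding f_def using Q R QQ by (intro A_scaleR A_add)
    moreover have "adj_op (f Q) = f Q"
      unfolding f_def using Q R QQ
      by (simp add: adj_op_scaleR adj_op_add adj_op_compose A_ops A_add)
    moreover have "norm (f Q) \<le> r"
    proof -
      have "norm (Q o\<^sub>L Q) \<le> norm Q * norm Q" by (rule norm_blinfun_compose)
      also have "\<dots> \<le> r * 1" using Q r by (intro mult_mono) auto
      finally have "norm (R + (Q o\<^sub>L Q)) \<le> r + r"
        using norm_triangle_ineq[of R "Q o\<^sub>L Q"] by (simp add: r_def)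
      then show ?thesis by (simp add: f_def)
    qed
    ultimately show "f Q \<in> S" by (simp add: S_def)
  qed
  have "dist (f Q) (f Q') \<le> r * dist Q Q'" if "Q \<in> S" "Q' \<in> S" for Q Q'
  proof -
    have "f Q - f Q' = (1/2) *\<^sub>R ((Q o\<^sub>L (Q - Q')) + ((Q - Q') o\<^sub>L Q'))"
      by (rule blinfun_eqI) (simp add: f_def blinfun.bilinear_simps algebra_simps)
    then have "norm (f Q - f Q') \<le> 1/2 * (norm (Q o\<^sub>L (Q - Q')) + norm ((Q - Q') o\<^sub>L Q'))"
      by (simp add: norm_triangle_ineq)
    also have "\<dots> \<le> 1/2 * (norm Q * norm (Q - Q') + norm (Q - Q') * norm Q')"
      by (intro mult_left_mono add_mono norm_blinfun_compose) simp
    also have "\<dots> \<le> 1/2 * (r * norm (Q - Q') + norm (Q - Q') * r)"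
      using that by (intro mult_left_mono add_mono mult_right_mono) (auto simp: S_def)
    finally show ?thesis by (simp add: dist_norm)
  qed
  from Banach_fix[OF cS neS r fS this] obtain Q where "Q \<in> S" "f Q = Q" by blast
  then have Q: "Q \<in> A" "adj_op Q = Q" "R + (Q o\<^sub>L Q) = 2 *\<^sub>R Q"
    by (auto simp: S_def f_def dest: arg_cong[of _ _ "\<lambda>T. 2 *\<^sub>R T"])
  have "blinfun_apply R x = 2 *\<^sub>R blinfun_apply Q x - blinfun_apply Q (blinfun_apply Q x)" for x
    using arg_cong[OF Q(3), of "\<lambda>T. blinfun_apply T x"]
    by (simp add: blinfun.bilinear_simps algebra_simps)
  then have "id_blinfun - R = (id_blinfun - Q) o\<^sub>L (id_blinfun - Q)"
    by (intro blinfun_eqI) (simp add: blinfun.bilinear_simps algebra_simps scaleR_2)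
  with Q show ?thesis by blast
qed

text \<open>
  The selfadjoint part of \<open>c\<close> plus a small multiple of the identity is, up to scaling, of the form
  \<open>1 - R\<close> with \<open>\<parallel>R\<parallel> < 1\<close>, hence a square of a selfadjoint element of \<open>A\<close>. Positivity is
  expressed by the real part of the quadratic form, so \<open>c\<close> need not be selfadjoint.
\<close>

lemma hom_positive:
  assumes c: "c \<in> A" and pos: "\<And>z. 0 \<le> inner z (blinfun_apply c z)"
  shows "0 \<le> inner z (blinfun_apply (\<theta> c) z)"
proof -
  define h where "h = (1/2) *\<^sub>R (c + adj_op c)"
  have hA: "h \<in> A" unfolding h_def using c by (intro A_scaleR A_add A_adj)
  have h_adj: "adj_op h = h"
    unfolding h_def using c A_ops
    by (simp add: adj_op_scaleR adj_op_add adj_adj_op bounded_ops_adj bounded_ops_add add.commute)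
  have h_form: "inner z (blinfun_apply h z) = inner z (blinfun_apply c z)" for z
    using inner_adj_op'[OF A_ops[OF c], of z z]
    by (simp add: h_def blinfun.bilinear_simps inner_simps inner_commute)
  have "\<theta> h = (1/2) *\<^sub>R (\<theta> c + adj_op (\<theta> c))"
    using c by (simp add: h_def hom_scaleR hom_add A_add A_adj hom_adj)
  then have th_form: "inner z (blinfun_apply (\<theta> h) z) = inner z (blinfun_apply (\<theta> c) z)" for z
    using inner_adj_op'[OF hom_ops[OF c], of z z]
    by (simp add: blinfun.bilinear_simps inner_simps inner_commute)
  have "- (e * (norm z)\<^sup>2) \<le> inner z (blinfun_apply (\<theta> h) z)" if e: "e > 0" for e
  proof -
    define N where "N = norm h + e"
    have N: "N > 0" using e by (simp add: N_def add_nonneg_pos)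
    define R where "R = id_blinfun - (1/N) *\<^sub>R (h + e *\<^sub>R id_blinfun)"
    have RA: "R \<in> A" unfolding R_def by (intro A_diff A_scaleR A_add hA A_id)
    have R_adj: "adj_op R = R"
      unfolding R_def using hA
      by (simp add: adj_op_scaleR adj_op_diff adj_op_add bounded_ops_scaleR bounded_ops_add A_ops h_adj)
    have R_form: "inner x (blinfun_apply R x) =
        (norm x)\<^sup>2 - (1/N) * (inner x (blinfun_apply h x) + e * (norm x)\<^sup>2)" for x
      by (simp add: R_def blinfun.bilinear_simps inner_simps power2_norm_eq_inner)
    have h_le: "inner x (blinfun_apply h x) \<le> norm h * (norm x)\<^sup>2" for x
    proof -
      have "inner x (blinfun_apply h x) \<le> norm x * norm (blinfun_apply h x)"
        by (rule norm_cauchy_schwarz)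
      also have "\<dots> \<le> norm x * (norm h * norm x)" by (intro mult_left_mono norm_blinfun) simp
      finally show ?thesis by (simp add: power2_eq_square algebra_simps)
    qed
    have "norm R \<le> 1 - e / N"
    proof (rule norm_le_of_positive_form[OF A_ops[OF RA] R_adj])
      show "0 \<le> 1 - e / N" using N e by (simp add: N_def field_simps)
      fix x
      have "(1/N) * (inner x (blinfun_apply h x) + e * (norm x)\<^sup>2) \<le> (1/N) * (N * (norm x)\<^sup>2)"
        using h_le[of x] N by (intro mult_left_mono) (auto simp: N_def algebra_simps)
      then show "0 \<le> inner x (blinfun_apply R x)" using N by (simp add: R_form)
      have "0 \<le> (1/N) * inner x (blinfun_apply h x)" using N pos[of x] by (simp add: h_form)
      then show "inner x (blinfun_apply R x) \<le> (1 - e / N) * (norm x)\<^sup>2"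
        by (simp add: R_form algebra_simps)
    qed
    also have "\<dots> < 1" using N e by simp
    finally obtain Q where Q: "Q \<in> A" "adj_op Q = Q"
        "id_blinfun - R = (id_blinfun - Q) o\<^sub>L (id_blinfun - Q)"
      using square_root_exists[OF RA R_adj] by blast
    have "(1/N) *\<^sub>R (h + e *\<^sub>R id_blinfun) = (id_blinfun - Q) o\<^sub>L (id_blinfun - Q)"
      using Q(3) by (simp add: R_def)
    then have "\<theta> ((1/N) *\<^sub>R (h + e *\<^sub>R id_blinfun)) = \<theta> ((id_blinfun - Q) o\<^sub>L (id_blinfun - Q))"
      by (rule arg_cong)
    then have eq: "(1/N) *\<^sub>R (\<theta> h + e *\<^sub>R id_blinfun) = (id_blinfun - \<theta> Q) o\<^sub>L (id_blinfun - \<theta> Q)"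
      using hA A_id Q
      by (simp add: hom_scaleR hom_add hom_compose hom_diff hom_id A_add A_scaleR A_diff)
    have tQ: "inner z (blinfun_apply (\<theta> Q) y) = inner (blinfun_apply (\<theta> Q) z) y" for y
      using inner_adj_op[OF hom_ops[OF Q(1)], of z y] hom_adj[OF Q(1)] Q(2) by simp
    have "inner z (blinfun_apply ((id_blinfun - \<theta> Q) o\<^sub>L (id_blinfun - \<theta> Q)) z) =
        inner (blinfun_apply (id_blinfun - \<theta> Q) z) (blinfun_apply (id_blinfun - \<theta> Q) z)"
      by (simp add: blinfun.bilinear_simps inner_diff_left inner_diff_right tQ)
    then have "0 \<le> inner z (blinfun_apply ((1/N) *\<^sub>R (\<theta> h + e *\<^sub>R id_blinfun)) z)"
      using eq by simp
    then have "0 \<le> (1/N) * (inner z (blinfun_apply (\<theta> h) z) + e * (norm z)\<^sup>2)"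
      by (simp add: blinfun.bilinear_simps inner_simps power2_norm_eq_inner)
    then show ?thesis using N by (simp add: zero_le_divide_iff)
  qed
  then have le: "- inner z (blinfun_apply (\<theta> h) z) \<le> e * (norm z)\<^sup>2" if "e > 0" for e
    using that by (simp add: minus_le_iff)
  have "- inner z (blinfun_apply (\<theta> h) z) \<le> 0 + e" if "e > 0" for e
  proof -
    have "- inner z (blinfun_apply (\<theta> h) z) \<le> e / ((norm z)\<^sup>2 + 1) * (norm z)\<^sup>2"
      by (rule le) (use that in \<open>simp add: add_nonneg_pos\<close>)
    also have "\<dots> \<le> e / ((norm z)\<^sup>2 + 1) * ((norm z)\<^sup>2 + 1)"
      using that by (intro mult_left_mono) auto
    also have "\<dots> = e" by (simp add: add_nonneg_eq_0_iff)
    finally show ?thesis by simp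
  qed
  then have "- inner z (blinfun_apply (\<theta> h) z) \<le> 0" by (rule field_le_epsilon)
  then show ?thesis by (simp add: th_form)
qed

text \<open>
  At the vectors \<open>\<theta> b\<^sub>i \<xi>\<close> the form is that of \<open>\<theta> c\<close> at \<open>\<xi>\<close>, where
  \<open>c\<close> is the sum of all \<open>b\<^sub>i\<^sup>* a\<^sub>i\<^sub>j b\<^sub>j\<close>.
\<close>

lemma hom_form_cyclic:
  assumes a: "\<And>i j. i \<in> I \<Longrightarrow> j \<in> I \<Longrightarrow> a i j \<in> A"
    and b: "\<And>i. i \<in> I \<Longrightarrow> b i \<in> A"
    and pos: "\<And>z. 0 \<le> (\<Sum>i\<in>I. \<Sum>j\<in>I. inner (z i) (blinfun_apply (a i j) (z j)))"
  shows "0 \<le> (\<Sum>i\<in>I. \<Sum>j\<in>I. inner (blinfun_apply (\<theta> (b i)) \<xi>)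
    (blinfun_apply (\<theta> (a i j)) (blinfun_apply (\<theta> (b j)) \<xi>)))"
proof -
  define c where "c = (\<Sum>i\<in>I. \<Sum>j\<in>I. adj_op (b i) o\<^sub>L (a i j o\<^sub>L b j))"
  have cij: "adj_op (b i) o\<^sub>L (a i j o\<^sub>L b j) \<in> A" if "i \<in> I" "j \<in> I" for i j
    using that a b by (intro A_compose A_adj)
  have cA: "c \<in> A" unfolding c_def using cij by (intro A_sum)
  have "0 \<le> inner z (blinfun_apply c z)" for z
    using pos[of "\<lambda>i. blinfun_apply (b i) z"] b
    by (simp add: c_def blinfun.sum_left inner_sum_right inner_adj_op' A_ops)
  then have "0 \<le> inner \<xi> (blinfun_apply (\<theta> c) \<xi>)" by (rule hom_positive[OF cA])
  also have "\<theta> c = (\<Sum>i\<in>I. \<Sum>j\<in>I. adj_op (\<theta> (b i)) o\<^sub>L (\<theta> (a i j) o\<^sub>L \<theta> (b j)))"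
    unfolding c_def using cij a b
    by (simp add: hom_sum A_sum hom_compose hom_adj A_adj A_compose)
  finally show ?thesis
    using b by (simp add: blinfun.sum_left inner_sum_right inner_adj_op' hom_ops)
qed

text \<open>
  A *-homomorphism is completely positive. For vectors in one cyclic subspace this reduces to
  positivity of the homomorphism itself. In general all vectors are split along the closed cyclic
  subspace of one of them and its orthogonal complement, both of which are invariant; the
  complementary components have fewer nonzero vectors.
\<close>

lemma hom_form_positive:
  assumes I: "finite I"
    and a: "\<And>i j. i \<in> I \<Longrightarrow> j \<in> I \<Longrightarrow> a i j \<in> A"
    and pos: "\<And>z. 0 \<le> (\<Sum>i\<in>I. \<Sum>j\<in>I. inner (z i) (blinfun_apply (a i j) (z j)))"
  shows "0 \<le> (\<Sum>i\<in>I. \<Sum>j\<in>I. inner (x i) (blinfun_apply (\<theta> (a i j)) (x j)))"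
proof (induction "card {i \<in> I. x i \<noteq> 0}" arbitrary: x rule: less_induct)
  case less
  show ?case
  proof (cases "\<forall>i\<in>I. x i = 0")
    case True
    then show ?thesis by simp
  next
    case False
    then obtain i0 where i0: "i0 \<in> I" "x i0 \<noteq> 0" by blast
    define orb where "orb = (\<lambda>b. blinfun_apply (\<theta> b) (x i0)) ` A"
    define K where "K = closure orb"
    have "subspace orb"
    proof (rule subspaceI)
      show "0 \<in> orb" using A_zero hom_zero by (force simp: orb_def)
      show "u + v \<in> orb" if uv: "u \<in> orb" "v \<in> orb" for u v
      proof -
        obtain b b' where "b \<in> A" "b' \<in> A" "u = blinfun_apply (\<theta> b) (x i0)" "v = blinfun_apply (\<theta> b') (x i0)"
          using uv by (auto simp: orb_def)
        then show ?thesis unfolding orb_def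
          by (intro image_eqI[of _ _ "b + b'"]) (auto simp: A_add hom_add blinfun.add_left)
      qed
      show "c *\<^sub>R u \<in> orb" if u: "u \<in> orb" for c u
      proof -
        obtain b where "b \<in> A" "u = blinfun_apply (\<theta> b) (x i0)" using u by (auto simp: orb_def)
        then show ?thesis unfolding orb_def
          by (intro image_eqI[of _ _ "c *\<^sub>R b"]) (auto simp: A_scaleR hom_scaleR blinfun.scaleR_left)
      qed
    qed
    then have K: "subspace K" "closed K" by (auto simp: K_def subspace_closure)
    have inv: "blinfun_apply (\<theta> T) v \<in> K" if T: "T \<in> A" and v: "v \<in> K" for T v
    proof -
      have "blinfun_apply (\<theta> T) ` orb \<subseteq> orb"
      proof (intro image_subsetI)
        fix v assume "v \<in> orb"
        then obtain b where "b \<in> A" "v = blinfun_apply (\<theta> b) (x i0)" by (auto simp: orb_def)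
        then show "blinfun_apply (\<theta> T) v \<in> orb"
          unfolding orb_def using T by (intro image_eqI[of _ _ "T o\<^sub>L b"]) (auto simp: A_compose hom_compose)
      qed
      then have "blinfun_apply (\<theta> T) ` closure orb \<subseteq> closure orb"
        by (intro image_closure_subset continuous_intros) (use closure_subset in auto)
      then show ?thesis using v by (auto simp: K_def)
    qed
    have x0K: "x i0 \<in> K"
      unfolding K_def
      by (rule subsetD[OF closure_subset]) (use A_id hom_id in \<open>force simp: orb_def\<close>)
    have "\<exists>y\<in>K. \<forall>k\<in>K. inner (x i - y) k = 0" for i
      using K by (rule orthogonal_projection_exists)
    then obtain y where yK: "\<And>i. y i \<in> K" and y_orth: "\<And>i k. k \<in> K \<Longrightarrow> inner (x i - y i) k = 0"
      by metis
    define z where "z i = x i - y i" for i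
    have x_eq: "x i = y i + z i" for i by (simp add: z_def)
    have z0: "z i = 0" if "x i \<in> K" for i
    proof -
      have "z i \<in> K" unfolding z_def using K that yK by (intro subspace_diff)
      then have "inner (z i) (z i) = 0" using y_orth by (simp add: z_def)
      then show ?thesis by simp
    qed
    have zx: "{i \<in> I. z i \<noteq> 0} \<subset> {i \<in> I. x i \<noteq> 0}"
      using z0 subspace_0[OF K(1)] i0 x0K by fastforce
    have z_pos: "0 \<le> (\<Sum>i\<in>I. \<Sum>j\<in>I. inner (z i) (blinfun_apply (\<theta> (a i j)) (z j)))"
      by (rule less) (use zx I in \<open>auto intro!: psubset_card_mono\<close>)
    have "\<exists>b. (\<forall>n. b n \<in> A) \<and> (\<lambda>n. blinfun_apply (\<theta> (b n)) (x i0)) \<longlonglongrightarrow> y i" for i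
    proof -
      obtain f where f: "\<And>n. f n \<in> orb" "f \<longlonglongrightarrow> y i"
        using yK[of i] by (auto simp: K_def closure_sequential)
      then have "\<exists>b. b \<in> A \<and> f n = blinfun_apply (\<theta> b) (x i0)" for n by (auto simp: orb_def image_iff)
      then obtain b where "\<And>n. b n \<in> A" "\<And>n. f n = blinfun_apply (\<theta> (b n)) (x i0)" by metis
      moreover from this have "f = (\<lambda>n. blinfun_apply (\<theta> (b n)) (x i0))" by auto
      ultimately show ?thesis using f(2) by (intro exI[of _ b]) simp
    qed
    then obtain b where bA: "\<And>i n. b i n \<in> A"
      and b_lim: "\<And>i. (\<lambda>n. blinfun_apply (\<theta> (b i n)) (x i0)) \<longlonglongrightarrow> y i"
      by metis
    have y_pos: "0 \<le> (\<Sum>i\<in>I. \<Sum>j\<in>I. inner (y i) (blinfun_apply (\<theta> (a i j)) (y j)))"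
    proof (rule LIMSEQ_le_const)
      show "(\<lambda>n. \<Sum>i\<in>I. \<Sum>j\<in>I. inner (blinfun_apply (\<theta> (b i n)) (x i0))
          (blinfun_apply (\<theta> (a i j)) (blinfun_apply (\<theta> (b j n)) (x i0))))
        \<longlonglongrightarrow> (\<Sum>i\<in>I. \<Sum>j\<in>I. inner (y i) (blinfun_apply (\<theta> (a i j)) (y j)))"
        by (intro tendsto_intros b_lim)
      show "\<exists>N. \<forall>n\<ge>N. 0 \<le> (\<Sum>i\<in>I. \<Sum>j\<in>I. inner (blinfun_apply (\<theta> (b i n)) (x i0))
          (blinfun_apply (\<theta> (a i j)) (blinfun_apply (\<theta> (b j n)) (x i0))))"
        using hom_form_cyclic[of I a "\<lambda>i. b i _", OF a bA pos] by blast
    qed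
    have "inner (x i) (blinfun_apply (\<theta> (a i j)) (x j)) =
        inner (y i) (blinfun_apply (\<theta> (a i j)) (y j)) + inner (z i) (blinfun_apply (\<theta> (a i j)) (z j))"
      if ij: "i \<in> I" "j \<in> I" for i j
    proof -
      have aA: "a i j \<in> A" using a ij by blast
      have "inner (z i) (blinfun_apply (\<theta> (a i j)) (y j)) = 0"
        unfolding z_def using y_orth inv[OF aA yK] by blast
      moreover have "inner (z j) (blinfun_apply (\<theta> (adj_op (a i j))) (y i)) = 0"
        unfolding z_def using y_orth inv[OF A_adj[OF aA] yK] by blast
      then have "inner (y i) (blinfun_apply (\<theta> (a i j)) (z j)) = 0"
        using inner_adj_op[OF hom_ops[OF aA], of "y i" "z j"] by (simp add: hom_adj[OF aA] inner_commute)
      ultimately show ?thesis by (simp add: x_eq blinfun.add_right inner_add_left inner_add_right)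
    qed
    then have "(\<Sum>i\<in>I. \<Sum>j\<in>I. inner (x i) (blinfun_apply (\<theta> (a i j)) (x j))) =
        (\<Sum>i\<in>I. \<Sum>j\<in>I. inner (y i) (blinfun_apply (\<theta> (a i j)) (y j))) +
        (\<Sum>i\<in>I. \<Sum>j\<in>I. inner (z i) (blinfun_apply (\<theta> (a i j)) (z j)))"
      by (simp add: sum.distrib)
    then show ?thesis using y_pos z_pos by simp
  qed
qed

end

section \<open>Arveson's extension theorem\<close>

text \<open>Matrix positivity through the real parts of the quadratic forms of \<open>A\<close> and \<open>\<i> A\<close>.\<close>

lemma positive_op_matrix_iff:
  "positive_op_matrix n A \<longleftrightarrow> (\<forall>x. 0 \<le> (\<Sum>i<n. \<Sum>j<n. inner (x i) (blinfun_apply (A i j) (x j))) \<and>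
    (\<Sum>i<n. \<Sum>j<n. inner (x i) (\<i> *\<^sub>C blinfun_apply (A i j) (x j))) = 0)"
  by (simp add: positive_op_matrix_def complex_nonneg_Reals_iff inner_eq_Re_cinner[symmetric]
      Im_cinner sum_negf)

text \<open>
  The optimal \<open>t\<close> is \<open>b / a\<close>; perturbing \<open>a\<close> and \<open>b\<close> by \<open>e\<close> avoids the
  degenerate cases.
\<close>

lemma le_of_all_scaled_mean:
  fixes x a b c :: real
  assumes a: "0 \<le> a" and b: "0 \<le> b" and c: "0 \<le> c"
    and le: "\<And>t. t > 0 \<Longrightarrow> x \<le> c / 2 * (t * a\<^sup>2 + b\<^sup>2 / t)"
  shows "x \<le> c * (a * b)"
proof -
  have bound: "x \<le> c * ((a + e) * (b + e))" if e: "e > 0" for e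
  proof -
    define t where "t = (b + e) / (a + e)"
    have pos: "a + e > 0" "b + e > 0" using a b e by auto
    then have t: "t > 0" by (simp add: t_def)
    have "t * a\<^sup>2 \<le> t * (a + e)\<^sup>2" using t a e by (intro mult_left_mono power_mono) auto
    also have "\<dots> = (a + e) * (b + e)" using pos by (simp add: t_def power2_eq_square)
    finally have 1: "t * a\<^sup>2 \<le> (a + e) * (b + e)" .
    have "b\<^sup>2 / t \<le> (b + e)\<^sup>2 / t" using t b e by (intro divide_right_mono power_mono) auto
    also have "\<dots> = (a + e) * (b + e)" using pos by (simp add: t_def power2_eq_square)
    finally have "t * a\<^sup>2 + b\<^sup>2 / t \<le> 2 * ((a + e) * (b + e))" using 1 by simp
    then have "c / 2 * (t * a\<^sup>2 + b\<^sup>2 / t) \<le> c / 2 * (2 * ((a + e) * (b + e)))"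
      using c by (intro mult_left_mono) auto
    then show ?thesis using le[OF t] by simp
  qed
  have "((\<lambda>e. c * ((a + e) * (b + e))) \<longlongrightarrow> c * ((a + 0) * (b + 0))) (at_right 0)"
    by (intro tendsto_intros)
  moreover have "eventually (\<lambda>e. x \<le> c * ((a + e) * (b + e))) (at_right 0)"
    using bound by (auto simp: eventually_at_filter)
  ultimately have "x \<le> c * ((a + 0) * (b + 0))" by (rule tendsto_lowerbound) simp
  then show ?thesis by simp
qed

lemma single_scaleR: "Poly_Mapping.single k (r *\<^sub>R v) = r *\<^sub>R Poly_Mapping.single k v"
  by (rule poly_mapping_eqI) (simp add: lookup_scaleR lookup_single when_def)

text \<open>
  Finitely supported operator-valued functions on pairs of vectors model the tensor product of B(H)
  with \<open>H\<close> and its conjugate before passing to the quotient by bilinearity: the value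
  \<open>T\<close> at the key \<open>(x, y)\<close> stands for \<open>T \<otimes> y\<close> tensored with the conjugate of \<open>x\<close>,
  and a functional is to take it to \<open>\<langle>x, \<Theta> T y\<rangle>\<close>. The form \<open>test_form z\<close> evaluates
  \<open>T\<close> at \<open>z x\<close> and \<open>z y\<close>, for an arbitrary function \<open>z\<close>. Working before the quotient
  avoids the choice of a basis; bilinearity of the extended functional is recovered afterwards.
\<close>

type_synonym 'h op_kernel = "('h \<times> 'h) \<Rightarrow>\<^sub>0 ('h \<Rightarrow>\<^sub>L 'h)"

definition test_form :: "('h \<Rightarrow> 'h) \<Rightarrow> ('h::chilbert_space) op_kernel \<Rightarrow> real" where
  "test_form z M = sum_keys (\<lambda>(x, y) T. inner (z x) (blinfun_apply T (z y))) M"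

text \<open>
  Only real parts are tested. Hence antihermitian kernels lie in the cone together with their
  negatives, and non-hermitian kernels can be majorised as well.
\<close>

definition positive_kernels :: "('h::chilbert_space) op_kernel set" where
  "positive_kernels = {M. \<forall>z. 0 \<le> test_form z M}"

lemma linear_test_form: "linear (test_form z)"
  unfolding test_form_def
  by (rule linearI)
    (auto intro!: sum_keys_add sum_keys_scaleR simp: blinfun.bilinear_simps inner_add_right)

lemma test_form_single:
  "test_form z (Poly_Mapping.single (x, y) T) = inner (z x) (blinfun_apply T (z y))"
  unfolding test_form_def by (subst sum_keys_single) auto

text \<open>
  A formal linear combination of vectors is a list of coefficients and vectors; \<open>lin_comb g\<close>
  evaluates it after applying \<open>g\<close> to the vectors. The elementary kernel
  \<open>u\<^sup>* \<otimes> T \<otimes> v\<close> of two formal linear combinations is \<open>elem_kernel u v T\<close>.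
\<close>

definition lin_comb :: "('h::chilbert_space \<Rightarrow> 'h) \<Rightarrow> (complex \<times> 'h) list \<Rightarrow> 'h" where
  "lin_comb g us = (\<Sum>(u, x)\<leftarrow>us. u *\<^sub>C g x)"

definition elem_kernel ::
  "(complex \<times> 'h) list \<Rightarrow> (complex \<times> 'h) list \<Rightarrow> ('h \<Rightarrow>\<^sub>L 'h) \<Rightarrow> ('h::chilbert_space) op_kernel" where
  "elem_kernel us vs T =
    (\<Sum>(u, x)\<leftarrow>us. \<Sum>(v, y)\<leftarrow>vs. Poly_Mapping.single (x, y) (scaleC_op (cnj u * v) T))"

lemma linear_elem_kernel:
  assumes L: "linear L"
    and single: "\<And>u v x y. L (Poly_Mapping.single (x, y) (scaleC_op (cnj u * v) T)) =
      inner (u *\<^sub>C g x) (blinfun_apply R (v *\<^sub>C g y))"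
  shows "L (elem_kernel us vs T) = inner (lin_comb g us) (blinfun_apply R (lin_comb g vs))"
proof -
  have inner_vs: "L (\<Sum>(v, y)\<leftarrow>vs. Poly_Mapping.single (x, y) (scaleC_op (cnj u * v) T)) =
      inner (u *\<^sub>C g x) (blinfun_apply R (lin_comb g vs))" for u x
    by (induction vs)
      (auto simp: lin_comb_def linear_0[OF L] linear_add[OF L] single blinfun.add_right inner_add_right)
  show ?thesis
    unfolding elem_kernel_def
    by (induction us)
      (auto simp: lin_comb_def linear_0[OF L] linear_add[OF L] inner_vs[unfolded lin_comb_def] inner_add_left)
qed

lemma test_form_elem_kernel:
  assumes "T \<in> bounded_ops"
  shows "test_form z (elem_kernel us vs T) = inner (lin_comb z us) (blinfun_apply T (lin_comb z vs))"
  by (rule linear_elem_kernel[OF linear_test_form])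
    (simp add: test_form_single inner_scaleC_left bounded_opsD[OF assms] scaleC_scaleC)

context unital_star_hom
begin

text \<open>
  The kernels with entries in \<open>A\<close>, and the functional on them given by \<open>\<theta>\<close>. It is
  nonnegative on positive kernels because \<open>\<theta>\<close> is completely positive.
\<close>

definition A_kernels :: "'h op_kernel set" where
  "A_kernels = {M. \<forall>k. Poly_Mapping.lookup M k \<in> A}"

definition hom_functional :: "'h op_kernel \<Rightarrow> real" where
  "hom_functional M = sum_keys (\<lambda>(x, y) T. inner x (blinfun_apply (\<theta> T) y)) M"

lemma subspace_A_kernels: "subspace A_kernels"
  by (rule subspaceI) (auto simp: A_kernels_def A_zero A_add A_scaleR lookup_add lookup_scaleR)

lemma single_A_kernels: "T \<in> A \<Longrightarrow> Poly_Mapping.single k T \<in> A_kernels"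
  by (simp add: A_kernels_def lookup_single when_def A_zero)

lemma hom_functional_add:
  "M \<in> A_kernels \<Longrightarrow> N \<in> A_kernels \<Longrightarrow> hom_functional (M + N) = hom_functional M + hom_functional N"
  unfolding hom_functional_def
  by (rule sum_keys_add)
    (auto simp: A_kernels_def hom_add hom_zero blinfun.add_left inner_add_right)

lemma hom_functional_scaleR:
  "M \<in> A_kernels \<Longrightarrow> hom_functional (r *\<^sub>R M) = r * hom_functional M"
  unfolding hom_functional_def
  by (rule sum_keys_scaleR)
    (auto simp: A_kernels_def hom_scaleR hom_zero blinfun.scaleR_left)

lemma hom_functional_single:
  "hom_functional (Poly_Mapping.single (x, y) T) = inner x (blinfun_apply (\<theta> T) y)"
  unfolding hom_functional_def by (subst sum_keys_single) (auto simp: hom_zero)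

lemma hom_functional_positive:
  assumes M: "M \<in> A_kernels" and pos: "M \<in> positive_kernels"
  shows "0 \<le> hom_functional M"
proof -
  define F where "F = fst ` Poly_Mapping.keys M \<union> snd ` Poly_Mapping.keys M"
  have F: "finite F" by (simp add: F_def)
  have keys: "Poly_Mapping.keys M \<subseteq> F \<times> F" by (force simp: F_def)
  have "test_form z M = (\<Sum>x\<in>F. \<Sum>y\<in>F. inner (z x) (blinfun_apply (Poly_Mapping.lookup M (x, y)) (z y)))" for z
    unfolding test_form_def
    by (subst sum_keys_superset[OF _ keys]) (auto simp: F sum.cartesian_product case_prod_unfold)
  moreover have "hom_functional M = (\<Sum>x\<in>F. \<Sum>y\<in>F. inner x (blinfun_apply (\<theta> (Poly_Mapping.lookup M (x, y))) y))"
    unfolding hom_functional_def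
    by (subst sum_keys_superset[OF _ keys]) (auto simp: F hom_zero sum.cartesian_product case_prod_unfold)
  moreover have "0 \<le> (\<Sum>x\<in>F. \<Sum>y\<in>F. inner x (blinfun_apply (\<theta> (Poly_Mapping.lookup M (x, y))) y))"
    by (rule hom_form_positive[OF F, where x = "\<lambda>x. x"])
      (use M pos calculation(1) in \<open>auto simp: A_kernels_def positive_kernels_def\<close>)
  ultimately show ?thesis by simp
qed

lemma A_kernels_majorise: "\<exists>N\<in>A_kernels. N - M \<in> positive_kernels"
proof -
  define F where "F = fst ` Poly_Mapping.keys M \<union> snd ` Poly_Mapping.keys M"
  define c where "c = (\<Sum>k\<in>Poly_Mapping.keys M. norm (Poly_Mapping.lookup M k))"
  define N :: "'h op_kernel" where "N = (\<Sum>x\<in>F. Poly_Mapping.single (x, x) (c *\<^sub>R id_blinfun))"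
  have F: "finite F" by (simp add: F_def)
  have "N \<in> A_kernels" unfolding N_def
    by (intro subspace_sum[OF subspace_A_kernels] single_A_kernels A_scaleR A_id)
  moreover have "0 \<le> test_form z (N - M)" for z
  proof -
    define q where "q = (\<Sum>x\<in>F. (norm (z x))\<^sup>2)"
    have qge: "(norm (z x))\<^sup>2 \<le> q" if "x \<in> F" for x
      unfolding q_def by (rule member_le_sum) (use that F in auto)
    have "test_form z N = c * q"
      unfolding N_def q_def
      by (simp add: linear_sum[OF linear_test_form] test_form_single blinfun.scaleR_left
          power2_norm_eq_inner sum_distrib_left)
    moreover have "test_form z M \<le> c * q"
      unfolding test_form_def sum_keys_def c_def sum_distrib_right
    proof (rule sum_mono, clarify)
      fix x y assume k: "(x, y) \<in> Poly_Mapping.keys M"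
      let ?T = "Poly_Mapping.lookup M (x, y)"
      have xy: "x \<in> F" "y \<in> F" using k by (force simp: F_def)+
      have "inner (z x) (blinfun_apply ?T (z y)) \<le> norm (z x) * norm (blinfun_apply ?T (z y))"
        by (rule norm_cauchy_schwarz)
      also have "\<dots> \<le> norm (z x) * (norm ?T * norm (z y))"
        by (intro mult_left_mono norm_blinfun) simp
      also have "\<dots> = norm ?T * (norm (z x) * norm (z y))" by simp
      also have "\<dots> \<le> norm ?T * q"
      proof (rule mult_left_mono)
        have "2 * (norm (z x) * norm (z y)) \<le> (norm (z x))\<^sup>2 + (norm (z y))\<^sup>2"
          using sum_squares_bound[of "norm (z x)" "norm (z y)"] by simp
        then show "norm (z x) * norm (z y) \<le> q" using qge[OF xy(1)] qge[OF xy(2)] by simp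
      qed simp
      finally show "inner (z x) (blinfun_apply ?T (z y)) \<le> norm ?T * q" .
    qed
    ultimately show ?thesis by (simp add: linear_diff[OF linear_test_form])
  qed
  ultimately show ?thesis unfolding positive_kernels_def by blast
qed

lemma functional_extension:
  "\<exists>S. linear S \<and> (\<forall>M\<in>A_kernels. S M = hom_functional M) \<and> (\<forall>M\<in>positive_kernels. 0 \<le> S M)"
proof (rule positive_functional_extension)
  show "\<And>M. \<exists>N\<in>A_kernels. N - M \<in> positive_kernels" by (rule A_kernels_majorise)
qed (auto simp: subspace_A_kernels hom_functional_add hom_functional_scaleR hom_functional_positive
      positive_kernels_def linear_0[OF linear_test_form] linear_add[OF linear_test_form]
      linear_scale[OF linear_test_form])

text \<open>
  The extended functional at \<open>u\<^sup>* \<otimes> T \<otimes> v\<close> is controlled by the vectors that the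
  formal combinations stand for. Hence it vanishes on the bilinearity relations.
\<close>

lemma functional_bound:
  assumes S: "linear S" and S_A: "\<And>M. M \<in> A_kernels \<Longrightarrow> S M = hom_functional M"
    and S_pos: "\<And>M. M \<in> positive_kernels \<Longrightarrow> 0 \<le> S M"
    and T: "T \<in> bounded_ops"
  shows "\<bar>S (elem_kernel us vs T)\<bar> \<le> norm T * (norm (lin_comb id us) * norm (lin_comb id vs))"
proof -
  have S_id: "S (elem_kernel ws ws id_blinfun) = (norm (lin_comb id ws))\<^sup>2" for ws
  proof -
    have "S (elem_kernel ws ws id_blinfun) = inner (lin_comb id ws) (blinfun_apply id_blinfun (lin_comb id ws))"
      by (rule linear_elem_kernel[OF S])
        (simp add: S_A single_A_kernels A_scaleC A_id hom_functional_single hom_scaleC hom_id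
          inner_scaleC_left scaleC_scaleC)
    then show ?thesis by (simp add: power2_norm_eq_inner)
  qed
  have le: "S (elem_kernel us vs R) \<le> norm R * (norm (lin_comb id us) * norm (lin_comb id vs))"
    if R: "R \<in> bounded_ops" for R
  proof (rule le_of_all_scaled_mean)
    fix t :: real assume t: "t > 0"
    define M where "M = (norm R / 2) *\<^sub>R (t *\<^sub>R elem_kernel us us id_blinfun
      + (1 / t) *\<^sub>R elem_kernel vs vs id_blinfun) - elem_kernel us vs R"
    have "0 \<le> test_form z M" for z
    proof -
      let ?a = "norm (lin_comb z us)" and ?b = "norm (lin_comb z vs)"
      have "inner (lin_comb z us) (blinfun_apply R (lin_comb z vs)) \<le> ?a * norm (blinfun_apply R (lin_comb z vs))"
        by (rule norm_cauchy_schwarz)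
      also have "\<dots> \<le> ?a * (norm R * ?b)" by (intro mult_left_mono norm_blinfun) simp
      also have "\<dots> = norm R / 2 * (2 * (?a * ?b))" by simp
      also have "\<dots> \<le> norm R / 2 * (t * ?a\<^sup>2 + ?b\<^sup>2 / t)"
      proof (rule mult_left_mono)
        have "0 \<le> (t * ?a - ?b)\<^sup>2 / t" using t by simp
        also have "\<dots> = t * ?a\<^sup>2 + ?b\<^sup>2 / t - 2 * (?a * ?b)"
          using t by (simp add: field_simps power2_eq_square)
        finally show "2 * (?a * ?b) \<le> t * ?a\<^sup>2 + ?b\<^sup>2 / t" by simp
      qed simp
      finally show ?thesis
        unfolding M_def
        by (simp add: linear_diff[OF linear_test_form] linear_add[OF linear_test_form]
            linear_scale[OF linear_test_form] test_form_elem_kernel R power2_norm_eq_inner)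
    qed
    then have "0 \<le> S M" by (intro S_pos) (simp add: positive_kernels_def)
    then show "S (elem_kernel us vs R) \<le> norm R / 2 * (t * (norm (lin_comb id us))\<^sup>2 + (norm (lin_comb id vs))\<^sup>2 / t)"
      unfolding M_def
      by (simp add: linear_diff[OF S] linear_add[OF S] linear_scale[OF S] S_id)
  qed auto
  have "elem_kernel us vs (- T) = - elem_kernel us vs T"
  proof -
    have "scaleC_op a (- T) = - scaleC_op a T" for a by (rule cop.scale_minus_right)
    then have row: "(\<Sum>(v, y)\<leftarrow>vs. Poly_Mapping.single (x, y) (scaleC_op (a * v) (- T))) =
        - (\<Sum>(v, y)\<leftarrow>vs. Poly_Mapping.single (x, y) (scaleC_op (a * v) T))" for a and x :: 'h
      by (induction vs) (auto simp: single_uminus)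
    show ?thesis unfolding elem_kernel_def by (induction us) (auto simp: row simp del: cop.scale_minus_right)
  qed
  then have "- S (elem_kernel us vs T) \<le> norm T * (norm (lin_comb id us) * norm (lin_comb id vs))"
    using le[OF bounded_ops_minus[OF T]] by (simp add: linear_neg[OF S])
  then show ?thesis using le[OF T] by (simp add: abs_le_iff)
qed

text \<open>
  The extended functional yields for every \<open>T\<close> in B(H) a bounded bilinear form and hence an
  operator \<open>\<Theta> T\<close>. Complete positivity of \<open>\<Theta>\<close> is positivity of the functional on the cone.
\<close>

lemma arveson_extension:
  "\<exists>\<Theta>. \<Theta> \<in> bounded_ops \<rightarrow> bounded_ops \<and> clinear_on bounded_ops \<Theta> \<and> completely_positive \<Theta> \<and>
    (\<forall>T\<in>A. \<Theta> T = \<theta> T)"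
proof -
  obtain S where S: "linear S" and S_A: "\<And>M. M \<in> A_kernels \<Longrightarrow> S M = hom_functional M"
    and S_pos: "\<And>M. M \<in> positive_kernels \<Longrightarrow> 0 \<le> S M"
    using functional_extension by blast
  define b where "b T x y = S (Poly_Mapping.single (x, y) T)" for T x y
  have bound: "\<bar>S (elem_kernel us vs T)\<bar> \<le> norm T * (norm (lin_comb id us) * norm (lin_comb id vs))"
    if "T \<in> bounded_ops" for T us vs
    by (rule functional_bound[OF S]) (use S_A S_pos that in auto)
  note S_lin = linear_add[OF S] linear_neg[OF S] linear_diff[OF S]
  have b_T_add: "b (T + T') x y = b T x y + b T' x y" for T T' x y
    by (simp add: b_def single_add S_lin)
  have b_T_scaleR: "b (r *\<^sub>R T) x y = r * b T x y" for r T x y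
    by (simp add: b_def single_scaleR linear_scale[OF S])
  have b_add_right: "b T x (y + y') = b T x y + b T x y'" if "T \<in> bounded_ops" for T x y y'
    using bound[OF that, of "[(1, x)]" "[(1, y + y'), (-1, y), (-1, y')]"]
    by (simp add: elem_kernel_def lin_comb_def S_lin single_uminus b_def scaleC_one scaleC_minus_left)
  have b_add_left: "b T (x + x') y = b T x y + b T x' y" if "T \<in> bounded_ops" for T x x' y
    using bound[OF that, of "[(1, x + x'), (-1, x), (-1, x')]" "[(1, y)]"]
    by (simp add: elem_kernel_def lin_comb_def S_lin single_uminus b_def scaleC_one scaleC_minus_left)
  have b_scaleC_right: "b T x (c *\<^sub>C y) = b (scaleC_op c T) x y" if "T \<in> bounded_ops" for T x y c
    using bound[OF that, of "[(1, x)]" "[(1, c *\<^sub>C y), (- c, y)]"]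
    by (simp add: elem_kernel_def lin_comb_def S_lin single_uminus b_def scaleC_one scaleC_minus_left)
  have b_scaleC_left: "b T (c *\<^sub>C x) y = b (scaleC_op (cnj c) T) x y" if "T \<in> bounded_ops" for T x y c
    using bound[OF that, of "[(1, c *\<^sub>C x), (- c, x)]" "[(1, y)]"]
    by (simp add: elem_kernel_def lin_comb_def S_lin single_uminus b_def scaleC_one scaleC_minus_left)
  have b_bound: "norm (b T x y) \<le> norm x * norm y * norm T" if "T \<in> bounded_ops" for T x y
    using bound[OF that, of "[(1, x)]" "[(1, y)]"]
    by (simp add: elem_kernel_def lin_comb_def b_def scaleC_one mult_ac)
  have b_bilinear: "bounded_bilinear (b T)" if T: "T \<in> bounded_ops" for T
  proof
    show "b T (r *\<^sub>R x) y = r *\<^sub>R b T x y" for r x y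
      using b_scaleC_left[OF T, of "complex_of_real r" x y]
      by (simp add: scaleR_scaleC scaleR_op[symmetric] b_T_scaleR)
    show "b T x (r *\<^sub>R y) = r *\<^sub>R b T x y" for r x y
      using b_scaleC_right[OF T, of x "complex_of_real r" y]
      by (simp add: scaleR_scaleC scaleR_op[symmetric] b_T_scaleR)
    show "\<exists>K. \<forall>x y. norm (b T x y) \<le> norm x * norm y * K" using b_bound[OF T] by blast
  qed (use b_add_left[OF T] b_add_right[OF T] in auto)
  then have "\<exists>R :: 'h \<Rightarrow>\<^sub>L 'h. T \<in> bounded_ops \<longrightarrow> (\<forall>x y. inner x (blinfun_apply R y) = b T x y)" for T
    using bounded_bilinear_form_operator by blast
  then obtain \<Theta> :: "('h \<Rightarrow>\<^sub>L 'h) \<Rightarrow> 'h \<Rightarrow>\<^sub>L 'h"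
    where \<Theta>: "\<And>T x y. T \<in> bounded_ops \<Longrightarrow> inner x (blinfun_apply (\<Theta> T) y) = b T x y"
    by metis
  have \<Theta>_scaleC: "blinfun_apply (\<Theta> (scaleC_op c T)) y = c *\<^sub>C blinfun_apply (\<Theta> T) y"
    if "T \<in> bounded_ops" for c T y
    by (rule vector_eq_ldot[THEN iffD1])
      (use that in \<open>simp add: \<Theta> bounded_ops_scaleC b_scaleC_left inner_scaleC_left[of "cnj c", simplified, symmetric]\<close>)
  have ops: "\<Theta> T \<in> bounded_ops" if T: "T \<in> bounded_ops" for T
    unfolding bounded_ops_def
  proof (intro CollectI allI)
    fix a x
    have "blinfun_apply (\<Theta> T) (a *\<^sub>C x) = blinfun_apply (\<Theta> (scaleC_op a T)) x"
      by (rule vector_eq_ldot[THEN iffD1]) (use T in \<open>simp add: \<Theta> bounded_ops_scaleC b_scaleC_right\<close>)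
    then show "blinfun_apply (\<Theta> T) (a *\<^sub>C x) = a *\<^sub>C blinfun_apply (\<Theta> T) x"
      by (simp add: \<Theta>_scaleC[OF T])
  qed
  have clin: "clinear_on bounded_ops \<Theta>"
    unfolding clinear_on_def
  proof (intro conjI ballI allI)
    fix T T' :: "'h \<Rightarrow>\<^sub>L 'h" assume "T \<in> bounded_ops" "T' \<in> bounded_ops"
    then show "\<Theta> (T + T') = \<Theta> T + \<Theta> T'"
      by (intro op_eqI) (simp add: \<Theta> bounded_ops_add b_T_add blinfun.add_left inner_add_right)
  next
    fix a and T :: "'h \<Rightarrow>\<^sub>L 'h" assume "T \<in> bounded_ops"
    then show "\<Theta> (scaleC_op a T) = scaleC_op a (\<Theta> T)"
      by (intro blinfun_eqI) (simp add: \<Theta>_scaleC)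
  qed
  \<comment> \<open>applied to \<open>B\<close> for the real part, and to \<open>\<i> B\<close> and \<open>- \<i> B\<close> for the imaginary part\<close>
  have form_pos: "0 \<le> (\<Sum>i<n. \<Sum>j<n. inner (x i) (blinfun_apply (\<Theta> (B i j)) (x j)))"
    if B: "\<And>i j. i < n \<Longrightarrow> j < n \<Longrightarrow> B i j \<in> bounded_ops"
      and pos: "\<And>z. 0 \<le> (\<Sum>i<n. \<Sum>j<n. inner (z i) (blinfun_apply (B i j) (z j)))"
    for n :: nat and B and x :: "nat \<Rightarrow> 'h"
  proof -
    define M where "M = (\<Sum>i<n. \<Sum>j<n. Poly_Mapping.single (x i, x j) (B i j))"
    have "test_form z M = (\<Sum>i<n. \<Sum>j<n. inner (z (x i)) (blinfun_apply (B i j) (z (x j))))" for z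
      by (simp add: M_def linear_sum[OF linear_test_form] test_form_single)
    then have "M \<in> positive_kernels"
      using pos[of "\<lambda>i. _ (x i)"] by (simp add: positive_kernels_def)
    then have "0 \<le> S M" by (rule S_pos)
    then show ?thesis using B by (simp add: M_def linear_sum[OF S] \<Theta> b_def)
  qed
  have cp: "completely_positive \<Theta>"
    unfolding completely_positive_def
  proof (intro allI impI)
    fix n and B :: "nat \<Rightarrow> nat \<Rightarrow> 'h \<Rightarrow>\<^sub>L 'h"
    assume "(\<forall>i<n. \<forall>j<n. B i j \<in> bounded_ops) \<and> positive_op_matrix n B"
    then have B: "\<And>i j. i < n \<Longrightarrow> j < n \<Longrightarrow> B i j \<in> bounded_ops"
      and re: "\<And>x. 0 \<le> (\<Sum>i<n. \<Sum>j<n. inner (x i) (blinfun_apply (B i j) (x j)))"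
      and im: "\<And>x. (\<Sum>i<n. \<Sum>j<n. inner (x i) (\<i> *\<^sub>C blinfun_apply (B i j) (x j))) = 0"
      by (auto simp: positive_op_matrix_iff)
    show "positive_op_matrix n (\<lambda>i j. \<Theta> (B i j))"
      unfolding positive_op_matrix_iff
    proof (intro allI conjI)
      fix x :: "nat \<Rightarrow> 'h"
      show "0 \<le> (\<Sum>i<n. \<Sum>j<n. inner (x i) (blinfun_apply (\<Theta> (B i j)) (x j)))"
        by (rule form_pos[OF B re])
      have "0 \<le> (\<Sum>i<n. \<Sum>j<n. inner (x i) (blinfun_apply (\<Theta> (scaleC_op \<i> (B i j))) (x j)))"
        by (rule form_pos) (simp_all add: B bounded_ops_scaleC im)
      moreover have "0 \<le> (\<Sum>i<n. \<Sum>j<n. inner (x i) (blinfun_apply (\<Theta> (scaleC_op (- \<i>) (B i j))) (x j)))"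
        by (rule form_pos)
          (simp_all add: B bounded_ops_scaleC scaleC_minus_left im sum_negf del: cop.scale_minus_left)
      ultimately show "(\<Sum>i<n. \<Sum>j<n. inner (x i) (\<i> *\<^sub>C blinfun_apply (\<Theta> (B i j)) (x j))) = 0"
        by (simp add: \<Theta>_scaleC B scaleC_minus_left sum_negf del: cop.scale_minus_left)
    qed
  qed
  have "\<Theta> T = \<theta> T" if T: "T \<in> A" for T
    by (rule op_eqI) (use T in \<open>simp add: \<Theta> A_ops b_def S_A single_A_kernels hom_functional_single\<close>)
  with ops clin cp show ?thesis by blast
qed

end

section \<open>Unital completely positive maps\<close>

text \<open>
  Unital completely positive maps on B(H). Values outside \<open>bounded_ops\<close> are irrelevant.
\<close>

definition ucp :: "(('h::chilbert_space \<Rightarrow>\<^sub>L 'h) \<Rightarrow> ('h \<Rightarrow>\<^sub>L 'h)) \<Rightarrow> bool" where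
  "ucp \<Theta> \<longleftrightarrow> \<Theta> \<in> bounded_ops \<rightarrow> bounded_ops \<and> clinear_on bounded_ops \<Theta> \<and>
    \<Theta> id_blinfun = id_blinfun \<and> completely_positive \<Theta>"

lemma ucp_compose:
  assumes "ucp \<Theta>" "ucp \<Psi>"
  shows "ucp (\<lambda>T. \<Theta> (\<Psi> T))"
  using assms unfolding ucp_def clinear_on_def completely_positive_def
  by (auto simp: Pi_iff)

lemma inner_scaleC_ii_self: "inner w (\<i> *\<^sub>C w) = 0" for w :: "'h::chilbert_space"
  using inner_scaleC_left[of \<i> w w] by (simp add: inner_commute scaleC_minus_left)

context
  fixes \<Theta> :: "('h::chilbert_space \<Rightarrow>\<^sub>L 'h) \<Rightarrow> ('h \<Rightarrow>\<^sub>L 'h)"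
  assumes \<Theta>: "ucp \<Theta>"
begin

lemma ucp_ops: "T \<in> bounded_ops \<Longrightarrow> \<Theta> T \<in> bounded_ops"
  using \<Theta> by (auto simp: ucp_def)

lemma ucp_id: "\<Theta> id_blinfun = id_blinfun"
  using \<Theta> by (auto simp: ucp_def)

lemma ucp_add: "S \<in> bounded_ops \<Longrightarrow> T \<in> bounded_ops \<Longrightarrow> \<Theta> (S + T) = \<Theta> S + \<Theta> T"
  using \<Theta> by (auto simp: ucp_def clinear_on_def)

lemma ucp_scaleC: "T \<in> bounded_ops \<Longrightarrow> \<Theta> (scaleC_op a T) = scaleC_op a (\<Theta> T)"
  using \<Theta> by (auto simp: ucp_def clinear_on_def)

lemma ucp_scaleR: "T \<in> bounded_ops \<Longrightarrow> \<Theta> (r *\<^sub>R T) = r *\<^sub>R \<Theta> T"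
  by (simp add: scaleR_op ucp_scaleC)

lemma ucp_diff:
  "S \<in> bounded_ops \<Longrightarrow> T \<in> bounded_ops \<Longrightarrow> \<Theta> (S - T) = \<Theta> S - \<Theta> T"
  using ucp_add[of S "- 1 *\<^sub>R T"] ucp_scaleR[of T "- 1"] bounded_ops_minus[of T] by simp

lemma ucp_matrix:
  assumes "positive_op_matrix n B" "\<And>i j. i < n \<Longrightarrow> j < n \<Longrightarrow> B i j \<in> bounded_ops"
  shows "positive_op_matrix n (\<lambda>i j. \<Theta> (B i j))"
  using \<Theta> assms by (simp add: ucp_def completely_positive_def)

text \<open>
  The matrix with entries \<open>R\<^sub>i\<^sup>* R\<^sub>j\<close> is positive, hence so is its image. At most three
  operators at a time are needed below.
\<close>

lemma ucp_gram_matrix: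
  fixes n :: nat
  assumes R: "\<And>i. i < n \<Longrightarrow> R i \<in> bounded_ops"
  shows "0 \<le> (\<Sum>i<n. \<Sum>j<n. inner (x i) (blinfun_apply (\<Theta> (adj_op (R i) o\<^sub>L R j)) (x j)))" (is ?re)
    and "(\<Sum>i<n. \<Sum>j<n. inner (x i) (\<i> *\<^sub>C blinfun_apply (\<Theta> (adj_op (R i) o\<^sub>L R j)) (x j))) = 0" (is ?im)
proof -
  have "positive_op_matrix n (\<lambda>i j. adj_op (R i) o\<^sub>L R j)"
    unfolding positive_op_matrix_iff
  proof (intro allI conjI)
    fix x :: "nat \<Rightarrow> 'h"
    let ?w = "\<Sum>i<n. blinfun_apply (R i) (x i)"
    have "(\<Sum>i<n. \<Sum>j<n. inner (x i) (blinfun_apply (adj_op (R i) o\<^sub>L R j) (x j))) = inner ?w ?w"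
      by (simp add: R inner_adj_op' inner_sum_left inner_sum_right)
        (rule sum.swap)
    then show "0 \<le> (\<Sum>i<n. \<Sum>j<n. inner (x i) (blinfun_apply (adj_op (R i) o\<^sub>L R j) (x j)))"
      by simp
    have "(\<Sum>i<n. \<Sum>j<n. inner (x i) (\<i> *\<^sub>C blinfun_apply (adj_op (R i) o\<^sub>L R j) (x j))) =
        (\<Sum>i<n. \<Sum>j<n. inner (blinfun_apply (R i) (x i)) (\<i> *\<^sub>C blinfun_apply (R j) (x j)))"
      by (intro sum.cong refl)
        (simp add: R inner_adj_op' bounded_opsD[OF bounded_ops_adj[OF R], symmetric])
    also have "\<dots> = inner ?w (\<i> *\<^sub>C ?w)"
      by (simp add: inner_sum_left inner_sum_right
          linear_sum[OF bounded_linear.linear[OF bounded_linear_scaleC]])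
        (rule sum.swap)
    finally show "(\<Sum>i<n. \<Sum>j<n. inner (x i) (\<i> *\<^sub>C blinfun_apply (adj_op (R i) o\<^sub>L R j) (x j))) = 0"
      by (simp add: inner_scaleC_ii_self)
  qed
  then have "positive_op_matrix n (\<lambda>i j. \<Theta> (adj_op (R i) o\<^sub>L R j))"
    by (rule ucp_matrix) (simp add: R bounded_ops_compose bounded_ops_adj)
  then show ?re ?im by (simp_all add: positive_op_matrix_iff)
qed

lemma ucp_adj:
  assumes T: "T \<in> bounded_ops"
  shows "\<Theta> (adj_op T) = adj_op (\<Theta> T)"
proof -
  have im: "inner x (\<i> *\<^sub>C blinfun_apply (\<Theta> T) y) + inner y (\<i> *\<^sub>C blinfun_apply (\<Theta> (adj_op T)) x)
      + inner y (\<i> *\<^sub>C blinfun_apply (\<Theta> (adj_op T o\<^sub>L T)) y) = 0" for x y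
    using ucp_gram_matrix(2)[of 2 "\<lambda>i. if i = 0 then id_blinfun else T" "\<lambda>i. if i = 0 then x else y"] T
    by (simp add: numeral_2_eq_2 ucp_id blinfun_compose_id inner_scaleC_ii_self add.assoc)
  have im': "inner x (\<i> *\<^sub>C blinfun_apply (\<Theta> T) y) = - inner y (\<i> *\<^sub>C blinfun_apply (\<Theta> (adj_op T)) x)" for x y
    using im[of x y] im[of 0 y] by (simp add: blinfun.zero_right)
  have "inner (blinfun_apply (\<Theta> (adj_op T)) x) y = inner x (blinfun_apply (\<Theta> T) y)" for x y
  proof -
    have "\<i> *\<^sub>C blinfun_apply (\<Theta> T) (- \<i> *\<^sub>C y) = blinfun_apply (\<Theta> T) y"
      by (simp only: bounded_opsD[OF ucp_ops[OF T]] scaleC_scaleC) (simp add: scaleC_one)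
    moreover have "inner (- \<i> *\<^sub>C y) (\<i> *\<^sub>C w) = - inner y w" for w
      by (simp only: inner_scaleC_left scaleC_scaleC) (simp add: scaleC_minus_left scaleC_one)
    ultimately show ?thesis
      using im'[of x "- \<i> *\<^sub>C y"] by (simp only: minus_minus inner_commute[of y])
  qed
  then show ?thesis by (rule adj_op_unique[OF ucp_ops[OF T], symmetric])
qed

lemma ucp_positive:
  assumes T: "T \<in> bounded_ops" "adj_op T = T" and pos: "\<And>z. 0 \<le> inner z (blinfun_apply T z)"
  shows "0 \<le> inner z (blinfun_apply (\<Theta> T) z)"
proof -
  have "inner z (\<i> *\<^sub>C blinfun_apply T z) = 0" for z
  proof -
    have "inner z (\<i> *\<^sub>C blinfun_apply T z) = inner (blinfun_apply T z) (\<i> *\<^sub>C z)"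
      using inner_adj_op[OF T(1), of z "\<i> *\<^sub>C z"] T(2) by (simp add: bounded_opsD[OF T(1)])
    also have "\<dots> = inner (- \<i> *\<^sub>C blinfun_apply T z) z"
      by (simp add: inner_scaleC_left)
    finally show ?thesis by (simp add: scaleC_minus_left inner_commute)
  qed
  then have "positive_op_matrix 1 (\<lambda>i j. T)" using pos by (simp add: positive_op_matrix_iff)
  then have "positive_op_matrix 1 (\<lambda>i j. \<Theta> T)" by (rule ucp_matrix) (rule T(1))
  then have "0 \<le> (\<Sum>i<1::nat. \<Sum>j<1::nat. inner z (blinfun_apply (\<Theta> T) z))"
    unfolding positive_op_matrix_iff by (elim allE[of _ "\<lambda>_. z"] conjE)
  then show ?thesis by simp
qed

text \<open>The Kadison--Schwarz inequality.\<close>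

lemma ucp_kadison_schwarz:
  assumes T: "T \<in> bounded_ops"
  shows "(norm (blinfun_apply (\<Theta> T) x))\<^sup>2 \<le> inner x (blinfun_apply (\<Theta> (adj_op T o\<^sub>L T)) x)"
  using ucp_gram_matrix(1)[of 2 "\<lambda>i. if i = 0 then id_blinfun else T"
        "\<lambda>i. if i = 0 then - blinfun_apply (\<Theta> T) x else x"] T
    by (simp add: numeral_2_eq_2 ucp_id blinfun_compose_id ucp_adj inner_adj_op' ucp_ops blinfun.minus_right
        dot_square_norm)

lemma ucp_norm_le:
  assumes T: "T \<in> bounded_ops"
  shows "norm (\<Theta> T) \<le> norm T"
proof (rule norm_blinfun_bound)
  fix x
  define N where "N = (norm T)\<^sup>2 *\<^sub>R id_blinfun - (adj_op T o\<^sub>L T)"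
  have TT: "adj_op T o\<^sub>L T \<in> bounded_ops" using T by (simp add: bounded_ops_compose bounded_ops_adj)
  have N: "N \<in> bounded_ops" unfolding N_def by (intro bounded_ops_diff bounded_ops_scaleR TT) simp
  have N_adj: "adj_op N = N"
    unfolding N_def using T TT
    by (simp add: adj_op_diff adj_op_scaleR adj_op_compose bounded_ops_scaleR bounded_ops_adj adj_adj_op)
  have "0 \<le> inner z (blinfun_apply N z)" for z
  proof -
    have "(norm (blinfun_apply T z))\<^sup>2 \<le> (norm T * norm z)\<^sup>2"
      by (intro power_mono norm_blinfun) simp
    then show ?thesis
      by (simp add: N_def blinfun.bilinear_simps inner_diff_right inner_adj_op'[OF T]
          power2_norm_eq_inner[symmetric] power_mult_distrib)
  qed
  then have "0 \<le> inner x (blinfun_apply (\<Theta> N) x)" by (rule ucp_positive[OF N N_adj])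
  moreover have "\<Theta> N = (norm T)\<^sup>2 *\<^sub>R id_blinfun - \<Theta> (adj_op T o\<^sub>L T)"
    using TT by (simp add: N_def ucp_diff ucp_scaleR ucp_id bounded_ops_scaleR)
  ultimately have "inner x (blinfun_apply (\<Theta> (adj_op T o\<^sub>L T)) x) \<le> (norm T)\<^sup>2 * (norm x)\<^sup>2"
    by (simp add: blinfun.bilinear_simps inner_diff_right power2_norm_eq_inner)
  then have "(norm (blinfun_apply (\<Theta> T) x))\<^sup>2 \<le> (norm T * norm x)\<^sup>2"
    using ucp_kadison_schwarz[OF T, of x] by (simp add: power_mult_distrib)
  then show "norm (blinfun_apply (\<Theta> T) x) \<le> norm T * norm x"
    by (rule power2_le_imp_le) simp
qed simp

text \<open>
  A coisometry \<open>U\<close> that is mapped to a coisometry \<open>V\<close> lies in the left multiplicative domain: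
  positivity of the Gram matrix of \<open>U\<^sup>*\<close>, \<open>1\<close>, \<open>T\<close> is tested at the vectors \<open>x\<close>,
  \<open>- V\<^sup>* x\<close> and \<open>t y\<close>; the part that is constant in \<open>t\<close> vanishes, hence so does the linear part.
\<close>

lemma ucp_coisometry_left:
  assumes U: "U \<in> bounded_ops" "U o\<^sub>L adj_op U = id_blinfun" "\<Theta> U o\<^sub>L adj_op (\<Theta> U) = id_blinfun"
    and T: "T \<in> bounded_ops"
  shows "\<Theta> (U o\<^sub>L T) = \<Theta> U o\<^sub>L \<Theta> T"
proof (rule op_eqI)
  fix x y
  define V where "V = \<Theta> U"
  have V: "V \<in> bounded_ops" using U ucp_ops by (simp add: V_def)
  have VV: "blinfun_apply V (blinfun_apply (adj_op V) x) = x" for x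
    using arg_cong[OF U(3), of "\<lambda>R. blinfun_apply R x"] by (simp add: V_def)
  have VV': "inner (blinfun_apply (adj_op V) x) (blinfun_apply (adj_op V) x) = inner x x" for x
    using inner_adj_op[OF V, of x "blinfun_apply (adj_op V) x"] by (simp add: VV)
  have UT: "U o\<^sub>L T \<in> bounded_ops" using U T by (simp add: bounded_ops_compose)
  define R where "R i = (if i = 0 then adj_op U else if i = 1 then id_blinfun else T)" for i :: nat
  have R: "R i \<in> bounded_ops" for i using U T by (simp add: R_def bounded_ops_adj)
  have TU: "\<Theta> (adj_op T o\<^sub>L adj_op U) = adj_op (\<Theta> (U o\<^sub>L T))"
    using ucp_adj[OF UT] U T by (simp add: adj_op_compose)
  have "0 \<le> (2 * (inner x (blinfun_apply (\<Theta> (U o\<^sub>L T)) y) - inner x (blinfun_apply V (blinfun_apply (\<Theta> T) y)))) * t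
      + inner y (blinfun_apply (\<Theta> (adj_op T o\<^sub>L T)) y) * t\<^sup>2" for t
  proof -
    define v where "v i = (if i = 0 then x else if i = 1 then - blinfun_apply (adj_op V) x else t *\<^sub>R y)" for i :: nat
    have scale: "inner w (blinfun_apply Q (t *\<^sub>R y)) = t * inner w (blinfun_apply Q y)" for w and Q :: "'h \<Rightarrow>\<^sub>L 'h"
      by (simp add: blinfun.scaleR_right)
    have Rv: "adj_op (adj_op U) = U" "adj_op (id_blinfun :: 'h \<Rightarrow>\<^sub>L 'h) = id_blinfun"
        "R 0 = adj_op U" "R 1 = id_blinfun" "R 2 = T"
        "v 0 = x" "v 1 = - blinfun_apply (adj_op V) x" "v 2 = t *\<^sub>R y"
      by (simp_all add: R_def v_def adj_adj_op U(1))
    define f where "f i j = inner (v i) (blinfun_apply (\<Theta> (adj_op (R i) o\<^sub>L R j)) (v j))" for i j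
    have "0 \<le> (\<Sum>i<3. \<Sum>j<3. f i j)"
      unfolding f_def by (rule ucp_gram_matrix(1)) (rule R)
    also have "\<dots> = f 0 0 + f 0 1 + f 0 2 + (f 1 0 + f 1 1 + f 1 2) + (f 2 0 + f 2 1 + f 2 2)"
      by (simp add: numeral_3_eq_3 numeral_2_eq_2)
    also have "f 0 0 = inner x x"
      unfolding f_def Rv by (simp add: U ucp_id)
    also have "f 0 1 = - inner x x"
      unfolding f_def Rv blinfun_compose_id V_def[symmetric] by (simp add: blinfun.minus_right VV)
    also have "f 0 2 = t * inner x (blinfun_apply (\<Theta> (U o\<^sub>L T)) y)"
      unfolding f_def Rv scale by (rule refl)
    also have "f 1 0 = - inner x x"
      unfolding f_def Rv blinfun_compose_id ucp_adj[OF U(1)] V_def[symmetric] by (simp add: VV')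
    also have "f 1 1 = inner x x"
      unfolding f_def Rv blinfun_compose_id ucp_id by (simp add: VV')
    also have "f 1 2 = - (t * inner x (blinfun_apply V (blinfun_apply (\<Theta> T) y)))"
      unfolding f_def Rv blinfun_compose_id scale by (simp add: inner_adj_op[OF V])
    also have "f 2 0 = t * inner x (blinfun_apply (\<Theta> (U o\<^sub>L T)) y)"
      unfolding f_def Rv TU inner_adj_op'[OF ucp_ops[OF UT]] inner_commute[of _ x] scale by (rule refl)
    also have "f 2 1 = - (t * inner x (blinfun_apply V (blinfun_apply (\<Theta> T) y)))"
      unfolding f_def Rv blinfun_compose_id ucp_adj[OF T] inner_adj_op'[OF ucp_ops[OF T]]
      by (simp add: inner_adj_op'[OF V] blinfun.scaleR_right inner_commute[of x])
    also have "f 2 2 = t\<^sup>2 * inner y (blinfun_apply (\<Theta> (adj_op T o\<^sub>L T)) y)"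
      unfolding f_def Rv scale by (simp add: power2_eq_square)
    finally show ?thesis by (simp add: algebra_simps)
  qed
  from linear_coefficient_eq_0[OF this]
  show "inner x (blinfun_apply (\<Theta> (U o\<^sub>L T)) y) = inner x (blinfun_apply (\<Theta> U o\<^sub>L \<Theta> T) y)"
    by (simp add: V_def)
qed

lemma ucp_unitary_conj:
  assumes U: "U \<in> bounded_ops" "U o\<^sub>L adj_op U = id_blinfun" "\<Theta> U o\<^sub>L adj_op (\<Theta> U) = id_blinfun"
    and T: "T \<in> bounded_ops"
  shows "\<Theta> (U o\<^sub>L T o\<^sub>L adj_op U) = \<Theta> U o\<^sub>L \<Theta> T o\<^sub>L adj_op (\<Theta> U)"
proof -
  note left = ucp_coisometry_left[OF U]
  have T': "adj_op T \<in> bounded_ops" and TU: "T o\<^sub>L adj_op U \<in> bounded_ops"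
    and UT: "U o\<^sub>L adj_op T \<in> bounded_ops"
    using T U(1) by (auto intro: bounded_ops_compose bounded_ops_adj)
  have "T o\<^sub>L adj_op U = adj_op (U o\<^sub>L adj_op T)"
    by (simp only: adj_op_compose[OF U(1) T'] adj_adj_op[OF T])
  then have "\<Theta> (T o\<^sub>L adj_op U) = adj_op (\<Theta> U o\<^sub>L \<Theta> (adj_op T))"
    by (simp only: ucp_adj[OF UT] left[OF T'])
  also have "\<dots> = \<Theta> T o\<^sub>L adj_op (\<Theta> U)"
    by (simp only: ucp_adj[OF T, symmetric] adj_op_compose[OF ucp_ops[OF U(1)] ucp_ops[OF T']]
        ucp_adj[OF T', symmetric] adj_adj_op[OF T])
  finally show ?thesis by (simp only: blinfun_compose_assoc left[OF TU])
qed

end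

lemma ucp_convex:
  assumes \<Theta>: "ucp \<Theta>" and \<Psi>: "ucp \<Psi>" and ab: "0 \<le> a" "0 \<le> b" "a + b = (1::real)"
  shows "ucp (\<lambda>T. a *\<^sub>R \<Theta> T + b *\<^sub>R \<Psi> T)"
  unfolding ucp_def
proof (intro conjI)
  show "(\<lambda>T. a *\<^sub>R \<Theta> T + b *\<^sub>R \<Psi> T) \<in> bounded_ops \<rightarrow> bounded_ops"
    using ucp_ops[OF \<Theta>] ucp_ops[OF \<Psi>] by (auto intro!: bounded_ops_add bounded_ops_scaleR)
  show "clinear_on bounded_ops (\<lambda>T. a *\<^sub>R \<Theta> T + b *\<^sub>R \<Psi> T)"
    by (auto simp: clinear_on_def ucp_add[OF \<Theta>] ucp_add[OF \<Psi>] ucp_scaleC[OF \<Theta>] ucp_scaleC[OF \<Psi>]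
        scaleR_op algebra_simps)
  show "a *\<^sub>R \<Theta> id_blinfun + b *\<^sub>R \<Psi> id_blinfun = id_blinfun"
    using ab by (simp add: ucp_id[OF \<Theta>] ucp_id[OF \<Psi>] scaleR_add_left[symmetric])
  show "completely_positive (\<lambda>T. a *\<^sub>R \<Theta> T + b *\<^sub>R \<Psi> T)"
    unfolding completely_positive_def
  proof (intro allI impI)
    fix n and B :: "nat \<Rightarrow> nat \<Rightarrow> 'a \<Rightarrow>\<^sub>L 'a"
    assume "(\<forall>i<n. \<forall>j<n. B i j \<in> bounded_ops) \<and> positive_op_matrix n B"
    then have "positive_op_matrix n (\<lambda>i j. \<Theta> (B i j))" "positive_op_matrix n (\<lambda>i j. \<Psi> (B i j))"
      by (auto intro: ucp_matrix[OF \<Theta>] ucp_matrix[OF \<Psi>])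
    then show "positive_op_matrix n (\<lambda>i j. a *\<^sub>R \<Theta> (B i j) + b *\<^sub>R \<Psi> (B i j))"
      using ab unfolding positive_op_matrix_iff
      by (simp add: blinfun.bilinear_simps inner_add_right scaleC_add_right sum.distrib
          linear_scale[OF bounded_linear.linear[OF bounded_linear_scaleC]] sum_distrib_left[symmetric])
  qed
qed

text \<open>
  If \<open>F\<close> and \<open>F'\<close> induce mutually inverse maps on the range of the idempotent \<open>\<phi>\<close>, then
  the Kadison--Schwarz inequalities of both force equality, and \<open>F\<close> is multiplicative for the
  Choi--Effros product.
\<close>

lemma ucp_inverse_multiplicative:
  fixes \<phi> F F' :: "('h::chilbert_space \<Rightarrow>\<^sub>L 'h) \<Rightarrow> ('h \<Rightarrow>\<^sub>L 'h)"
  assumes \<phi>: "ucp \<phi>" and F: "ucp F" and F': "ucp F'"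
    and \<phi>F: "\<And>T. T \<in> bounded_ops \<Longrightarrow> \<phi> (F T) = F T"
    and F\<phi>: "\<And>T. T \<in> bounded_ops \<Longrightarrow> F (\<phi> T) = F T"
    and FF': "\<And>T. T \<in> bounded_ops \<Longrightarrow> F (F' T) = \<phi> T"
    and F'F: "\<And>T. T \<in> bounded_ops \<Longrightarrow> F' (F T) = \<phi> T"
    and S: "S \<in> bounded_ops" "\<phi> S = S" and T: "T \<in> bounded_ops" "\<phi> T = T"
  shows "F (S o\<^sub>L T) = \<phi> (F S o\<^sub>L F T)"
proof -
  have sq_ops: "adj_op a o\<^sub>L a \<in> bounded_ops" and sq_adj: "adj_op (adj_op a o\<^sub>L a) = adj_op a o\<^sub>L a"
    if "a \<in> bounded_ops" for a :: "'h \<Rightarrow>\<^sub>L 'h"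
    using that by (simp_all add: bounded_ops_compose bounded_ops_adj adj_op_compose adj_adj_op)
  \<comment> \<open>the Kadison--Schwarz inequality for \<open>\<Theta>\<close>, followed by the positive map \<open>\<Psi>\<close>\<close>
  have ks: "inner z (blinfun_apply (\<Psi> (adj_op (\<Theta> a) o\<^sub>L \<Theta> a)) z) \<le>
      inner z (blinfun_apply (\<Psi> (\<Theta> (adj_op a o\<^sub>L a))) z)"
    if \<Theta>: "ucp \<Theta>" and \<Psi>: "ucp \<Psi>" and a: "a \<in> bounded_ops" for \<Theta> \<Psi> :: "('h \<Rightarrow>\<^sub>L 'h) \<Rightarrow> ('h \<Rightarrow>\<^sub>L 'h)" and a z
  proof -
    define D where "D = \<Theta> (adj_op a o\<^sub>L a) - (adj_op (\<Theta> a) o\<^sub>L \<Theta> a)"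
    note ops = sq_ops[OF a] ucp_ops[OF \<Theta> sq_ops[OF a]] sq_ops[OF ucp_ops[OF \<Theta> a]]
    have D: "D \<in> bounded_ops" unfolding D_def by (intro bounded_ops_diff ops)
    have "adj_op (\<Theta> (adj_op a o\<^sub>L a)) = \<Theta> (adj_op a o\<^sub>L a)"
      using ucp_adj[OF \<Theta> sq_ops[OF a]] sq_adj[OF a] by simp
    then have "adj_op D = D"
      unfolding D_def using ops sq_adj[OF ucp_ops[OF \<Theta> a]] by (simp add: adj_op_diff)
    moreover have "0 \<le> inner x (blinfun_apply D x)" for x
      using ucp_kadison_schwarz[OF \<Theta> a, of x]
      by (simp add: D_def blinfun.diff_left inner_diff_right inner_adj_op'[OF ucp_ops[OF \<Theta> a]]
          power2_norm_eq_inner)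
    ultimately have "0 \<le> inner z (blinfun_apply (\<Psi> D) z)" by (rule ucp_positive[OF \<Psi> D])
    then show ?thesis
      using ops by (simp add: D_def ucp_diff[OF \<Psi>] blinfun.diff_left inner_diff_right)
  qed
  have square: "F (adj_op a o\<^sub>L a) = \<phi> (adj_op (F a) o\<^sub>L F a)"
    if a: "a \<in> bounded_ops" "\<phi> a = a" for a
  proof -
    note Fa = ucp_ops[OF F a(1)]
    define D where "D = F (adj_op a o\<^sub>L a) - \<phi> (adj_op (F a) o\<^sub>L F a)"
    have D: "D \<in> bounded_ops"
      unfolding D_def by (intro bounded_ops_diff ucp_ops[OF F] ucp_ops[OF \<phi>] sq_ops a Fa)
    have D_adj: "adj_op D = D"
    proof -
      have "adj_op (F (adj_op a o\<^sub>L a)) = F (adj_op a o\<^sub>L a)"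
        using ucp_adj[OF F sq_ops[OF a(1)]] sq_adj[OF a(1)] by simp
      moreover have "adj_op (\<phi> (adj_op (F a) o\<^sub>L F a)) = \<phi> (adj_op (F a) o\<^sub>L F a)"
        using ucp_adj[OF \<phi> sq_ops[OF Fa]] sq_adj[OF Fa] by simp
      ultimately show ?thesis
        unfolding D_def using adj_op_diff[OF ucp_ops[OF F sq_ops[OF a(1)]] ucp_ops[OF \<phi> sq_ops[OF Fa]]] by simp
    qed
    have form: "inner z (blinfun_apply D z) = 0" for z
    proof -
      have "inner z (blinfun_apply (\<phi> (adj_op (F a) o\<^sub>L F a)) z) \<le>
          inner z (blinfun_apply (F (adj_op a o\<^sub>L a)) z)"
        using ks[OF F \<phi> a(1), of z] by (simp add: \<phi>F sq_ops a)
      moreover have "inner z (blinfun_apply (F (adj_op a o\<^sub>L a)) z) \<le>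
          inner z (blinfun_apply (\<phi> (adj_op (F a) o\<^sub>L F a)) z)"
        using ks[OF F' F Fa, of z] a by (simp add: F'F FF' sq_ops Fa)
      ultimately show ?thesis by (simp add: D_def blinfun.diff_left inner_diff_right)
    qed
    have "inner x (blinfun_apply D y) = 0" for x y
    proof -
      have "inner y (blinfun_apply D x) = inner x (blinfun_apply D y)"
        using inner_adj_op[OF D, of y x] D_adj by (simp add: inner_commute)
      then show ?thesis
        using form[of "x + y"] form[of x] form[of y]
        by (simp add: blinfun.add_right inner_add_left inner_add_right)
    qed
    then have "D = 0" by (intro op_eqI) simp
    then show ?thesis by (simp add: D_def)
  qed
  \<comment> \<open>polarisation: the sesquilinear defect \<open>E\<close> vanishes on the diagonal of the range of \<open>\<phi>\<close>\<close>
  define E where "E a c = F (adj_op a o\<^sub>L c) - \<phi> (adj_op (F a) o\<^sub>L F c)" for a c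
  have comp: "(a + b) o\<^sub>L c = (a o\<^sub>L c) + (b o\<^sub>L c)" "a o\<^sub>L (b + c) = (a o\<^sub>L b) + (a o\<^sub>L c)"
    "scaleC_op u a o\<^sub>L b = scaleC_op u (a o\<^sub>L b)" for a b c :: "'h \<Rightarrow>\<^sub>L 'h" and u
    by (auto intro!: blinfun_eqI simp: blinfun.bilinear_simps)
  have comp_scale: "a o\<^sub>L scaleC_op u b = scaleC_op u (a o\<^sub>L b)" if "a \<in> bounded_ops" for a b :: "'h \<Rightarrow>\<^sub>L 'h" and u
    by (rule blinfun_eqI) (simp add: bounded_opsD[OF that])
  have E0: "E a a = 0" if "a \<in> bounded_ops" "\<phi> a = a" for a
    using square[OF that] by (simp add: E_def)
  have E_sum: "E (a + c) (a + c) = E a a + E a c + E c a + E c c"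
    if "a \<in> bounded_ops" "c \<in> bounded_ops" for a c
    using that
    by (simp add: E_def adj_op_add ucp_ops[OF F] ucp_add[OF F] ucp_add[OF \<phi>] comp
        bounded_ops_add bounded_ops_adj bounded_ops_compose)
  have E_anti: "E a c + E c a = 0"
    if "a \<in> bounded_ops" "\<phi> a = a" "c \<in> bounded_ops" "\<phi> c = c" for a c
    using E_sum[of a c] E0[of "a + c"] E0[of a] E0[of c] that
    by (simp add: bounded_ops_add ucp_add[OF \<phi>])
  have E_right: "E a (scaleC_op u c) = scaleC_op u (E a c)"
    if "a \<in> bounded_ops" "c \<in> bounded_ops" for a c u
    using that
    by (simp add: E_def comp_scale ucp_scaleC[OF F] ucp_scaleC[OF \<phi>] bounded_ops_adj
        bounded_ops_compose ucp_ops[OF F] cop.scale_right_diff_distrib)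
  have E_left: "E (scaleC_op u a) c = scaleC_op (cnj u) (E a c)"
    if "a \<in> bounded_ops" "c \<in> bounded_ops" for a c u
    using that
    by (simp add: E_def comp adj_op_scaleC ucp_scaleC[OF F] ucp_scaleC[OF \<phi>] bounded_ops_adj
        bounded_ops_compose ucp_ops[OF F] cop.scale_right_diff_distrib)
  have E_zero: "E a c = 0" if a: "a \<in> bounded_ops" "\<phi> a = a" and c: "c \<in> bounded_ops" "\<phi> c = c" for a c
  proof -
    have "scaleC_op \<i> (E a c) - scaleC_op \<i> (E c a) = 0"
      using E_anti[of a "scaleC_op \<i> c"] a c
      by (simp add: bounded_ops_scaleC ucp_scaleC[OF \<phi>] E_right E_left)
    then have "scaleC_op \<i> (E a c - E c a) = 0" by (simp add: cop.scale_right_diff_distrib)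
    then have "E a c = E c a" by (simp add: cop.scale_eq_0_iff)
    with E_anti[OF a c] have "2 *\<^sub>R E a c = 0" by (simp add: scaleR_2)
    then show ?thesis by simp
  qed
  have "E (adj_op S) T = 0"
    using S T by (intro E_zero) (simp_all add: bounded_ops_adj ucp_adj[OF \<phi>])
  then show ?thesis
    using S by (simp add: E_def adj_adj_op ucp_adj[OF F] ucp_ops[OF F])
qed

section \<open>Equivariant maps and rigidity of minimal maps\<close>

lemma unitary_repD:
  fixes G :: "('g, 'm) monoid_scheme"
  assumes rep: "unitary_rep G \<pi>" and g: "g \<in> carrier G"
  shows "\<pi> g \<in> bounded_ops" "adj_op (\<pi> g) o\<^sub>L \<pi> g = id_blinfun" "\<pi> g o\<^sub>L adj_op (\<pi> g) = id_blinfun"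
    and "h \<in> carrier G \<Longrightarrow> \<pi> (g \<otimes>\<^bsub>G\<^esub> h) = \<pi> g o\<^sub>L \<pi> h"
  using assms by (auto simp: unitary_rep_def unitary_group_def hom_def)

lemma unitary_rep_one:
  fixes G :: "('g, 'm) monoid_scheme"
  assumes rep: "unitary_rep G \<pi>"
  shows "\<pi> \<one>\<^bsub>G\<^esub> = id_blinfun"
proof -
  interpret group G using rep by (simp add: unitary_rep_def)
  note u = unitary_repD[OF rep one_closed]
  have "\<pi> \<one>\<^bsub>G\<^esub> = (adj_op (\<pi> \<one>\<^bsub>G\<^esub>) o\<^sub>L \<pi> \<one>\<^bsub>G\<^esub>) o\<^sub>L \<pi> \<one>\<^bsub>G\<^esub>"
    by (simp only: u blinfun_compose_id)
  also have "\<dots> = adj_op (\<pi> \<one>\<^bsub>G\<^esub>) o\<^sub>L \<pi> (\<one>\<^bsub>G\<^esub> \<otimes>\<^bsub>G\<^esub> \<one>\<^bsub>G\<^esub>)"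
    by (simp only: blinfun_compose_assoc u(4)[OF one_closed])
  also have "\<dots> = id_blinfun" by (simp add: u)
  finally show ?thesis .
qed

lemma unitary_rep_inv:
  fixes G :: "('g, 'm) monoid_scheme"
  assumes rep: "unitary_rep G \<pi>" and g: "g \<in> carrier G"
  shows "\<pi> (inv\<^bsub>G\<^esub> g) = adj_op (\<pi> g)"
proof -
  interpret group G using rep by (simp add: unitary_rep_def)
  have "\<pi> (inv\<^bsub>G\<^esub> g) = (\<pi> (inv\<^bsub>G\<^esub> g) o\<^sub>L \<pi> g) o\<^sub>L adj_op (\<pi> g)"
    by (simp only: blinfun_compose_assoc unitary_repD[OF rep g] blinfun_compose_id)
  also have "\<pi> (inv\<^bsub>G\<^esub> g) o\<^sub>L \<pi> g = id_blinfun"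
    using unitary_repD(4)[OF rep inv_closed[OF g] g] g by (simp add: unitary_rep_one[OF rep])
  finally show ?thesis by (simp only: blinfun_compose_id)
qed

lemma op_act_eq:
  fixes G :: "('g, 'm) monoid_scheme"
  assumes "unitary_rep G \<pi>" "g \<in> carrier G"
  shows "op_act G \<pi> g T = \<pi> g o\<^sub>L T o\<^sub>L adj_op (\<pi> g)"
  by (simp add: op_act_def unitary_rep_inv[OF assms])

lemma op_act_ops:
  fixes G :: "('g, 'm) monoid_scheme"
  assumes "unitary_rep G \<pi>" "g \<in> carrier G" "T \<in> bounded_ops"
  shows "op_act G \<pi> g T \<in> bounded_ops"
  using assms unitary_repD[OF assms(1,2)]
  by (simp add: op_act_eq bounded_ops_compose bounded_ops_adj)

lemma op_act_mult:
  fixes G :: "('g, 'm) monoid_scheme"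
  assumes rep: "unitary_rep G \<pi>" and g: "g \<in> carrier G" and h: "h \<in> carrier G"
  shows "op_act G \<pi> (g \<otimes>\<^bsub>G\<^esub> h) T = op_act G \<pi> g (op_act G \<pi> h T)"
proof -
  interpret group G using rep by (simp add: unitary_rep_def)
  show ?thesis using g h
    by (simp add: op_act_eq[OF rep] unitary_repD[OF rep] adj_op_compose blinfun_compose_assoc)
qed

lemma ucp_op_act:
  fixes G :: "('g, 'm) monoid_scheme" and \<pi> :: "'g \<Rightarrow> ('h::chilbert_space \<Rightarrow>\<^sub>L 'h)"
  assumes rep: "unitary_rep G \<pi>" and g: "g \<in> carrier G"
  shows "ucp (op_act G \<pi> g)"
  unfolding ucp_def
proof (intro conjI)
  note u = unitary_repD[OF rep g]
  show "op_act G \<pi> g \<in> bounded_ops \<rightarrow> bounded_ops" using op_act_ops[OF rep g] by auto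
  show "op_act G \<pi> g id_blinfun = id_blinfun"
    by (simp add: op_act_eq[OF rep g] blinfun_compose_id u)
  show "clinear_on bounded_ops (op_act G \<pi> g)"
    unfolding clinear_on_def op_act_eq[OF rep g]
    by (auto intro!: blinfun_eqI simp: blinfun.bilinear_simps bounded_opsD[OF u(1)])
  show "completely_positive (op_act G \<pi> g)"
    unfolding completely_positive_def
  proof (intro allI impI, elim conjE)
    fix n and B :: "nat \<Rightarrow> nat \<Rightarrow> 'h \<Rightarrow>\<^sub>L 'h"
    assume pos: "positive_op_matrix n B"
    have re: "inner x (blinfun_apply (op_act G \<pi> g T) y) =
        inner (blinfun_apply (adj_op (\<pi> g)) x) (blinfun_apply T (blinfun_apply (adj_op (\<pi> g)) y))" for x y T
      by (simp add: op_act_eq[OF rep g] inner_adj_op[OF u(1)])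
    have im: "inner x (\<i> *\<^sub>C blinfun_apply (op_act G \<pi> g T) y) =
        inner (blinfun_apply (adj_op (\<pi> g)) x) (\<i> *\<^sub>C blinfun_apply T (blinfun_apply (adj_op (\<pi> g)) y))" for x y T
      by (simp add: op_act_eq[OF rep g] inner_adj_op[OF u(1)] bounded_opsD[OF u(1)])
    show "positive_op_matrix n (\<lambda>i j. op_act G \<pi> g (B i j))"
      unfolding positive_op_matrix_iff re im
      using pos[unfolded positive_op_matrix_iff, THEN spec, of "\<lambda>i. blinfun_apply (adj_op (\<pi> g)) (_ i)"]
      by blast
  qed
qed

text \<open>
  Unital completely positive maps that intertwine the action with its twist by \<open>\<alpha>\<close>. Only the
  values of \<open>\<alpha>\<close> on the carrier matter, and \<open>\<alpha>\<close> need not be an automorphism.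
\<close>

definition ucp_along ::
  "('g, 'm) monoid_scheme \<Rightarrow> ('g \<Rightarrow> ('h::chilbert_space \<Rightarrow>\<^sub>L 'h)) \<Rightarrow> ('g \<Rightarrow> 'g) \<Rightarrow>
    (('h \<Rightarrow>\<^sub>L 'h) \<Rightarrow> ('h \<Rightarrow>\<^sub>L 'h)) \<Rightarrow> bool" where
  "ucp_along G \<pi> \<alpha> \<Theta> \<longleftrightarrow> ucp \<Theta> \<and>
    (\<forall>g\<in>carrier G. \<forall>T\<in>bounded_ops. \<Theta> (op_act G \<pi> g T) = op_act G \<pi> (\<alpha> g) (\<Theta> T))"

lemma ucp_along_ucp: "ucp_along G \<pi> \<alpha> \<Theta> \<Longrightarrow> ucp \<Theta>"
  by (simp add: ucp_along_def)

lemma gamma_maps_iff: "\<psi> \<in> gamma_maps G \<pi> \<longleftrightarrow> ucp_along G \<pi> (\<lambda>g. g) \<psi>"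
  by (auto simp: gamma_maps_def ucp_along_def ucp_def)

lemma ucp_along_compose:
  assumes "ucp_along G \<pi> \<alpha> \<Theta>" "ucp_along G \<pi> \<beta> \<Psi>"
    and "\<And>g. g \<in> carrier G \<Longrightarrow> \<beta> g \<in> carrier G"
    and "\<And>g. g \<in> carrier G \<Longrightarrow> \<gamma> g = \<alpha> (\<beta> g)"
  shows "ucp_along G \<pi> \<gamma> (\<lambda>T. \<Theta> (\<Psi> T))"
  using assms ucp_ops[of \<Psi>] by (auto simp: ucp_along_def ucp_compose)

context
  fixes G :: "('g, 'm) monoid_scheme" and \<pi> :: "'g \<Rightarrow> ('h::chilbert_space \<Rightarrow>\<^sub>L 'h)"
  assumes rep: "unitary_rep G \<pi>"
begin

lemma gamma_maps_compose:
  "\<theta> \<in> gamma_maps G \<pi> \<Longrightarrow> \<psi> \<in> gamma_maps G \<pi> \<Longrightarrow> (\<lambda>T. \<theta> (\<psi> T)) \<in> gamma_maps G \<pi>"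
  using ucp_along_compose[of G \<pi> "\<lambda>g. g" \<theta> "\<lambda>g. g" \<psi> "\<lambda>g. g"] by (simp add: gamma_maps_iff)

lemma gamma_maps_convex:
  assumes \<theta>: "\<theta> \<in> gamma_maps G \<pi>" and \<psi>: "\<psi> \<in> gamma_maps G \<pi>"
    and ab: "0 \<le> a" "0 \<le> b" "a + b = (1::real)"
  shows "(\<lambda>T. a *\<^sub>R \<theta> T + b *\<^sub>R \<psi> T) \<in> gamma_maps G \<pi>"
proof -
  have "op_act G \<pi> g (a *\<^sub>R S + b *\<^sub>R T) = a *\<^sub>R op_act G \<pi> g S + b *\<^sub>R op_act G \<pi> g T" for g S T
    by (rule blinfun_eqI) (simp add: op_act_def blinfun.bilinear_simps)
  then show ?thesis
    using assms by (auto simp: gamma_maps_iff ucp_along_def ucp_convex)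
qed

text \<open>
  Every Cesaro mean of the powers of a minimal map \<open>\<phi>\<close> is a \<open>\<Gamma>\<close>-map below \<open>\<phi>\<close>, hence has the
  same seminorm as \<open>\<phi>\<close>; on \<open>T - \<phi> T\<close> the means telescope and tend to \<open>0\<close>. No limit of
  maps is needed.
\<close>

lemma minimal_gamma_map_idempotent:
  assumes min: "minimal_gamma_map G \<pi> \<phi>" and T: "T \<in> bounded_ops"
  shows "\<phi> (\<phi> T) = \<phi> T"
proof -
  have \<phi>: "\<phi> \<in> gamma_maps G \<pi>" using min by (simp add: minimal_gamma_map_def)
  then have ucp: "ucp \<phi>" by (simp add: gamma_maps_iff ucp_along_ucp)
  note ops = ucp_ops[OF ucp]
  have pow: "(\<lambda>T. (\<phi> ^^ Suc n) T) \<in> gamma_maps G \<pi> \<and>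
      (\<forall>T\<in>bounded_ops. norm ((\<phi> ^^ Suc n) T) \<le> norm (\<phi> T))" for n
  proof (induction n)
    case 0
    then show ?case using \<phi> by simp
  next
    case (Suc n)
    have "(\<phi> ^^ Suc n) T \<in> bounded_ops" if "T \<in> bounded_ops" for T
      using Suc that by (auto simp: gamma_maps_iff ucp_along_def intro: ucp_ops)
    then have "norm (\<phi> ((\<phi> ^^ Suc n) T)) \<le> norm (\<phi> T)" if "T \<in> bounded_ops" for T
      using Suc that ucp_norm_le[OF ucp] by (blast intro: order_trans)
    then show ?case using gamma_maps_compose[OF \<phi>] Suc by simp
  qed
  \<comment> \<open>\<open>\<psi>\<close> is the mean of the powers of \<open>\<phi>\<close> with exponents from \<open>1\<close> to \<open>n + 1\<close>\<close>
  have mean: "\<exists>\<psi>\<in>gamma_maps G \<pi>. (\<forall>T\<in>bounded_ops. norm (\<psi> T) \<le> norm (\<phi> T) \<and>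
      (real n + 1) *\<^sub>R \<psi> (T - \<phi> T) = \<phi> T - (\<phi> ^^ Suc (Suc n)) T)" for n
  proof (induction n)
    case 0
    show ?case
      by (rule bexI[OF _ \<phi>]) (simp add: ucp_diff[OF ucp] ops)
  next
    case (Suc n)
    then obtain \<psi> where \<psi>: "\<psi> \<in> gamma_maps G \<pi>"
      and le: "\<And>T. T \<in> bounded_ops \<Longrightarrow> norm (\<psi> T) \<le> norm (\<phi> T)"
      and tel: "\<And>T. T \<in> bounded_ops \<Longrightarrow> (real n + 1) *\<^sub>R \<psi> (T - \<phi> T) = \<phi> T - (\<phi> ^^ Suc (Suc n)) T"
      by blast
    define a where "a = (real n + 1) / (real n + 2)"
    define b where "b = 1 / (real n + 2)"
    define \<omega> where "\<omega> T = a *\<^sub>R \<psi> T + b *\<^sub>R (\<phi> ^^ Suc (Suc n)) T" for T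
    have ab: "0 \<le> a" "0 \<le> b" "a + b = 1" by (auto simp: a_def b_def field_simps)
    have \<phi>n: "(\<lambda>T. (\<phi> ^^ Suc (Suc n)) T) \<in> gamma_maps G \<pi>" using pow[of "Suc n"] by blast
    have "\<omega> \<in> gamma_maps G \<pi>" unfolding \<omega>_def by (rule gamma_maps_convex[OF \<psi> \<phi>n ab])
    moreover have "norm (\<omega> T) \<le> norm (\<phi> T)" if T: "T \<in> bounded_ops" for T
    proof -
      have "norm (\<omega> T) \<le> a * norm (\<psi> T) + b * norm ((\<phi> ^^ Suc (Suc n)) T)"
        unfolding \<omega>_def using ab by (intro norm_triangle_le) simp
      also have "\<dots> \<le> a * norm (\<phi> T) + b * norm (\<phi> T)"
        using ab le[OF T] pow[of "Suc n"] T by (intro add_mono mult_left_mono) auto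
      also have "\<dots> = norm (\<phi> T)" using ab by (simp add: distrib_right[symmetric])
      finally show ?thesis .
    qed
    moreover have "(real (Suc n) + 1) *\<^sub>R \<omega> (T - \<phi> T) = \<phi> T - (\<phi> ^^ Suc (Suc (Suc n))) T"
      if T: "T \<in> bounded_ops" for T
    proof -
      have "ucp (\<lambda>T. (\<phi> ^^ Suc (Suc n)) T)" using \<phi>n by (simp only: gamma_maps_iff ucp_along_ucp)
      from ucp_diff[OF this T ops[OF T]]
      have "(\<phi> ^^ Suc (Suc n)) (T - \<phi> T) = (\<phi> ^^ Suc (Suc n)) T - (\<phi> ^^ Suc (Suc (Suc n))) T"
        by (simp only: funpow_Suc_right o_apply)
      moreover have "(real (Suc n) + 1) * a = real n + 1" "(real (Suc n) + 1) * b = 1"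
        by (auto simp: a_def b_def field_simps)
      ultimately show ?thesis
        using tel[OF T] by (simp add: \<omega>_def scaleR_add_right del: funpow.simps)
    qed
    ultimately show ?case by blast
  qed
  have bound: "norm (\<phi> (T - \<phi> T)) \<le> 2 * norm (\<phi> T) / (real n + 1)" for n
  proof -
    obtain \<psi> where \<psi>: "\<psi> \<in> gamma_maps G \<pi>"
      and le: "\<And>T. T \<in> bounded_ops \<Longrightarrow> norm (\<psi> T) \<le> norm (\<phi> T)"
      and tel: "\<And>T. T \<in> bounded_ops \<Longrightarrow> (real n + 1) *\<^sub>R \<psi> (T - \<phi> T) = \<phi> T - (\<phi> ^^ Suc (Suc n)) T"
      using mean by blast
    have "norm (\<phi> (T - \<phi> T)) \<le> norm (\<psi> (T - \<phi> T))"
      using min \<psi> le bounded_ops_diff[OF T ops[OF T]]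
      unfolding minimal_gamma_map_def gamma_map_le_def by blast
    then have "(real n + 1) * norm (\<phi> (T - \<phi> T)) \<le> (real n + 1) * norm (\<psi> (T - \<phi> T))"
      by (intro mult_left_mono) auto
    also have "\<dots> = norm (\<phi> T - (\<phi> ^^ Suc (Suc n)) T)"
      using arg_cong[OF tel[OF T], of norm] by (simp del: funpow.simps)
    also have "\<dots> \<le> norm (\<phi> T) + norm ((\<phi> ^^ Suc (Suc n)) T)" by (rule norm_triangle_ineq4)
    also have "\<dots> \<le> 2 * norm (\<phi> T)" using pow[of "Suc n"] T by simp
    finally show ?thesis by (simp add: field_simps)
  qed
  have "norm (\<phi> (T - \<phi> T)) \<le> 0"
  proof (rule LIMSEQ_le_const)
    show "(\<lambda>n. 2 * norm (\<phi> T) / (real n + 1)) \<longlonglongrightarrow> 0"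
      using tendsto_mult_right_zero[OF LIMSEQ_inverse_real_of_nat, of "2 * norm (\<phi> T)"]
      by (simp add: field_simps)
  qed (use bound in blast)
  then show ?thesis using T ops by (simp add: ucp_diff[OF ucp])
qed

text \<open>
  The map \<open>\<phi> \<psi> \<phi>\<close> lies below \<open>\<phi>\<close>, so it is itself minimal and therefore idempotent, and it
  has the same kernel as \<open>\<phi>\<close>.
\<close>

lemma minimal_gamma_map_rigid:
  assumes min: "minimal_gamma_map G \<pi> \<phi>" and \<psi>: "\<psi> \<in> gamma_maps G \<pi>" and T: "T \<in> bounded_ops"
  shows "\<phi> (\<psi> (\<phi> T)) = \<phi> T"
proof -
  have \<phi>: "\<phi> \<in> gamma_maps G \<pi>" using min by (simp add: minimal_gamma_map_def)
  then have u\<phi>: "ucp \<phi>" and u\<psi>: "ucp \<psi>" using \<psi> by (auto simp: gamma_maps_iff ucp_along_ucp)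
  note ops = ucp_ops[OF u\<phi>] ucp_ops[OF u\<psi>]
  define \<omega> where "\<omega> T = \<phi> (\<psi> (\<phi> T))" for T
  have \<omega>: "\<omega> \<in> gamma_maps G \<pi>"
    unfolding \<omega>_def by (intro gamma_maps_compose[OF \<phi>] gamma_maps_compose[OF \<psi>] \<phi>)
  have \<omega>\<phi>: "gamma_map_le \<omega> \<phi>"
    unfolding gamma_map_le_def \<omega>_def
    using ucp_norm_le[OF u\<phi>] ucp_norm_le[OF u\<psi>] ops by (meson order_trans)
  then have \<phi>\<omega>: "gamma_map_le \<phi> \<omega>" using min \<omega> by (simp add: minimal_gamma_map_def)
  have "minimal_gamma_map G \<pi> \<omega>"
    using min \<omega> \<omega>\<phi> unfolding minimal_gamma_map_def gamma_map_le_def by (meson order_trans)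
  then have "\<omega> (\<omega> T) = \<omega> T" using T by (rule minimal_gamma_map_idempotent)
  moreover have \<omega>T: "\<omega> T \<in> bounded_ops" using T ops by (simp add: \<omega>_def)
  ultimately have "\<omega> (T - \<omega> T) = 0"
    using \<omega> T by (simp add: gamma_maps_iff ucp_diff[OF ucp_along_ucp])
  then have "norm (\<phi> (T - \<omega> T)) \<le> 0"
    using \<phi>\<omega> bounded_ops_diff[OF T \<omega>T] by (auto simp: gamma_map_le_def)
  then have "\<phi> T = \<phi> (\<omega> T)" using T \<omega>T by (simp add: ucp_diff[OF u\<phi>])
  also have "\<dots> = \<omega> T"
    unfolding \<omega>_def using T ops by (simp add: minimal_gamma_map_idempotent[OF min])
  finally show ?thesis by (simp add: \<omega>_def)
qed

end

section \<open>Automorphisms of the boundary\<close>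

context
  fixes G :: "('g, 'm) monoid_scheme" and \<pi> :: "'g \<Rightarrow> ('h::chilbert_space \<Rightarrow>\<^sub>L 'h)"
    and \<phi> :: "('h \<Rightarrow>\<^sub>L 'h) \<Rightarrow> ('h \<Rightarrow>\<^sub>L 'h)"
  assumes rep: "unitary_rep G \<pi>" and min: "minimal_gamma_map G \<pi> \<phi>"
begin

lemma minimal_gamma: "\<phi> \<in> gamma_maps G \<pi>"
  using min by (simp add: minimal_gamma_map_def)

lemma minimal_along: "ucp_along G \<pi> (\<lambda>g. g) \<phi>"
  using minimal_gamma by (simp add: gamma_maps_iff)

lemma minimal_ucp: "ucp \<phi>"
  using minimal_along by (rule ucp_along_ucp)

lemma minimal_idem: "T \<in> bounded_ops \<Longrightarrow> \<phi> (\<phi> T) = \<phi> T"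
  by (rule minimal_gamma_map_idempotent[OF rep min])

lemma fh_boundary_iff: "b \<in> fh_boundary \<phi> \<longleftrightarrow> b \<in> bounded_ops \<and> \<phi> b = b"
proof
  assume "b \<in> fh_boundary \<phi>"
  then show "b \<in> bounded_ops \<and> \<phi> b = b"
    unfolding fh_boundary_def using minimal_idem ucp_ops[OF minimal_ucp] by auto
next
  assume "b \<in> bounded_ops \<and> \<phi> b = b"
  then show "b \<in> fh_boundary \<phi>"
    unfolding fh_boundary_def by (intro image_eqI[of _ _ b]) auto
qed

lemma map_in_boundary: "T \<in> bounded_ops \<Longrightarrow> \<phi> T \<in> fh_boundary \<phi>"
  by (simp add: fh_boundary_def)

text \<open>
  An \<open>\<alpha>\<close>-equivariant and an \<open>\<alpha>'\<close>-equivariant map compose to a \<open>\<Gamma>\<close>-map if \<open>\<alpha>'\<close> is a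
  right inverse of \<open>\<alpha>\<close>, so by rigidity the map that \<open>\<Theta>\<close> induces on the boundary is a left
  inverse of the one induced by \<open>\<Theta>'\<close>.
\<close>

lemma rigid_pair:
  assumes \<Theta>: "ucp_along G \<pi> \<alpha> \<Theta>" and \<Theta>': "ucp_along G \<pi> \<alpha>' \<Theta>'"
    and \<alpha>': "\<And>g. g \<in> carrier G \<Longrightarrow> \<alpha>' g \<in> carrier G" "\<And>g. g \<in> carrier G \<Longrightarrow> \<alpha> (\<alpha>' g) = g"
    and T: "T \<in> bounded_ops"
  shows "\<phi> (\<Theta> (\<phi> (\<Theta>' (\<phi> T)))) = \<phi> T"
proof -
  have 1: "ucp_along G \<pi> \<alpha>' (\<lambda>T. \<phi> (\<Theta>' T))"
    by (rule ucp_along_compose[OF minimal_along \<Theta>']) (use \<alpha>' in auto)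
  have "ucp_along G \<pi> (\<lambda>g. g) (\<lambda>T. \<Theta> (\<phi> (\<Theta>' T)))"
    by (rule ucp_along_compose[OF \<Theta> 1]) (use \<alpha>' in auto)
  then show ?thesis
    using minimal_gamma_map_rigid[OF rep min _ T, of "\<lambda>T. \<Theta> (\<phi> (\<Theta>' T))"] by (simp add: gamma_maps_iff)
qed

text \<open>
  Both induced maps are inverse to the one induced by \<open>\<Theta>'\<close>, hence they agree.
\<close>

lemma induced_unique:
  assumes \<Theta>: "ucp_along G \<pi> \<alpha> \<Theta>" and \<Psi>: "ucp_along G \<pi> \<alpha> \<Psi>" and \<Theta>': "ucp_along G \<pi> \<alpha>' \<Theta>'"
    and \<alpha>: "\<And>g. g \<in> carrier G \<Longrightarrow> \<alpha> g \<in> carrier G" "\<And>g. g \<in> carrier G \<Longrightarrow> \<alpha>' (\<alpha> g) = g"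
    and \<alpha>': "\<And>g. g \<in> carrier G \<Longrightarrow> \<alpha>' g \<in> carrier G" "\<And>g. g \<in> carrier G \<Longrightarrow> \<alpha> (\<alpha>' g) = g"
    and b: "b \<in> fh_boundary \<phi>"
  shows "\<phi> (\<Theta> b) = \<phi> (\<Psi> b)"
proof -
  have b': "b \<in> bounded_ops" "\<phi> b = b" using b by (auto simp: fh_boundary_iff)
  have "\<phi> (\<Theta>' (\<phi> (\<Psi> (\<phi> b)))) = \<phi> b"
    by (rule rigid_pair[OF \<Theta>' \<Psi>]) (use \<alpha> b'(1) in auto)
  moreover have "\<phi> (\<Theta> (\<phi> (\<Theta>' (\<phi> (\<Psi> b))))) = \<phi> (\<Psi> b)"
    by (rule rigid_pair[OF \<Theta> \<Theta>']) (use \<alpha>' ucp_ops[OF ucp_along_ucp[OF \<Psi>] b'(1)] in auto)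
  ultimately show ?thesis by (simp add: b')
qed

lemma induced_star_auto:
  assumes \<Theta>: "ucp_along G \<pi> \<alpha> \<Theta>" and \<Theta>': "ucp_along G \<pi> \<alpha>' \<Theta>'"
    and \<alpha>: "\<And>g. g \<in> carrier G \<Longrightarrow> \<alpha> g \<in> carrier G" "\<And>g. g \<in> carrier G \<Longrightarrow> \<alpha>' (\<alpha> g) = g"
    and \<alpha>': "\<And>g. g \<in> carrier G \<Longrightarrow> \<alpha>' g \<in> carrier G" "\<And>g. g \<in> carrier G \<Longrightarrow> \<alpha> (\<alpha>' g) = g"
  shows "(\<lambda>b\<in>fh_boundary \<phi>. \<phi> (\<Theta> b)) \<in> star_auto (fh_boundary \<phi>) (choi_effros \<phi>)"
proof -
  define B where "B = fh_boundary \<phi>"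
  note \<Theta>u = ucp_along_ucp[OF \<Theta>] and \<Theta>'u = ucp_along_ucp[OF \<Theta>']
  define F where "F T = \<phi> (\<Theta> (\<phi> T))" for T
  define F' where "F' T = \<phi> (\<Theta>' (\<phi> T))" for T
  have Fu: "ucp F" and F'u: "ucp F'"
    unfolding F_def F'_def by (intro ucp_compose[OF minimal_ucp] ucp_compose[OF \<Theta>u] ucp_compose[OF \<Theta>'u] minimal_ucp)+
  note ops = ucp_ops[OF minimal_ucp] ucp_ops[OF \<Theta>u] ucp_ops[OF \<Theta>'u]
  have FF': "F (F' T) = \<phi> T" and F'F: "F' (F T) = \<phi> T" if T: "T \<in> bounded_ops" for T
    unfolding F_def F'_def
    using rigid_pair[OF \<Theta> \<Theta>' \<alpha>' T] rigid_pair[OF \<Theta>' \<Theta> \<alpha> T] T by (simp_all add: minimal_idem ops)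
  have \<phi>F: "\<phi> (F T) = F T" and F\<phi>: "F (\<phi> T) = F T" if "T \<in> bounded_ops" for T
    unfolding F_def using that by (simp_all add: minimal_idem ops)
  have B: "b \<in> bounded_ops" "\<phi> b = b" if "b \<in> B" for b
    using that by (auto simp: B_def fh_boundary_iff)
  have BI: "b \<in> B" if "b \<in> bounded_ops" "\<phi> b = b" for b
    using that by (auto simp: B_def fh_boundary_iff)
  have F_eq: "(\<lambda>b\<in>B. \<phi> (\<Theta> b)) b = F b" if "b \<in> B" for b
    using that by (simp add: F_def B)
  have B_add: "S + T \<in> B" if "S \<in> B" "T \<in> B" for S T
    using that by (intro BI) (simp_all add: B bounded_ops_add ucp_add[OF minimal_ucp])
  have B_scaleC: "scaleC_op a T \<in> B" if "T \<in> B" for a T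
    using that by (intro BI) (simp_all add: B bounded_ops_scaleC ucp_scaleC[OF minimal_ucp])
  have B_adj: "adj_op T \<in> B" if "T \<in> B" for T
    using that by (intro BI) (simp_all add: B bounded_ops_adj ucp_adj[OF minimal_ucp])
  have B_prod: "choi_effros \<phi> S T \<in> B" if "S \<in> B" "T \<in> B" for S T
    using that unfolding choi_effros_def B_def
    by (intro map_in_boundary bounded_ops_compose) (auto simp: fh_boundary_iff)
  have "bij_betw (\<lambda>b\<in>B. \<phi> (\<Theta> b)) B B"
  proof (rule bij_betw_byWitness[of _ F'])
    show "\<forall>b\<in>B. F' ((\<lambda>b\<in>B. \<phi> (\<Theta> b)) b) = b"
      by (auto simp: F_eq F'F B simp del: restrict_apply)
    show "\<forall>b\<in>B. (\<lambda>b\<in>B. \<phi> (\<Theta> b)) (F' b) = b"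
    proof
      fix b assume b: "b \<in> B"
      have "F' b \<in> B" unfolding F'_def B_def using b by (intro map_in_boundary ops B)
      then show "(\<lambda>b\<in>B. \<phi> (\<Theta> b)) (F' b) = b"
        using b by (simp only: F_eq FF' B)
    qed
    show "(\<lambda>b\<in>B. \<phi> (\<Theta> b)) ` B \<subseteq> B" using map_in_boundary ops B by (auto simp: B_def)
    show "F' ` B \<subseteq> B" unfolding F'_def using map_in_boundary ops B by (auto simp: B_def)
  qed
  then have "(\<lambda>b\<in>B. \<phi> (\<Theta> b)) \<in> Bij B" by (simp add: Bij_def)
  moreover have "clinear_on B (\<lambda>b\<in>B. \<phi> (\<Theta> b))"
    unfolding clinear_on_def
    by (simp add: F_eq B_add B_scaleC B ucp_add[OF Fu] ucp_scaleC[OF Fu] del: restrict_apply)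
  moreover have "(\<lambda>b\<in>B. \<phi> (\<Theta> b)) (choi_effros \<phi> S T) =
      choi_effros \<phi> ((\<lambda>b\<in>B. \<phi> (\<Theta> b)) S) ((\<lambda>b\<in>B. \<phi> (\<Theta> b)) T)" if S: "S \<in> B" and T: "T \<in> B" for S T
  proof -
    have "F (choi_effros \<phi> S T) = F (S o\<^sub>L T)"
      unfolding choi_effros_def using B[OF S] B[OF T] by (simp add: F\<phi> bounded_ops_compose)
    also have "\<dots> = \<phi> (F S o\<^sub>L F T)"
      by (rule ucp_inverse_multiplicative[OF minimal_ucp Fu F'u \<phi>F F\<phi> FF' F'F B[OF S] B[OF T]])
    finally show ?thesis
      unfolding F_eq[OF B_prod[OF S T]] F_eq[OF S] F_eq[OF T] by (simp only: choi_effros_def)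
  qed
  moreover have "(\<lambda>b\<in>B. \<phi> (\<Theta> b)) (adj_op T) = adj_op ((\<lambda>b\<in>B. \<phi> (\<Theta> b)) T)" if T: "T \<in> B" for T
    by (simp only: F_eq[OF T] F_eq[OF B_adj[OF T]] ucp_adj[OF Fu B(1)[OF T]])
  ultimately show ?thesis unfolding star_auto_def B_def by blast
qed

end

section \<open>Extending automorphisms of the group C*-algebra\<close>

lemma closure_binary:
  fixes f :: "'a::metric_space \<Rightarrow> 'b::metric_space \<Rightarrow> 'c::metric_space"
  assumes cont: "\<And>u v x y. u \<longlonglongrightarrow> x \<Longrightarrow> v \<longlonglongrightarrow> y \<Longrightarrow> (\<lambda>n. f (u n) (v n)) \<longlonglongrightarrow> f x y"
    and S: "\<And>x y. x \<in> S \<Longrightarrow> y \<in> T \<Longrightarrow> f x y \<in> U"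
    and x: "x \<in> closure S" and y: "y \<in> closure T"
  shows "f x y \<in> closure U"
proof -
  obtain u v where "\<And>n. u n \<in> S" "u \<longlonglongrightarrow> x" "\<And>n. v n \<in> T" "v \<longlonglongrightarrow> y"
    using x y by (auto simp: closure_sequential)
  then show ?thesis
    unfolding closure_sequential using S cont by (intro exI[of _ "\<lambda>n. f (u n) (v n)"]) auto
qed

lemma bounded_linear_scaleC_op: "bounded_linear (scaleC_op a)"
proof (rule bounded_linear_intro[of _ "cmod a"])
  show "scaleC_op a (S + T) = scaleC_op a S + scaleC_op a T" for S T
    by (rule cop.scale_right_distrib)
  show "scaleC_op a (r *\<^sub>R T) = r *\<^sub>R scaleC_op a T" for r T
    by (simp add: scaleR_op mult.commute)
  show "norm (scaleC_op a T) \<le> norm T * cmod a" for T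
  proof (rule norm_blinfun_bound)
    fix x
    have "cmod a * norm (blinfun_apply T x) \<le> cmod a * (norm T * norm x)"
      by (intro mult_left_mono norm_blinfun) simp
    then show "norm (blinfun_apply (scaleC_op a T) x) \<le> norm T * cmod a * norm x"
      by (simp add: norm_scaleC mult_ac)
  qed simp
qed

context
  fixes G :: "('g, 'm) monoid_scheme" and \<pi> :: "'g \<Rightarrow> ('h::chilbert_space \<Rightarrow>\<^sub>L 'h)"
  assumes rep: "unitary_rep G \<pi>"
begin

interpretation group G
  using rep by (simp add: unitary_rep_def)

lemma rep_in_cstar: "g \<in> carrier G \<Longrightarrow> \<pi> g \<in> cstar_rep G \<pi>"
  unfolding cstar_rep_def by (intro subsetD[OF closure_subset] cop.span_base) simp

lemma cstar_rep_ops: "cstar_rep G \<pi> \<subseteq> bounded_ops"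
proof -
  have "cop.span (\<pi> ` carrier G) \<subseteq> bounded_ops"
  proof
    fix T assume "T \<in> cop.span (\<pi> ` carrier G)"
    then show "T \<in> bounded_ops"
      by (induction rule: cop.span_induct_alt)
        (auto intro: bounded_ops_add bounded_ops_scaleC unitary_repD[OF rep])
  qed
  then show ?thesis
    unfolding cstar_rep_def by (rule closure_minimal[OF _ closed_bounded_ops])
qed

lemma cstar_rep_add: "S \<in> cstar_rep G \<pi> \<Longrightarrow> T \<in> cstar_rep G \<pi> \<Longrightarrow> S + T \<in> cstar_rep G \<pi>"
  unfolding cstar_rep_def by (erule (1) closure_binary[rotated 2]) (auto intro: tendsto_add cop.span_add)

lemma cstar_rep_scaleC: "T \<in> cstar_rep G \<pi> \<Longrightarrow> scaleC_op a T \<in> cstar_rep G \<pi>"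
  unfolding cstar_rep_def
  using closure_binary[of "\<lambda>T _. scaleC_op a T" "cop.span (\<pi> ` carrier G)" "cop.span (\<pi> ` carrier G)"
      "cop.span (\<pi> ` carrier G)" T T]
  by (auto intro: bounded_linear.tendsto[OF bounded_linear_scaleC_op] cop.span_scale)

lemma span_rep_compose:
  assumes S: "S \<in> cop.span (\<pi> ` carrier G)" and T: "T \<in> cop.span (\<pi> ` carrier G)"
  shows "S o\<^sub>L T \<in> cop.span (\<pi> ` carrier G)"
proof -
  have left: "\<pi> g o\<^sub>L T \<in> cop.span (\<pi> ` carrier G)" if g: "g \<in> carrier G" for g
    using T
  proof (induction rule: cop.span_induct_alt)
    case base
    then show ?case by (simp add: cop.span_zero)
  next
    case (step c R T)
    then obtain h where h: "h \<in> carrier G" "R = \<pi> h" by blast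
    have "\<pi> g o\<^sub>L (scaleC_op c R + T) = scaleC_op c (\<pi> (g \<otimes>\<^bsub>G\<^esub> h)) + (\<pi> g o\<^sub>L T)"
      using unitary_repD[OF rep g] h
      by (intro blinfun_eqI) (simp add: blinfun.bilinear_simps bounded_opsD)
    moreover have "scaleC_op c (\<pi> (g \<otimes>\<^bsub>G\<^esub> h)) \<in> cop.span (\<pi> ` carrier G)"
      using g h by (intro cop.span_scale cop.span_base) simp
    ultimately show ?case
      using cop.span_add step by simp
  qed
  from S show ?thesis
  proof (induction rule: cop.span_induct_alt)
    case base
    then show ?case by (simp add: cop.span_zero)
  next
    case (step c R S)
    have "(scaleC_op c R + S) o\<^sub>L T = scaleC_op c (R o\<^sub>L T) + (S o\<^sub>L T)"
      by (intro blinfun_eqI) (simp add: blinfun.bilinear_simps)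
    moreover have "R o\<^sub>L T \<in> cop.span (\<pi> ` carrier G)" using step left by blast
    ultimately show ?case
      using step by (simp only:) (intro cop.span_add cop.span_scale)
  qed
qed

lemma cstar_rep_compose: "S \<in> cstar_rep G \<pi> \<Longrightarrow> T \<in> cstar_rep G \<pi> \<Longrightarrow> S o\<^sub>L T \<in> cstar_rep G \<pi>"
  unfolding cstar_rep_def
  by (erule (1) closure_binary[rotated 2])
    (auto intro: bounded_bilinear.tendsto[OF bounded_bilinear_blinfun_compose] span_rep_compose)

lemma cstar_rep_adj:
  assumes T: "T \<in> cstar_rep G \<pi>"
  shows "adj_op T \<in> cstar_rep G \<pi>"
proof -
  let ?A = "cop.span (\<pi> ` carrier G)"
  have span_ops: "?A \<subseteq> bounded_ops"
    using cstar_rep_ops closure_subset unfolding cstar_rep_def by blast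
  have span_adj: "adj_op S \<in> ?A" if "S \<in> ?A" for S
  proof -
    from that have "adj_op S \<in> ?A \<and> S \<in> bounded_ops"
    proof (induction rule: cop.span_induct_alt)
      case base
      have "adj_op (0 :: 'h \<Rightarrow>\<^sub>L 'h) = 0" by (rule adj_op_unique) simp_all
      then show ?case by (simp add: cop.span_zero)
    next
      case (step c R S)
      then obtain g where g: "g \<in> carrier G" "R = \<pi> g" by blast
      have "adj_op R \<in> ?A"
        using g unitary_rep_inv[OF rep g(1)] by (auto intro!: cop.span_base image_eqI[of _ _ "inv\<^bsub>G\<^esub> g"])
      moreover have "R \<in> bounded_ops" using g unitary_repD[OF rep] by simp
      ultimately show ?case
        using step by (auto simp: adj_op_add adj_op_scaleC bounded_ops_scaleC bounded_ops_add
            intro!: cop.span_add cop.span_scale)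
    qed
    then show ?thesis ..
  qed
  obtain f where f: "\<And>n. f n \<in> ?A" "f \<longlonglongrightarrow> T"
    using T by (auto simp: cstar_rep_def closure_sequential)
  have "(\<lambda>n. norm (adj_op (f n) - adj_op T)) = (\<lambda>n. norm (f n - T))"
  proof
    fix n
    have "f n \<in> bounded_ops" "T \<in> bounded_ops" using f(1) span_ops T cstar_rep_ops by auto
    then show "norm (adj_op (f n) - adj_op T) = norm (f n - T)"
      by (simp add: adj_op_diff[symmetric] norm_adj_op bounded_ops_diff)
  qed
  moreover have "(\<lambda>n. norm (f n - T)) \<longlonglongrightarrow> 0"
    using f(2) by (simp add: tendsto_norm_zero_iff LIM_zero_iff)
  ultimately have "(\<lambda>n. norm (adj_op (f n) - adj_op T)) \<longlonglongrightarrow> 0" by simp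
  then have "(\<lambda>n. adj_op (f n)) \<longlonglongrightarrow> adj_op T"
    by (rule LIM_zero_cancel[OF tendsto_norm_zero_cancel])
  then show ?thesis
    unfolding cstar_rep_def closure_sequential using f(1) span_adj
    by (intro exI[of _ "\<lambda>n. adj_op (f n)"]) auto
qed

lemma rep_auto_carrier: "\<alpha> \<in> rep_auto G \<pi> \<Longrightarrow> g \<in> carrier G \<Longrightarrow> \<alpha> g \<in> carrier G"
  by (auto simp: rep_auto_def auto_def hom_def)

text \<open>
  The C*-algebra automorphism extends to B(H) by Arveson's theorem; the extension maps the unitaries
  \<open>\<pi> g\<close> to the unitaries \<open>\<pi> (\<alpha> g)\<close>, so it intertwines the actions.
\<close>

lemma rep_auto_extension:
  assumes \<alpha>: "\<alpha> \<in> rep_auto G \<pi>"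
  shows "\<exists>\<Theta>. ucp_along G \<pi> \<alpha> \<Theta>"
proof -
  obtain \<theta> where \<theta>: "\<theta> \<in> star_auto (cstar_rep G \<pi>) (o\<^sub>L)"
    and \<theta>\<pi>: "\<And>g. g \<in> carrier G \<Longrightarrow> \<theta> (\<pi> g) = \<pi> (\<alpha> g)" and \<alpha>_hom: "\<alpha> \<in> hom G G"
    using \<alpha> by (auto simp: rep_auto_def auto_def)
  have \<theta>_mem: "\<theta> T \<in> cstar_rep G \<pi>" if "T \<in> cstar_rep G \<pi>" for T
    using \<theta> that by (auto simp: star_auto_def dest: Bij_imp_funcset)
  have \<alpha>_one: "\<alpha> \<one>\<^bsub>G\<^esub> = \<one>\<^bsub>G\<^esub>" by (rule hom_one[OF \<alpha>_hom]) (rule group_axioms)+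
  interpret unital_star_hom "cstar_rep G \<pi>" \<theta>
  proof
    show "id_blinfun \<in> cstar_rep G \<pi>"
      using rep_in_cstar[OF one_closed] by (simp add: unitary_rep_one[OF rep])
    show "\<theta> id_blinfun = id_blinfun"
      using \<theta>\<pi>[OF one_closed] by (simp add: \<alpha>_one unitary_rep_one[OF rep])
    show "closed (cstar_rep G \<pi>)" by (simp add: cstar_rep_def)
  qed (use \<theta> \<theta>_mem cstar_rep_ops in \<open>auto simp: star_auto_def clinear_on_def cstar_rep_add
        cstar_rep_scaleC cstar_rep_compose cstar_rep_adj\<close>)
  obtain \<Theta> where "\<Theta> \<in> bounded_ops \<rightarrow> bounded_ops" "clinear_on bounded_ops \<Theta>" "completely_positive \<Theta>"
    and ext: "\<And>T. T \<in> cstar_rep G \<pi> \<Longrightarrow> \<Theta> T = \<theta> T"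
    using arveson_extension by blast
  then have ucp: "ucp \<Theta>" by (simp add: ucp_def A_id hom_id)
  have "\<Theta> (op_act G \<pi> g T) = op_act G \<pi> (\<alpha> g) (\<Theta> T)"
    if g: "g \<in> carrier G" and T: "T \<in> bounded_ops" for g T
  proof -
    note \<alpha>g = rep_auto_carrier[OF \<alpha> g]
    have \<Theta>g: "\<Theta> (\<pi> g) = \<pi> (\<alpha> g)" by (simp add: ext rep_in_cstar g \<theta>\<pi>)
    have "\<Theta> (\<pi> g) o\<^sub>L adj_op (\<Theta> (\<pi> g)) = id_blinfun"
      unfolding \<Theta>g by (rule unitary_repD(3)[OF rep \<alpha>g])
    from ucp_unitary_conj[OF ucp unitary_repD(1,3)[OF rep g] this T]
    show ?thesis by (simp add: op_act_eq[OF rep g] op_act_eq[OF rep \<alpha>g] \<Theta>g)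
  qed
  with ucp show ?thesis by (auto simp: ucp_along_def)
qed

lemma rep_auto_inverse:
  assumes \<alpha>: "\<alpha> \<in> rep_auto G \<pi>"
  shows "\<exists>\<beta>\<in>rep_auto G \<pi>. \<forall>g\<in>carrier G. \<beta> (\<alpha> g) = g \<and> \<alpha> (\<beta> g) = g"
proof -
  let ?A = "cstar_rep G \<pi>"
  obtain \<theta> where \<theta>: "\<theta> \<in> star_auto ?A (o\<^sub>L)"
    and \<theta>\<pi>: "\<And>g. g \<in> carrier G \<Longrightarrow> \<theta> (\<pi> g) = \<pi> (\<alpha> g)"
    and \<alpha>_hom: "\<alpha> \<in> hom G G" and \<alpha>_Bij: "\<alpha> \<in> Bij (carrier G)"
    using \<alpha> by (auto simp: rep_auto_def auto_def)
  define \<beta> where "\<beta> = (\<lambda>g\<in>carrier G. inv_into (carrier G) \<alpha> g)"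
  define \<eta> where "\<eta> = (\<lambda>T\<in>?A. inv_into ?A \<theta> T)"
  have \<alpha>_bij: "bij_betw \<alpha> (carrier G) (carrier G)" using \<alpha>_Bij by (simp add: Bij_def)
  have \<beta>: "\<beta> g \<in> carrier G" "\<beta> (\<alpha> g) = g" "\<alpha> (\<beta> g) = g" if "g \<in> carrier G" for g
    using that bij_betw_inv_into_left[OF \<alpha>_bij that] bij_betw_inv_into_right[OF \<alpha>_bij that]
      bij_betwE[OF bij_betw_inv_into[OF \<alpha>_bij]] bij_betwE[OF \<alpha>_bij]
    by (auto simp: \<beta>_def)
  have "\<beta> \<in> auto G"
    unfolding auto_def \<beta>_def using restrict_inv_into_hom[OF \<alpha>_hom \<alpha>_Bij] restrict_inv_into_Bij[OF \<alpha>_Bij]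
    by blast
  have \<theta>_Bij: "\<theta> \<in> Bij ?A" using \<theta> by (simp add: star_auto_def)
  then have \<theta>_bij: "bij_betw \<theta> ?A ?A" by (simp add: Bij_def)
  have \<eta>: "\<eta> T \<in> ?A" "\<eta> (\<theta> T) = T" "\<theta> (\<eta> T) = T" if "T \<in> ?A" for T
    using that bij_betw_inv_into_left[OF \<theta>_bij that] bij_betw_inv_into_right[OF \<theta>_bij that]
      bij_betwE[OF bij_betw_inv_into[OF \<theta>_bij]] bij_betwE[OF \<theta>_bij]
    by (auto simp: \<eta>_def)
  have \<eta>_eqI: "\<eta> T = S" if "S \<in> ?A" "\<theta> S = T" for S T
    using \<eta>(2)[OF that(1)] that(2) by simp
  have hom: "\<theta> (S + T) = \<theta> S + \<theta> T" "\<theta> (scaleC_op a T) = scaleC_op a (\<theta> T)"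
    "\<theta> (S o\<^sub>L T) = \<theta> S o\<^sub>L \<theta> T" "\<theta> (adj_op T) = adj_op (\<theta> T)" if "S \<in> ?A" "T \<in> ?A" for S T a
    using \<theta> that by (auto simp: star_auto_def clinear_on_def)
  have "\<eta> \<in> star_auto ?A (o\<^sub>L)"
    unfolding star_auto_def clinear_on_def
  proof (intro CollectI conjI ballI allI)
    show "\<eta> \<in> Bij ?A" unfolding \<eta>_def by (rule restrict_inv_into_Bij[OF \<theta>_Bij])
  qed (auto intro!: \<eta>_eqI simp: hom \<eta> cstar_rep_add cstar_rep_scaleC cstar_rep_compose cstar_rep_adj)
  moreover have "\<eta> (\<pi> g) = \<pi> (\<beta> g)" if "g \<in> carrier G" for g
    using that by (intro \<eta>_eqI) (simp_all add: \<beta> rep_in_cstar \<theta>\<pi>)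
  ultimately have "\<beta> \<in> rep_auto G \<pi>"
    using \<open>\<beta> \<in> auto G\<close> by (auto simp: rep_auto_def)
  with \<beta> show ?thesis by blast
qed

end

lemma ucp_along_inner_auto:
  assumes rep: "unitary_rep G \<pi>" and g: "g \<in> carrier G"
  shows "ucp_along G \<pi> (inner_auto G g) (op_act G \<pi> g)"
proof -
  interpret group G using rep by (simp add: unitary_rep_def)
  have "op_act G \<pi> g (op_act G \<pi> h T) = op_act G \<pi> (inner_auto G g h) (op_act G \<pi> g T)"
    if h: "h \<in> carrier G" for h T
    using g h by (simp add: inner_auto_def op_act_mult[OF rep, symmetric] m_assoc)
  then show ?thesis by (simp add: ucp_along_def ucp_op_act[OF rep g])
qed

theorem theorem5p3:
  fixes G :: "('g, 'm) monoid_scheme"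
    and \<pi> :: "'g \<Rightarrow> ('h::chilbert_space \<Rightarrow>\<^sub>L 'h)"
    and \<phi> :: "('h \<Rightarrow>\<^sub>L 'h) \<Rightarrow> ('h \<Rightarrow>\<^sub>L 'h)"
  assumes "unitary_rep G \<pi>"
    and "minimal_gamma_map G \<pi> \<phi>"
  shows "\<exists>\<Phi> \<in> hom (RepAutoGroup G \<pi>) (StarAutoGroup (fh_boundary \<phi>) (choi_effros \<phi>)).
    \<forall>g\<in>carrier G. \<Phi> (inner_auto G g) = (\<lambda>b\<in>fh_boundary \<phi>. op_act G \<pi> g b)"
proof -
  note rep = assms(1) and min = assms(2)
  interpret group G using rep by (simp add: unitary_rep_def)
  define B where "B = fh_boundary \<phi>"
  \<comment> \<open>by uniqueness of the induced maps the choice of the extension is immaterial\<close>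
  define ext where "ext \<alpha> = (SOME \<Theta>. ucp_along G \<pi> \<alpha> \<Theta>)" for \<alpha>
  define \<Phi> where "\<Phi> \<alpha> = (\<lambda>b\<in>B. \<phi> (ext \<alpha> b))" for \<alpha>
  note minimal_along = minimal_along[OF rep min] and minimal_ucp = minimal_ucp[OF rep min]
  note carr = rep_auto_carrier[OF rep]
  have ext_along: "ucp_along G \<pi> \<alpha> (ext \<alpha>)" if "ucp_along G \<pi> \<alpha> \<Theta>" for \<alpha> \<Theta>
    unfolding ext_def by (rule someI[of "ucp_along G \<pi> \<alpha>", OF that])
  have ext_rep: "ucp_along G \<pi> \<alpha> (ext \<alpha>)" if "\<alpha> \<in> rep_auto G \<pi>" for \<alpha>
    using rep_auto_extension[OF rep that] ext_along by blast
  have auto: "\<Phi> \<alpha> \<in> star_auto B (choi_effros \<phi>)" if \<alpha>: "\<alpha> \<in> rep_auto G \<pi>" for \<alpha>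
  proof -
    obtain \<beta> where \<beta>: "\<beta> \<in> rep_auto G \<pi>" "\<And>g. g \<in> carrier G \<Longrightarrow> \<beta> (\<alpha> g) = g"
      "\<And>g. g \<in> carrier G \<Longrightarrow> \<alpha> (\<beta> g) = g"
      using rep_auto_inverse[OF rep \<alpha>] by blast
    show ?thesis
      unfolding \<Phi>_def B_def
      by (rule induced_star_auto[OF rep min ext_rep[OF \<alpha>] ext_rep[OF \<beta>(1)]])
        (use \<beta> carr \<alpha> in auto)
  qed
  have Bij: "\<Phi> \<alpha> \<in> Bij B" if "\<alpha> \<in> rep_auto G \<pi>" for \<alpha>
    using auto[OF that] by (simp add: star_auto_def)
  have mult: "\<Phi> (compose (carrier G) \<alpha> \<beta>) = compose B (\<Phi> \<alpha>) (\<Phi> \<beta>)"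
    if \<alpha>: "\<alpha> \<in> rep_auto G \<pi>" and \<beta>: "\<beta> \<in> rep_auto G \<pi>" for \<alpha> \<beta>
  proof -
    let ?\<gamma> = "compose (carrier G) \<alpha> \<beta>"
    obtain \<alpha>' where \<alpha>': "\<alpha>' \<in> rep_auto G \<pi>" "\<And>g. g \<in> carrier G \<Longrightarrow> \<alpha>' (\<alpha> g) = g"
      "\<And>g. g \<in> carrier G \<Longrightarrow> \<alpha> (\<alpha>' g) = g"
      using rep_auto_inverse[OF rep \<alpha>] by blast
    obtain \<beta>' where \<beta>': "\<beta>' \<in> rep_auto G \<pi>" "\<And>g. g \<in> carrier G \<Longrightarrow> \<beta>' (\<beta> g) = g"
      "\<And>g. g \<in> carrier G \<Longrightarrow> \<beta> (\<beta>' g) = g"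
      using rep_auto_inverse[OF rep \<beta>] by blast
    have \<phi>\<beta>: "ucp_along G \<pi> \<beta> (\<lambda>T. \<phi> (ext \<beta> T))"
      by (rule ucp_along_compose[OF minimal_along ext_rep[OF \<beta>]]) (use carr[OF \<beta>] in auto)
    have \<gamma>: "ucp_along G \<pi> ?\<gamma> (\<lambda>T. ext \<alpha> (\<phi> (ext \<beta> T)))"
      by (rule ucp_along_compose[OF ext_rep[OF \<alpha>] \<phi>\<beta>]) (use carr[OF \<beta>] in \<open>auto simp: compose_def\<close>)
    have \<gamma>': "ucp_along G \<pi> (\<lambda>g. \<beta>' (\<alpha>' g)) (\<lambda>T. ext \<beta>' (ext \<alpha>' T))"
      by (rule ucp_along_compose[OF ext_rep[OF \<beta>'(1)] ext_rep[OF \<alpha>'(1)]]) (use carr[OF \<alpha>'(1)] in auto)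
    have eq: "\<phi> (ext ?\<gamma> b) = \<phi> (ext \<alpha> (\<phi> (ext \<beta> b)))" if "b \<in> B" for b
      by (rule induced_unique[OF rep min ext_along[OF \<gamma>] \<gamma> \<gamma>'])
        (use that \<alpha>' \<beta>' carr \<alpha> \<beta> in \<open>auto simp: compose_def B_def\<close>)
    have mem: "\<phi> (ext \<beta> b) \<in> B" if "b \<in> B" for b
      using funcset_mem[OF Bij_imp_funcset[OF Bij[OF \<beta>]] that] that by (simp add: \<Phi>_def)
    show ?thesis
    proof (rule ext)
      fix b
      show "\<Phi> ?\<gamma> b = compose B (\<Phi> \<alpha>) (\<Phi> \<beta>) b"
        by (cases "b \<in> B") (simp_all add: \<Phi>_def mem eq compose_eq, simp add: compose_def)
    qed
  qed
  have "\<Phi> \<in> hom (RepAutoGroup G \<pi>) (StarAutoGroup (fh_boundary \<phi>) (choi_effros \<phi>))"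
  proof (rule homI)
    fix \<alpha> assume "\<alpha> \<in> carrier (RepAutoGroup G \<pi>)"
    then show "\<Phi> \<alpha> \<in> carrier (StarAutoGroup (fh_boundary \<phi>) (choi_effros \<phi>))"
      using auto by (simp add: RepAutoGroup_def StarAutoGroup_def B_def)
  next
    fix \<alpha> \<beta> assume "\<alpha> \<in> carrier (RepAutoGroup G \<pi>)" "\<beta> \<in> carrier (RepAutoGroup G \<pi>)"
    then have \<alpha>: "\<alpha> \<in> rep_auto G \<pi>" and \<beta>: "\<beta> \<in> rep_auto G \<pi>" by (auto simp: RepAutoGroup_def)
    then have "\<alpha> \<in> Bij (carrier G)" "\<beta> \<in> Bij (carrier G)" by (auto simp: rep_auto_def auto_def)
    then show "\<Phi> (\<alpha> \<otimes>\<^bsub>RepAutoGroup G \<pi>\<^esub> \<beta>) = \<Phi> \<alpha> \<otimes>\<^bsub>StarAutoGroup (fh_boundary \<phi>) (choi_effros \<phi>)\<^esub> \<Phi> \<beta>"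
      using mult[OF \<alpha> \<beta>] Bij[OF \<alpha>] Bij[OF \<beta>]
      by (simp add: RepAutoGroup_def AutoGroup_def StarAutoGroup_def BijGroup_def B_def)
  qed
  moreover have "\<Phi> (inner_auto G g) = (\<lambda>b\<in>fh_boundary \<phi>. op_act G \<pi> g b)" if g: "g \<in> carrier G" for g
  proof -
    have g': "inv\<^bsub>G\<^esub> g \<in> carrier G" using g by simp
    have closed: "inner_auto G k h \<in> carrier G" if "k \<in> carrier G" "h \<in> carrier G" for k h
      using that by (simp add: inner_auto_def)
    have cancel: "inner_auto G (inv\<^bsub>G\<^esub> g) (inner_auto G g h) = h"
      "inner_auto G g (inner_auto G (inv\<^bsub>G\<^esub> g) h) = h" if h: "h \<in> carrier G" for h
      using g h m_assoc[of g "inv\<^bsub>G\<^esub> g" h] m_assoc[of "inv\<^bsub>G\<^esub> g" g h]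
      by (simp_all add: inner_auto_def m_assoc)
    note Ad = ucp_along_inner_auto[OF rep g]
    have "\<phi> (ext (inner_auto G g) b) = op_act G \<pi> g b" if b: "b \<in> B" for b
    proof -
      have "\<phi> (ext (inner_auto G g) b) = \<phi> (op_act G \<pi> g b)"
        by (rule induced_unique[OF rep min ext_along[OF Ad] Ad ucp_along_inner_auto[OF rep g']])
          (use b closed[OF g] closed[OF g'] cancel in \<open>auto simp: B_def\<close>)
      also have "\<dots> = op_act G \<pi> g (\<phi> b)"
        using minimal_along g b by (simp add: ucp_along_def B_def fh_boundary_iff[OF rep min])
      finally show ?thesis using b by (simp add: B_def fh_boundary_iff[OF rep min])
    qed
    then show ?thesis by (auto simp: \<Phi>_def B_def intro!: restrict_ext)
  qed
  ultimately show ?thesis by blast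
qed

end
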